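(* Consider nearest-neighbor bond percolation on $\mathbb{Z}^d$ with $0<p<p_c(d)$. Let $\Xi^{(N)},\Psi^{(N),\kappa},\Xi^{(N),\iota},\Pi^{(N),\iota,\kappa}$ ($N\geq0$, $\iota,\kappa\in\{\pm1,\dots,\pm d\}$) be the coefficients defined in the context and let $\mu_p=p\,\mathbb{P}_p(e_1\notin\mathscr{C}(0)\mid (0,e_1)\text{ vacant})$. Then for every $M\geq1$ there are functions $R_M$ and $R^\iota_M$ on $\mathbb{Z}^d$ such that, for every $x\in\mathbb{Z}^d$ and $\iota\in\{\pm1,\dots,\pm d\}$, $$\tau(x)=\delta_{0,x}+\mu_p\sum_{y\in\mathbb{Z}^d,\ \kappa\in\{\pm1,\dots,\pm d\}}\bigl(\delta_{0,y}+\Psi_M^\kappa(y)\bigr)\tau^\kappa(x-y+e_\kappa)+\Xi_M(x),$$ $$\tau(x)=\tau^\iota(x)+\mu_p\,\tau^{-\iota}(x-e_\iota)+\sum_{y\in\mathbb{Z}^d,\ \kappa\in\{\pm1,\dots,\pm d\}}\Pi_M^{\iota,\kappa}(y)\,\tau^\kappa(x-y+e_\kappa)+\Xi_M^\iota(x),$$ where $$\Pi_M^{\iota,\kappa}(y)=\sum_{N=0}^M(-1)^N\Pi^{(N),\iota,\kappa}(y),\qquad \Xi_M(x)=R_M(x)+\sum_{N=0}^M(-1)^N\Xi^{(N)}(x),$$ $$\Psi_M^{\kappa}(y)=\sum_{N=0}^M(-1)^N\Psi^{(N),\kappa}(y),\qquad \Xi^\iota_M(x)=R^\iota_M(x)+\sum_{N=0}^M(-1)^N\Xi^{(N),\iota}(x),$$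 and $$R_M(x)\leq\mu_p\sum_{y\in\mathbb{Z}^d,\ \kappa}\Psi^{(M),\kappa}(y)\,\tau^\kappa(x-y+e_\kappa),\qquad R^\iota_M(x)\leq\sum_{y\in\mathbb{Z}^d,\ \kappa}\Pi^{(M),\iota,\kappa}(y)\,\tau^\kappa(x-y+e_\kappa).$$
   Context: **Model.** Each nearest-neighbor bond of $\mathbb{Z}^d$ is independently occupied with probability $p$, vacant otherwise; $\mathbb{P}=\mathbb{P}_p$ is the product measure, $\mathbb{E}$ its expectation. $x\leftrightarrow y$ means that there is a path of occupied bonds from $x$ to $y$; $\mathscr{C}(x)=\{y:y\leftrightarrow x\}$; $\tau(x)=\tau_p(x)=\mathbb{P}_p(0\leftrightarrow x)$; $p_c(d)=\sup\{p:\sum_x\tau_p(x)<\infty\}$. For $\iota\in\{\pm1,\dots,\pm d\}$, $e_\iota$ is the unit vector with $(e_\iota)_i=\mathrm{sign}(\iota)\delta_{|\iota|,i}$, and $b_\iota$ is the bond $(0,e_\iota)$. **Off and through.** For a vertex set $A$, $\mathrm{B}(A)$ is the set of bonds with at least one endpoint in $A$; $\mathrm{B}(v)=\mathrm{B}(\{v\})$. For a bond set $B$, "$E$ occurs off $B$" means that $E$ occurs in the configuration modified by making all bonds of $B$ vacant; off a vertex set $A$ means off $\mathrm{B}(A)$. For a deterministic bond set $B$, $\mathbb{P}^B(E)=\mathbb{P}(E\text{ occurs off }B)$, with expectation $\mathbb{E}^B$ (all random objects are evaluated in the configuration with $B$ made vacant); for a vertex $v$, $\mathbb{P}^v=\mathbb{P}^{\mathrm{B}(v)}$,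 and for a bond $b$, $\mathbb{P}^b=\mathbb{P}^{\{b\}}$. $\tau^\iota(x)=\mathbb{P}(0\leftrightarrow x\text{ off }\mathrm{B}(e_\iota))$. For a vertex set $A$, $x\xleftrightarrow{A}y$ ("through $A$") is the event that $x\leftrightarrow y$ and every occupied path from $x$ to $y$ contains a bond of $\mathrm{B}(A)$; by convention $x\xleftrightarrow{A}x$ iff $x\in A$. $x\Leftrightarrow y$ means that there are two bond-disjoint occupied paths from $x$ to $y$ (with $x\Leftrightarrow x$ always). $\tilde{\mathscr{C}}^b(x)$ is the set of vertices connected to $x$ in the configuration in which bond $b$ is made vacant. A directed bond $b=(\underline b,\overline b)$ is pivotal for $x\leftrightarrow y$ if $x\leftrightarrow\underline b$, $\overline b\leftrightarrow y$ and $y\notin\tilde{\mathscr{C}}^b(x)$. Define $$E'(v,y;A)=\{v\xleftrightarrow{A}y\}\cap\{\nexists\, b'\text{ occupied and pivotal for }v\leftrightarrow y\text{ such that }v\xleftrightarrow{A}\underline b'\}.$$ **General coefficients.** Let $x,y\in\mathbb{Z}^d$, let $A$ be a vertex set and $B$ a bond set with either $B\subseteq\mathrm{B}(x)$ (then put $A'=\varnothing$) or $B=\mathrm{B}(A')$ for a vertex set $A'$. Set $$\Xi^{B,(0)}(x,y;A)=\mathbb{P}^B(E'(x,y;A)),$$ $$\Psi^{B,(0),\kappa}(x,y;A)=\mathbf{1}_{\{(y,y-e_\kappa)\notin B\}}\,\mathbb{P}^B\bigl(E'(x,y;A)\cap\{y-e_\kappa\notin\tilde{\mathscr{C}}^{(y,y-e_\kappa)}(x)\}\bigr).$$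 For $N\geq1$, consider independent percolation configurations indexed $0,\dots,N$, with nested expectations $\mathbb{E}_0,\dots,\mathbb{E}_N$ (quantities from lower levels are treated as fixed in higher levels), and for directed bonds $b_0,\dots,b_{N-1}$ write $\tilde{\mathscr{C}}_0=\tilde{\mathscr{C}}^{b_0}_0(x)\cup A'$ and $\tilde{\mathscr{C}}_i=\tilde{\mathscr{C}}^{b_i}_i(\overline b_{i-1})\cup\{\underline b_{i-1}\}$ for $i\geq1$. Then $$\Xi^{B,(N)}(x,y;A)=p^N\sum_{b_0,\dots,b_{N-1}}\mathbb{E}^B_0\Bigl[\mathbf{1}_{E'(x,\underline b_0;A)}\mathbf{1}_{\{\overline b_0\notin\tilde{\mathscr{C}}_0\}}\mathbb{E}_1^{\underline b_0}\Bigl[\mathbf{1}_{E'(\overline b_0,\underline b_1;\tilde{\mathscr{C}}_0)}\mathbf{1}_{\{\overline b_1\notin\tilde{\mathscr{C}}_1\}}\cdots\mathbb{E}_N^{\underline b_{N-1}}\bigl[\mathbf{1}_{E'(\overline b_{N-1},y;\tilde{\mathscr{C}}_{N-1})}\bigr]\cdots\Bigr]\Bigr],$$ where level $i$ for $1\leq i\leq N-1$ carries $\mathbb{E}_i^{\underline b_{i-1}}$ with factors $\mathbf{1}_{E'(\overline b_{i-1},\underline b_i;\tilde{\mathscr{C}}_{i-1})}\mathbf{1}_{\{\overline b_i\notin\tilde{\mathscr{C}}_i\}}$; and $\Psi^{B,(N),\kappa}(x,y;A)$ is given by the same formula with the innermost factor replaced by $$\mathbb{E}_N^{\underline b_{N-1}}\bigl[\mathbf{1}_{E'(\overline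 b_{N-1},y;\tilde{\mathscr{C}}_{N-1})}\mathbf{1}_{\{y-e_\kappa\notin\tilde{\mathscr{C}}_N^{(y,y-e_\kappa)}(\overline b_{N-1})\cup\{\underline b_{N-1}\}\}}\bigr].$$ **NoBLE coefficients.** $$\Xi^{(0)}(x)=(1-\delta_{0,x})\mathbb{P}(0\Leftrightarrow x),\qquad \Psi^{(0),\kappa}(x)=(1-\delta_{0,x})\tfrac{p}{\mu_p}\,\mathbb{P}\bigl(\{0\Leftrightarrow x\}\cap\{x-e_\kappa\notin\tilde{\mathscr{C}}^{\{x,x-e_\kappa\}}(x)\}\bigr),$$ $$\Xi^{(0),\iota}(x)=\Xi^{\{b_\iota\},(0)}(0,x;\{e_\iota\}),\qquad \Pi^{(0),\iota,\kappa}(x)=p\,\Psi^{\{b_\iota\},(0),\kappa}(0,x;\{e_\iota\}),$$ and for $N\geq1$, $$\Xi^{(N)}(x)=\Xi^{\varnothing,(N)}(0,x;\{0\}),\qquad \Psi^{(N),\kappa}(x)=\tfrac{p}{\mu_p}\Psi^{\varnothing,(N),\kappa}(0,x;\{0\}),$$ $$\Xi^{(N),\iota}(x)=\Xi^{\{b_\iota\},(N)}(0,x;\{e_\iota\})+p\,\mathbb{E}^{b_\iota}\bigl[\mathbf{1}_{\{e_\iota\notin\tilde{\mathscr{C}}^{b_\iota}(0)\}}\,\Xi^{\mathrm{B}(0),(N-1)}(e_\iota,x;\tilde{\mathscr{C}}^{b_\iota}(0))\bigr],$$ $$\Pi^{(N),\iota,\kappa}(x)=p\,\Psi^{\{b_\iota\},(N),\kappa}(0,x;\{e_\iota\})+p^2\,\mathbb{E}^{b_\iota}\bigl[\mathbf{1}_{\{e_\iota\notin\tilde{\mathscr{C}}^{b_\iota}(0)\}}\,\Psi^{\mathrm{B}(0),(N-1),\kappa}(e_\iota,x;\tilde{\mathscr{C}}^{b_\iota}(0))\bigr],$$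 where $\tilde{\mathscr{C}}^{b_\iota}(0)$ is treated as a fixed set inside the coefficient it is inserted into, and $A'=\{0\}$ for $B=\mathrm{B}(0)$.
   Formalization: In the definition of a directed pivotal bond b, the connections from x to its bottom and from its top to y are required to hold with b made vacant; read verbatim, the reversal of an occupied pivotal bond would also be pivotal and the remainder bound would fail for d at least 2 and small p. *)

theory Defs
  imports "HOL-Probability.Probability"
begin

section \<open>Lattice, bonds and paths\<close>

text \<open>
  The lattice is \<open>int ^ 'd\<close>, so that \<open>d = CARD('d) \<ge> 1\<close>. A direction \<open>(s, i)\<close> stands for
  \<open>+i\<close> if \<open>s\<close> holds and for \<open>-i\<close> otherwise; the directions are thus the indices
  \<open>\<plusminus>1, \<dots>, \<plusminus>d\<close>.
\<close>

type_synonym 'd dir = "bool \<times> 'd"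
type_synonym 'd bond = "(int ^ 'd) set"
type_synonym 'd dbond = "(int ^ 'd) \<times> (int ^ 'd)"

definition unit_vec :: "'d::finite dir \<Rightarrow> int ^ 'd" where
  "unit_vec \<iota> = axis (snd \<iota>) (if fst \<iota> then 1 else - 1)"

definition opp :: "'d dir \<Rightarrow> 'd dir" where
  "opp \<iota> = (\<not> fst \<iota>, snd \<iota>)"

text \<open>The coordinates are ordered only in order to have a coordinate called 1.\<close>

definition first_dir :: "'d::{finite,linorder} dir" where
  "first_dir = (True, Min UNIV)"

definition bonds :: "'d::finite bond set" where
  "bonds = {{x, x + unit_vec \<iota>} | x \<iota>. True}"

definition dbonds :: "'d::finite dbond set" where
  "dbonds = {(u, v). {u, v} \<in> bonds}"

definition ubond :: "'d::finite dbond \<Rightarrow> 'd bond" where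
  "ubond b = {fst b, snd b}"

definition bonds_at :: "(int ^ 'd) set \<Rightarrow> 'd::finite bond set" where
  "bonds_at A = {b \<in> bonds. b \<inter> A \<noteq> {}}"

text \<open>
  A configuration is represented by its set \<open>C\<close> of occupied bonds; making the bonds of \<open>B\<close> vacant
  turns \<open>C\<close> into \<open>C - B\<close>. Paths are given by their lists of vertices. They need not be
  self-avoiding: loop erasure only removes bonds, so this affects none of the notions below.
\<close>

fun path_bonds :: "(int ^ 'd::finite) list \<Rightarrow> 'd bond set" where
  "path_bonds (u # v # vs) = insert {u, v} (path_bonds (v # vs))"
| "path_bonds _ = {}"

definition occ_path :: "'d::finite bond set \<Rightarrow> (int ^ 'd) list \<Rightarrow> int ^ 'd \<Rightarrow> int ^ 'd \<Rightarrow> bool" where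
  "occ_path C vs x y \<longleftrightarrow> vs \<noteq> [] \<and> hd vs = x \<and> last vs = y \<and> path_bonds vs \<subseteq> C"

definition conn :: "'d::finite bond set \<Rightarrow> int ^ 'd \<Rightarrow> int ^ 'd \<Rightarrow> bool" where
  "conn C x y \<longleftrightarrow> (\<exists>vs. occ_path C vs x y)"

definition cluster :: "'d::finite bond set \<Rightarrow> int ^ 'd \<Rightarrow> (int ^ 'd) set" where
  "cluster C x = {y. conn C y x}"

definition cluster_off :: "'d::finite bond set \<Rightarrow> 'd bond \<Rightarrow> int ^ 'd \<Rightarrow> (int ^ 'd) set" where
  "cluster_off C b x = cluster (C - {b}) x"

definition conn_through ::
    "'d::finite bond set \<Rightarrow> (int ^ 'd) set \<Rightarrow> int ^ 'd \<Rightarrow> int ^ 'd \<Rightarrow> bool" where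
  "conn_through C A x y \<longleftrightarrow>
     (if x = y then x \<in> A
      else conn C x y \<and> (\<forall>vs. occ_path C vs x y \<longrightarrow> path_bonds vs \<inter> bonds_at A \<noteq> {}))"

text \<open>For \<open>x = y\<close> the following holds because the trivial path has no bonds.\<close>

definition doubly_conn :: "'d::finite bond set \<Rightarrow> int ^ 'd \<Rightarrow> int ^ 'd \<Rightarrow> bool" where
  "doubly_conn C x y \<longleftrightarrow>
     (\<exists>vs ws. occ_path C vs x y \<and> occ_path C ws x y \<and> path_bonds vs \<inter> path_bonds ws = {})"

text \<open>
  Pivotality of a directed bond: the connections from \<open>x\<close> to its bottom and from its top to \<open>y\<close>
  must not use the bond itself. Otherwise, if \<open>b\<close> is occupied and pivotal, its reversal would be
  pivotal as well.
\<close>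

definition pivotal :: "'d::finite bond set \<Rightarrow> 'd dbond \<Rightarrow> int ^ 'd \<Rightarrow> int ^ 'd \<Rightarrow> bool" where
  "pivotal C b x y \<longleftrightarrow>
     conn (C - {ubond b}) x (fst b) \<and> conn (C - {ubond b}) (snd b) y \<and>
     y \<notin> cluster_off C (ubond b) x"

definition E_prime ::
    "'d::finite bond set \<Rightarrow> int ^ 'd \<Rightarrow> int ^ 'd \<Rightarrow> (int ^ 'd) set \<Rightarrow> bool" where
  "E_prime C v y A \<longleftrightarrow>
     conn_through C A v y \<and>
     \<not> (\<exists>b\<in>dbonds. ubond b \<in> C \<and> pivotal C b v y \<and> conn_through C A v (fst b))"


section \<open>Percolation measure\<close>

definition perc :: "real \<Rightarrow> ('d::finite bond \<Rightarrow> bool) measure" where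
  "perc p = PiM bonds (\<lambda>_. measure_pmf (bernoulli_pmf p))"

definition occupied :: "('d::finite bond \<Rightarrow> bool) \<Rightarrow> 'd bond set" where
  "occupied \<omega> = {b \<in> bonds. \<omega> b}"

definition prob_off :: "real \<Rightarrow> 'd::finite bond set \<Rightarrow> ('d bond set \<Rightarrow> bool) \<Rightarrow> real" where
  "prob_off p B E = \<P>(\<omega> in perc p. E (occupied \<omega> - B))"

text \<open>
  Expectations of nonnegative quantities, and the general coefficients below, take values in
  \<open>ennreal\<close>, so that they are meaningful regardless of convergence.
\<close>

definition expect_off :: "real \<Rightarrow> 'd::finite bond set \<Rightarrow> ('d bond set \<Rightarrow> ennreal) \<Rightarrow> ennreal" where
  "expect_off p B F = (\<integral>\<^sup>+ \<omega>. F (occupied \<omega> - B) \<partial>perc p)"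

definition tau :: "real \<Rightarrow> int ^ 'd::finite \<Rightarrow> real" where
  "tau p x = prob_off p {} (\<lambda>C. conn C 0 x)"

definition tau_dir :: "real \<Rightarrow> 'd::finite dir \<Rightarrow> int ^ 'd \<Rightarrow> real" where
  "tau_dir p \<iota> x = prob_off p (bonds_at {unit_vec \<iota>}) (\<lambda>C. conn C 0 x)"

definition p_crit :: "'d::finite itself \<Rightarrow> real" where
  "p_crit _ = Sup {p \<in> {0..1}. (tau p :: int ^ 'd \<Rightarrow> real) summable_on UNIV}"

definition mu :: "'d::{finite,linorder} itself \<Rightarrow> real \<Rightarrow> real" where
  "mu _ p =
     p * \<P>(\<omega> in perc p. unit_vec (first_dir :: 'd dir) \<notin> cluster (occupied \<omega>) 0
             \<bar> {0, unit_vec (first_dir :: 'd dir)} \<notin> occupied \<omega>)"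


section \<open>General coefficients\<close>

text \<open>
  The nested expectation for a fixed list \<open>b\<^sub>0, \<dots>, b\<^sub>N\<^sub>-\<^sub>1\<close> of directed bonds. A level is determined
  by the bond set \<open>B\<close> made vacant, the set \<open>A'\<close> added to the cluster, the starting point \<open>x\<close> and
  the set \<open>A\<close> passed through. At level 0 these are the data of the coefficient; at level \<open>i \<ge> 1\<close>
  they are the set of bonds at the bottom of \<open>b\<^sub>i\<^sub>-\<^sub>1\<close>, the singleton of that bottom, the top of
  \<open>b\<^sub>i\<^sub>-\<^sub>1\<close> and the (augmented) cluster of level \<open>i - 1\<close>. The innermost event is \<open>F C A' x A\<close>.
\<close>

fun nested ::
    "real \<Rightarrow> ('d::finite bond set \<Rightarrow> (int ^ 'd) set \<Rightarrow> int ^ 'd \<Rightarrow> (int ^ 'd) set \<Rightarrow> bool) \<Rightarrow>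
     'd bond set \<Rightarrow> (int ^ 'd) set \<Rightarrow> int ^ 'd \<Rightarrow> (int ^ 'd) set \<Rightarrow> 'd dbond list \<Rightarrow> ennreal" where
  "nested p F B A' x A [] = expect_off p B (\<lambda>C. of_bool (F C A' x A))"
| "nested p F B A' x A (b # bs) =
     expect_off p B (\<lambda>C.
       of_bool (E_prime C x (fst b) A) *
       of_bool (snd b \<notin> cluster_off C (ubond b) x \<union> A') *
       nested p F (bonds_at {fst b}) {fst b} (snd b) (cluster_off C (ubond b) x \<union> A') bs)"

definition nested_sum ::
    "real \<Rightarrow> ('d::finite bond set \<Rightarrow> (int ^ 'd) set \<Rightarrow> int ^ 'd \<Rightarrow> (int ^ 'd) set \<Rightarrow> bool) \<Rightarrow>
     'd bond set \<Rightarrow> (int ^ 'd) set \<Rightarrow> nat \<Rightarrow> int ^ 'd \<Rightarrow> (int ^ 'd) set \<Rightarrow> ennreal" where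
  "nested_sum p F B A' N x A =
     ennreal (p ^ N) *
     (\<Sum>\<^sub>\<infinity>bs\<in>{bs. set bs \<subseteq> dbonds \<and> length bs = N}. nested p F B A' x A bs)"

text \<open>
  The set \<open>A'\<close> accompanying \<open>B\<close> is an explicit argument: it is empty if \<open>B \<subseteq> bonds_at {x}\<close>, and
  otherwise \<open>B = bonds_at A'\<close>.
\<close>

definition Xi_gen ::
    "real \<Rightarrow> 'd::finite bond set \<Rightarrow> (int ^ 'd) set \<Rightarrow> nat \<Rightarrow> int ^ 'd \<Rightarrow> int ^ 'd \<Rightarrow> (int ^ 'd) set \<Rightarrow>
     ennreal" where
  "Xi_gen p B A' N x y A =
     (if N = 0 then ennreal (prob_off p B (\<lambda>C. E_prime C x y A))
      else nested_sum p (\<lambda>C _ x A. E_prime C x y A) B A' N x A)"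

definition Psi_gen ::
    "real \<Rightarrow> 'd::finite bond set \<Rightarrow> (int ^ 'd) set \<Rightarrow> nat \<Rightarrow> 'd dir \<Rightarrow> int ^ 'd \<Rightarrow> int ^ 'd \<Rightarrow>
     (int ^ 'd) set \<Rightarrow> ennreal" where
  "Psi_gen p B A' N \<kappa> x y A =
     (let z = y - unit_vec \<kappa> in
      if N = 0 then
        of_bool ({y, z} \<notin> B) *
        ennreal (prob_off p B (\<lambda>C. E_prime C x y A \<and> z \<notin> cluster_off C {y, z} x))
      else
        nested_sum p (\<lambda>C A' x A. E_prime C x y A \<and> z \<notin> cluster_off C {y, z} x \<union> A')
          B A' N x A)"


section \<open>NoBLE coefficients\<close>

definition Xi :: "real \<Rightarrow> nat \<Rightarrow> int ^ 'd::finite \<Rightarrow> real" where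
  "Xi p N x =
     (if N = 0 then (1 - of_bool (x = 0)) * prob_off p {} (\<lambda>C. doubly_conn C 0 x)
      else enn2real (Xi_gen p {} {} N 0 x {0}))"

definition Psi ::
    "real \<Rightarrow> nat \<Rightarrow> ('d::{finite,linorder}) dir \<Rightarrow> int ^ ('d::{finite,linorder}) \<Rightarrow> real" where
  "Psi p N \<kappa> x =
     (if N = 0 then
        (1 - of_bool (x = 0)) * (p / mu TYPE('d) p) *
        prob_off p {} (\<lambda>C. doubly_conn C 0 x \<and>
          x - unit_vec \<kappa> \<notin> cluster_off C {x, x - unit_vec \<kappa>} x)
      else p / mu TYPE('d) p * enn2real (Psi_gen p {} {} N \<kappa> 0 x {0}))"

definition Xi_dir :: "real \<Rightarrow> nat \<Rightarrow> 'd::finite dir \<Rightarrow> int ^ 'd \<Rightarrow> real" where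
  "Xi_dir p N \<iota> x =
     (let e = unit_vec \<iota>; b = {0, e} in
      if N = 0 then enn2real (Xi_gen p {b} {} 0 0 x {e})
      else enn2real
        (Xi_gen p {b} {} N 0 x {e} +
         ennreal p * expect_off p {b} (\<lambda>C.
           of_bool (e \<notin> cluster_off C b 0) *
           Xi_gen p (bonds_at {0}) {0} (N - 1) e x (cluster_off C b 0))))"

definition Pi_dir :: "real \<Rightarrow> nat \<Rightarrow> 'd::finite dir \<Rightarrow> 'd dir \<Rightarrow> int ^ 'd \<Rightarrow> real" where
  "Pi_dir p N \<iota> \<kappa> x =
     (let e = unit_vec \<iota>; b = {0, e} in
      if N = 0 then p * enn2real (Psi_gen p {b} {} 0 \<kappa> 0 x {e})
      else enn2real
        (ennreal p * Psi_gen p {b} {} N \<kappa> 0 x {e} +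
         ennreal (p\<^sup>2) * expect_off p {b} (\<lambda>C.
           of_bool (e \<notin> cluster_off C b 0) *
           Psi_gen p (bonds_at {0}) {0} (N - 1) \<kappa> e x (cluster_off C b 0))))"

end

theory Submission
  imports Defs
begin

text \<open>
  If \<open>v\<close> is connected to \<open>x\<close> through \<open>A\<close> but \<open>E'(v, x; A)\<close> fails, there is a unique first occupied
  pivotal bond \<open>b\<close> whose bottom is connected to \<open>v\<close> through \<open>A\<close>. Given the cluster \<open>S\<close> of \<open>v\<close> off
  \<open>b\<close>, the state of \<open>b\<close> and the connection from its top to \<open>x\<close> off \<open>S\<close> are independent of
  \<open>E'(v, fst b; A)\<close>. Connections off \<open>S\<close> are those avoiding the bottom of \<open>b\<close> minus those passing
  through \<open>S\<close>; the latter are of the original form, so that the argument can be iterated, and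
  dropping the subtracted term bounds the remainder. Below \<open>p\<^sub>c\<close> the susceptibility is finite, which
  makes clusters almost surely finite and all the sums convergent.
\<close>

section \<open>Connections and Menger's theorem\<close>

text \<open>Each order of the expansion is kept as an identity between sums of nonnegative terms,
  r_N + r_(N+1) = xi_N + s_N: here r_N is the nested expectation ending in a through-connection,
  xi_N the one ending in \<open>E_prime\<close>, and in s_N a last bond is weighted by a two-point
  function that avoids its bottom. In \<open>ennreal\<close> such identities survive integration and
  summation, while subtraction is ill behaved; alternating signs enter only after all terms are
  known to be finite. Independence requires that, on the event that the cluster is \<open>S\<close>,
  the remaining conditions concern disjoint sets of bonds. This is why clusters are augmented by the
  set \<open>A'\<close>, whose bonds are vacant already. Menger's theorem links
  \<open>E_prime\<close> to the coefficients of order 0: if \<open>A\<close> is just the starting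
  point, \<open>E_prime\<close> says that no occupied bond is pivotal, while the coefficients speak
  of two disjoint paths. The Kronecker delta beside \<Psi> is the trivial term of order 0 at the
  origin, whose weight, including a factor \<open>p\<close>, is exactly \<mu>.\<close>

lemma conn_iff_rtrancl: "conn C x y \<longleftrightarrow> (x, y) \<in> {(u, v). {u, v} \<in> C}\<^sup>*"
proof
  have "(hd vs, last vs) \<in> {(u, v). {u, v} \<in> C}\<^sup>*" if "vs \<noteq> []" "path_bonds vs \<subseteq> C" for vs
    using that by (induction vs rule: path_bonds.induct) (auto intro: converse_rtrancl_into_rtrancl)
  then show "conn C x y \<Longrightarrow> (x, y) \<in> {(u, v). {u, v} \<in> C}\<^sup>*"
    by (auto simp: conn_def occ_path_def)
next
  assume "(x, y) \<in> {(u, v). {u, v} \<in> C}\<^sup>*"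
  then show "conn C x y"
  proof (induction rule: converse_rtrancl_induct)
    case base
    have "occ_path C [y] y y" by (simp add: occ_path_def)
    then show ?case unfolding conn_def by blast
  next
    case (step u v)
    then obtain vs where vs: "occ_path C vs v y" by (auto simp: conn_def)
    then have "occ_path C (u # vs) u y"
      using step(1) by (cases vs) (auto simp: occ_path_def)
    then show ?case unfolding conn_def by blast
  qed
qed

lemma conn_refl [simp]: "conn C x x"
  by (simp add: conn_iff_rtrancl)

lemma conn_trans: "conn C x y \<Longrightarrow> conn C y z \<Longrightarrow> conn C x z"
  by (auto simp: conn_iff_rtrancl)

lemma conn_edge: "{x, y} \<in> C \<Longrightarrow> conn C x y"
  by (auto simp: conn_iff_rtrancl)

lemma conn_sym: "conn C x y \<longleftrightarrow> conn C y x"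
proof -
  have "sym {(u, v). {u, v} \<in> C}" by (auto simp: sym_def insert_commute)
  then show ?thesis unfolding conn_iff_rtrancl by (metis sym_rtrancl symE)
qed

lemma conn_mono: "conn C x y \<Longrightarrow> C \<subseteq> D \<Longrightarrow> conn D x y"
  by (auto simp: conn_def occ_path_def)

lemma conn_induct [consumes 1, case_names refl step]:
  assumes "conn C x y" "P x" "\<And>u v. conn C x u \<Longrightarrow> {u, v} \<in> C \<Longrightarrow> P u \<Longrightarrow> P v"
  shows "P y"
proof -
  have "(x, y) \<in> {(u, v). {u, v} \<in> C}\<^sup>*" using assms(1) by (simp add: conn_iff_rtrancl)
  then show ?thesis
  proof (induction rule: rtrancl_induct)
    case base show ?case by (rule assms)
  next
    case (step u v) then show ?case using assms(3)[of u v] by (auto simp: conn_iff_rtrancl)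
  qed
qed

lemma in_cluster: "y \<in> cluster C x \<longleftrightarrow> conn C x y"
  by (simp add: cluster_def conn_sym[of C y])

lemma in_cluster_off: "y \<in> cluster_off C b x \<longleftrightarrow> conn (C - {b}) x y"
  by (simp add: cluster_off_def in_cluster)

text \<open>Induction on the endpoint: a bond stepping out of \<open>W\<close> is itself the new
  last exit, followed by the trivial path; a step outside \<open>W\<close> prolongs the path after
  the old exit by a bond that does not touch \<open>W\<close>.\<close>

lemma last_exit:
  assumes "conn D x y" "x \<in> W" "y \<notin> W"
  obtains v w where "v \<in> W" "w \<notin> W" "{v, w} \<in> D" "conn (D - {b. b \<inter> W \<noteq> {}}) w y"
proof -
  have "\<exists>v w. v \<in> W \<and> w \<notin> W \<and> {v, w} \<in> D \<and> conn (D - {b. b \<inter> W \<noteq> {}}) w z"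
    if "conn D x z" "z \<notin> W" for z
  proof -
    have "z \<notin> W \<longrightarrow> (\<exists>v w. v \<in> W \<and> w \<notin> W \<and> {v, w} \<in> D \<and> conn (D - {b. b \<inter> W \<noteq> {}}) w z)"
      using that(1)
    proof (induction rule: conn_induct)
      case refl then show ?case using assms by simp
    next
      case (step u v)
      show ?case
      proof (cases "u \<in> W")
        case True then show ?thesis using step conn_refl by blast
      next
        case False
        show ?thesis
        proof
          assume "v \<notin> W"
          then have "{u, v} \<in> D - {b. b \<inter> W \<noteq> {}}" using False step by auto
          then show "\<exists>w x. w \<in> W \<and> x \<notin> W \<and> {w, x} \<in> D \<and> conn (D - {b. b \<inter> W \<noteq> {}}) x v"
            using step False conn_edge conn_trans by meson
        qed
      qed
    qed
    then show ?thesis using that by blast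
  qed
  then show ?thesis using assms that by blast
qed

text \<open>Take the last exit from the cluster of \<open>x\<close> off \<beta>. Only \<beta> can
  leave that cluster, since any other bond of \<open>D\<close> would enlarge it. The result also
  tells in which direction \<beta> is crossed.\<close>

lemma conn_leaves_cluster:
  assumes "conn D x y" "\<not> conn (D - {\<beta>}) x y"
  obtains u w where "\<beta> = {u, w}" "\<beta> \<in> D" "conn (D - {\<beta>}) x u"
    "conn (D - {b. b \<inter> cluster (D - {\<beta>}) x \<noteq> {}}) w y" "\<not> conn (D - {\<beta>}) x w"
proof -
  let ?W = "cluster (D - {\<beta>}) x"
  obtain v w where *: "v \<in> ?W" "w \<notin> ?W" "{v, w} \<in> D" "conn (D - {b. b \<inter> ?W \<noteq> {}}) w y"
    using last_exit[of D x y ?W] assms by (auto simp: in_cluster)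
  have "{v, w} = \<beta>"
  proof (rule ccontr)
    assume "{v, w} \<noteq> \<beta>"
    then have "conn (D - {\<beta>}) v w" using * by (intro conn_edge) auto
    then show False using * by (auto simp: in_cluster intro: conn_trans)
  qed
  then show ?thesis using * that by (auto simp: in_cluster)
qed

text \<open>A connection from \<open>v\<close> that needs the bond crosses it from \<open>u\<close>
  to \<open>w\<close> and goes on to \<open>z\<close>; then \<open>w\<close> would be joined to
  \<open>v\<close> by way of \<open>z\<close> without the bond. The subset \<open>D\<close> leaves
  room for configurations with further bonds removed, such as those off \<open>A\<close>.\<close>

lemma conn_within_cluster_iff:
  assumes "\<not> conn (C - {{u, w}}) v w" "D \<subseteq> C" "conn (C - {{u, w}}) v z"
  shows "conn D v z \<longleftrightarrow> conn (D - {{u, w}}) v z"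
proof
  assume "conn (D - {{u, w}}) v z" then show "conn D v z" by (rule conn_mono) auto
next
  assume D: "conn D v z"
  show "conn (D - {{u, w}}) v z"
  proof (rule ccontr)
    assume "\<not> ?thesis"
    then obtain u' w' where *: "{u, w} = {u', w'}" "conn (D - {{u, w}}) v u'"
      "conn (D - {b. b \<inter> cluster (D - {{u, w}}) v \<noteq> {}}) w' z"
      using conn_leaves_cluster[OF D] by metis
    have sub: "D - {{u, w}} \<subseteq> C - {{u, w}}" using assms by auto
    have "u' \<noteq> w" using * assms(1) conn_mono[OF _ sub] by metis
    then have uw: "u' = u" "w' = w" using * by (auto simp: doubleton_eq_iff)
    have "conn (C - {{u, w}}) w z"
      by (rule conn_mono[OF *(3)[unfolded uw]]) (use *(2) sub uw in \<open>auto simp: in_cluster\<close>)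
    then have "conn (C - {{u, w}}) v w" using conn_trans[OF assms(3)] conn_sym[of _ w z] by blast
    then show False using assms(1) by simp
  qed
qed

lemma conn_through_iff:
  "conn_through C A x y \<longleftrightarrow>
     (if x = y then x \<in> A else conn C x y \<and> \<not> conn (C - bonds_at A) x y)"
proof -
  have "occ_path (C - bonds_at A) vs x y \<longleftrightarrow> occ_path C vs x y \<and> path_bonds vs \<inter> bonds_at A = {}" for vs
    by (auto simp: occ_path_def)
  then show ?thesis unfolding conn_through_def conn_def by metis
qed

lemma conn_through_imp_conn: "conn_through C A x y \<Longrightarrow> conn C x y"
  by (auto simp: conn_through_iff split: if_splits)

lemma E_prime_imp_conn: "E_prime C x y A \<Longrightarrow> conn C x y"
  by (auto simp: E_prime_def conn_through_imp_conn)

lemma conn_isolated: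
  assumes "conn (C - bonds_at A) x y" "x \<in> A" "C \<subseteq> bonds"
  shows "x = y"
  using assms(1)
proof (induction rule: conn_induct)
  case (step u v)
  then show ?case using assms by (auto simp: bonds_at_def)
qed simp

lemma conn_isolated':
  assumes "conn (C - bonds_at A) x y" "y \<in> A" "C \<subseteq> bonds"
  shows "x = y"
  using conn_isolated[of C A y x] assms conn_sym by metis

lemma conn_off_cluster:
  assumes "D \<subseteq> bonds" "conn D w y" "\<not> conn D v w"
  shows "conn (D - bonds_at (cluster D v)) w y" "\<not> conn D v y"
proof -
  have "conn (D - bonds_at (cluster D v)) w y \<and> \<not> conn D v y"
    using assms(2)
  proof (induction rule: conn_induct)
    case refl then show ?case using assms by simp
  next
    case (step a b)
    have "\<not> conn D v b"
      using step conn_edge[of b a D] conn_trans[of D v b a] by (auto simp: insert_commute)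
    then have "{a, b} \<in> D - bonds_at (cluster D v)"
      using step by (auto simp: bonds_at_def in_cluster)
    then show ?case using step conn_edge conn_trans \<open>\<not> conn D v b\<close> by meson
  qed
  then show "conn (D - bonds_at (cluster D v)) w y" "\<not> conn D v y" by auto
qed

subsection \<open>Two bond-disjoint connections\<close>

text \<open>Bond sets instead of paths: they can be enlarged, trimmed and rerouted without keeping
  track of vertex lists.\<close>

definition disjoint_conn :: "'d::finite bond set \<Rightarrow> int ^ 'd \<Rightarrow> int ^ 'd \<Rightarrow> bool" where
  "disjoint_conn D x y \<longleftrightarrow>
     (\<exists>F G. F \<subseteq> D \<and> G \<subseteq> D \<and> F \<inter> G = {} \<and> conn F x y \<and> conn G x y)"

lemma doubly_conn_iff_disjoint: "doubly_conn D x y \<longleftrightarrow> disjoint_conn D x y"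
proof
  assume "doubly_conn D x y"
  then obtain vs ws where *: "occ_path D vs x y" "occ_path D ws x y" "path_bonds vs \<inter> path_bonds ws = {}"
    by (auto simp: doubly_conn_def)
  then have "conn (path_bonds vs) x y" "conn (path_bonds ws) x y"
    by (auto simp: conn_def occ_path_def)
  then show "disjoint_conn D x y"
    using * unfolding disjoint_conn_def occ_path_def by blast
next
  assume "disjoint_conn D x y"
  then show "doubly_conn D x y"
    unfolding disjoint_conn_def doubly_conn_def conn_def occ_path_def by blast
qed

text \<open>Trimming \<open>F\<close> to the component of \<open>x\<close> ensures that meeting any
  remaining bond means meeting a vertex that \<open>x\<close> reaches within
  \<open>F\<close>.\<close>

lemma conn_restrict_cluster:
  assumes "conn F x y"
  shows "conn {b \<in> F. \<exists>z\<in>b. conn F x z} x y"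
  using assms
proof (induction rule: conn_induct)
  case (step u v)
  then have "{u, v} \<in> {b \<in> F. \<exists>z\<in>b. conn F x z}" by auto
  then show ?case using step conn_edge conn_trans by meson
qed simp

text \<open>An augmenting-path argument. The return path from \<open>w\<close> to \<open>v\<close>
  is followed until it first meets one of the two trimmed connections, at \<open>a\<close>. That
  connection is redirected from \<open>a\<close> to \<open>w\<close> along \<open>H\<close>; the
  other one is prolonged from \<open>v\<close> by the bond \<open>{v, w}\<close>, which is still
  free.\<close>

lemma disjoint_conn_step_avoid:
  assumes FG: "F \<subseteq> D" "G \<subseteq> D" "F \<inter> G = {}" "conn F x v" "conn G x v"
    and b: "{v, w} \<in> D" "{v, w} \<notin> F" "{v, w} \<notin> G" and wv: "conn (D - {{v, w}}) w v"
  shows "disjoint_conn D x w"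
proof -
  define F' where "F' = {b \<in> F. \<exists>z\<in>b. conn F x z}"
  define G' where "G' = {b \<in> G. \<exists>z\<in>b. conn G x z}"
  have F': "conn F' x v" "F' \<subseteq> F" and G': "conn G' x v" "G' \<subseteq> G"
    using conn_restrict_cluster FG by (auto simp: F'_def G'_def)
  define H where "H = D - {{v, w}} - F' - G'"
  have "\<exists>a. conn H w a \<and> (conn F x a \<or> conn G x a)"
  proof (rule ccontr)
    assume no: "\<not> ?thesis"
    then have "v \<notin> cluster H w" using FG by (auto simp: in_cluster)
    \<comment> \<open>On the way to \<open>v\<close> the cluster of \<open>w\<close> in
      \<open>H\<close> has to be left. The bond that leaves it is missing from \<open>H\<close>,
      hence belongs to one of the trimmed connections.\<close>
    then obtain a c where ac: "a \<in> cluster H w" "c \<notin> cluster H w" "{a, c} \<in> D - {{v, w}}"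
      using last_exit[OF wv, of "cluster H w"] by (metis conn_refl in_cluster)
    then have "{a, c} \<notin> H" by (auto simp: in_cluster intro: conn_trans conn_edge)
    then consider "{a, c} \<in> F'" | "{a, c} \<in> G'" using ac by (auto simp: H_def)
    then have "conn F x a \<or> conn G x a"
    proof cases
      case 1
      then have "conn F x a \<or> conn F x c" "conn F a c" "conn F c a"
        by (auto simp: F'_def conn_edge conn_sym[of F c])
      then show ?thesis using conn_trans by blast
    next
      case 2
      then have "conn G x a \<or> conn G x c" "conn G a c" "conn G c a"
        by (auto simp: G'_def conn_edge conn_sym[of G c])
      then show ?thesis using conn_trans by blast
    qed
    then show False using no ac by (auto simp: in_cluster)
  qed
  then obtain a where a: "conn H a w" "conn F x a \<or> conn G x a" using conn_sym by metis
  have main: "disjoint_conn D x w"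
    if "conn P x a" "conn Q x v" "P \<inter> Q = {}" "P \<subseteq> D" "Q \<subseteq> D" "{v, w} \<notin> P" "H \<inter> Q = {}" for P Q
  proof -
    have "conn (P \<union> H) x w"
      by (rule conn_trans[OF conn_mono[OF that(1)] conn_mono[OF a(1)]]) auto
    moreover have "conn (insert {v, w} Q) x w"
      by (rule conn_trans[OF conn_mono[OF that(2)] conn_edge]) auto
    moreover have "(P \<union> H) \<inter> insert {v, w} Q = {}" using that by (auto simp: H_def)
    moreover have "P \<union> H \<subseteq> D" "insert {v, w} Q \<subseteq> D" using that b by (auto simp: H_def)
    ultimately show ?thesis unfolding disjoint_conn_def by blast
  qed
  from a(2) show ?thesis
  proof
    assume "conn F x a"
    then have "conn F' x a" using conn_restrict_cluster by (auto simp: F'_def)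
    then show ?thesis by (rule main[OF _ G'(1)]) (use F' G' FG b in \<open>auto simp: H_def\<close>)
  next
    assume "conn G x a"
    then have "conn G' x a" using conn_restrict_cluster by (auto simp: G'_def)
    then show ?thesis by (rule main[OF _ F'(1)]) (use F' G' FG b in \<open>auto simp: H_def\<close>)
  qed
qed

lemma disjoint_conn_step_use:
  assumes FG: "F \<subseteq> D" "G \<subseteq> D" "F \<inter> G = {}" "conn F x v" "conn G x v"
    and b: "{v, w} \<in> F" and wv: "conn (D - {{v, w}}) w v"
  shows "disjoint_conn D x w"
proof (cases "conn (F - {{v, w}}) x v")
  case True
  show ?thesis
    by (rule disjoint_conn_step_avoid[of "F - {{v, w}}" D G x v w]) (use assms True in auto)
next
  case False
  then obtain u u' where *: "{v, w} = {u, u'}" "conn (F - {{v, w}}) x u"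
    using conn_leaves_cluster[OF FG(4)] by metis
  then have "u = w" using False by (auto simp: doubleton_eq_iff)
  then have "conn (F - {{v, w}}) x w" using * by simp
  moreover have "conn (insert {v, w} G) x w"
    by (rule conn_trans[OF conn_mono[OF FG(5)] conn_edge]) auto
  moreover have "(F - {{v, w}}) \<inter> insert {v, w} G = {}" "F - {{v, w}} \<subseteq> D" "insert {v, w} G \<subseteq> D"
    using FG b by auto
  ultimately show ?thesis unfolding disjoint_conn_def by blast
qed

lemma disjoint_conn_step:
  assumes "disjoint_conn D x v" "{v, w} \<in> D" "conn (D - {{v, w}}) w v"
  shows "disjoint_conn D x w"
proof -
  obtain F G where FG: "F \<subseteq> D" "G \<subseteq> D" "F \<inter> G = {}" "conn F x v" "conn G x v"
    using assms(1) by (auto simp: disjoint_conn_def)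
  consider "{v, w} \<in> F" | "{v, w} \<in> G" | "{v, w} \<notin> F" "{v, w} \<notin> G" by blast
  then show ?thesis
  proof cases
    case 1 then show ?thesis using disjoint_conn_step_use FG assms by blast
  next
    case 2
    have "G \<inter> F = {}" using FG by blast
    then show ?thesis using 2 disjoint_conn_step_use[of G D F] FG assms by blast
  next
    case 3 then show ?thesis using disjoint_conn_step_avoid FG assms by blast
  qed
qed

lemma disjoint_conn_remove:
  assumes "disjoint_conn D x v"
  shows "conn (D - {\<beta>}) x v"
proof -
  obtain F G where FG: "F \<subseteq> D" "G \<subseteq> D" "F \<inter> G = {}" "conn F x v" "conn G x v"
    using assms by (auto simp: disjoint_conn_def)
  then have "F \<subseteq> D - {\<beta>} \<or> G \<subseteq> D - {\<beta>}" by blast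
  then show ?thesis using FG conn_mono[of F x v] conn_mono[of G x v] by blast
qed

text \<open>
  Menger's theorem for two bond-disjoint paths. Let \<open>W\<close> be the set of vertices doubly connected to
  \<open>x\<close>. A bond through which a path leaves \<open>W\<close> for the last time would separate \<open>W\<close> from \<open>y\<close>.
\<close>

lemma doubly_conn_iff: "doubly_conn D x y \<longleftrightarrow> (\<forall>\<beta>. conn (D - {\<beta>}) x y)"
proof
  assume "doubly_conn D x y"
  then show "\<forall>\<beta>. conn (D - {\<beta>}) x y" by (simp add: doubly_conn_iff_disjoint disjoint_conn_remove)
next
  assume *: "\<forall>\<beta>. conn (D - {\<beta>}) x y"
  define W where "W = {w. disjoint_conn D x w}"
  have "x \<in> W" unfolding W_def disjoint_conn_def by (auto intro!: exI[of _ "{}"])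
  have "conn D x y" using *[rule_format, of "{}"] by (rule conn_mono) auto
  have "y \<in> W"
  proof (rule ccontr)
    assume "y \<notin> W"
    with \<open>conn D x y\<close> \<open>x \<in> W\<close> obtain v w where vw: "v \<in> W" "w \<notin> W" "{v, w} \<in> D"
      "conn (D - {b. b \<inter> W \<noteq> {}}) w y" using last_exit by metis
    have "conn (D - {{v, w}}) w y" using vw(4) by (rule conn_mono) (use vw in auto)
    moreover have "conn (D - {{v, w}}) x v"
      using vw(1) disjoint_conn_remove by (auto simp: W_def)
    \<comment> \<open>The return path goes from \<open>w\<close> to \<open>y\<close> after the last
      exit, from \<open>y\<close> to \<open>x\<close> off the bond by assumption, and from
      \<open>x\<close> to \<open>v\<close> along whichever disjoint connection avoids the
      bond.\<close>
    ultimately have "conn (D - {{v, w}}) w v"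
      using conn_trans[OF _ conn_trans, of _ w y x v] * conn_sym[of "D - {{v, w}}" x y] by blast
    then have "disjoint_conn D x w" using disjoint_conn_step[of D x v w] vw(1,3) by (simp add: W_def)
    then show False using vw(2) by (simp add: W_def)
  qed
  then show "doubly_conn D x y" by (simp add: doubly_conn_iff_disjoint W_def)
qed

section \<open>The first pivotal bond\<close>

lemma dbonds_ne: "b \<in> dbonds \<Longrightarrow> fst b \<noteq> snd b"
proof
  assume "b \<in> dbonds" "fst b = snd b"
  then obtain x \<iota> where "{snd b} = {x, x + unit_vec \<iota>}"
    by (cases b) (auto simp: dbonds_def bonds_def)
  then have "unit_vec \<iota> = 0" by (auto simp: doubleton_eq_iff)
  then have "unit_vec \<iota> $ snd \<iota> = 0" by simp
  then show False by (auto simp: unit_vec_def axis_def split: if_splits)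
qed

lemma ubond_in_bonds: "b \<in> dbonds \<longleftrightarrow> ubond b \<in> bonds"
  by (cases b) (auto simp: dbonds_def ubond_def)

lemma pivotal_iff:
  "pivotal D b v x \<longleftrightarrow>
     conn (D - {ubond b}) v (fst b) \<and> conn (D - {ubond b}) (snd b) x \<and> \<not> conn (D - {ubond b}) v x"
  by (simp add: pivotal_def in_cluster_off)

lemma pivotal_imp_not_conn_top:
  assumes "pivotal D b v x"
  shows "\<not> conn (D - {ubond b}) v (snd b)"
  using assms conn_trans by (metis pivotal_iff)

lemma pivotal_imp_conn:
  assumes "pivotal D b v x" "ubond b \<in> D"
  shows "conn D v x"
proof -
  have "conn D v (fst b)" "conn D (snd b) x"
    using assms(1) conn_mono[of "D - {ubond b}" _ _ D] by (auto simp: pivotal_iff)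
  moreover have "conn D (fst b) (snd b)" using assms(2) by (simp add: conn_edge ubond_def)
  ultimately show ?thesis using conn_trans[of D] by metis
qed

text \<open>
  For an occupied bond \<open>b\<close> these are the configurations in which \<open>b\<close> is the first pivotal bond for
  \<open>v \<leftrightarrow> x\<close> whose bottom is connected to \<open>v\<close> through \<open>A\<close>.
\<close>

definition first_pivotal ::
    "'d::finite bond set \<Rightarrow> int ^ 'd \<Rightarrow> int ^ 'd \<Rightarrow> (int ^ 'd) set \<Rightarrow> 'd dbond \<Rightarrow> bool" where
  "first_pivotal D v x A b \<longleftrightarrow>
     ubond b \<in> D \<and> E_prime D v (fst b) A \<and> snd b \<notin> cluster_off D (ubond b) v \<and>
     conn (D - bonds_at (cluster_off D (ubond b) v)) (snd b) x"

lemma conn_off_top_iff: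
  assumes "\<not> conn (C - {ubond b}) v (snd b)" "D \<subseteq> C" "conn (C - {ubond b}) v z"
  shows "conn D v z \<longleftrightarrow> conn (D - {ubond b}) v z"
  using conn_within_cluster_iff[of C "fst b" "snd b" v D z] assms by (simp add: ubond_def)

text \<open>A bond that is needed is crossed from an end reached without it. This end is not the
  top, so it is the bottom, which is then reached without the bond.\<close>

lemma conn_bottom_off:
  assumes "conn D v (fst b)" "\<not> conn (D - {ubond b}) v (snd b)"
  shows "conn (D - {ubond b}) v (fst b)"
proof (rule ccontr)
  assume no: "\<not> ?thesis"
  obtain u w where *: "ubond b = {u, w}" "conn (D - {ubond b}) v u"
    using conn_leaves_cluster[OF assms(1) no] by metis
  then have "u = fst b \<or> u = snd b" by (auto simp: ubond_def doubleton_eq_iff)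
  then show False using * no assms by auto
qed

lemma first_pivotal_imp:
  assumes D: "D \<subseteq> bonds" and f: "first_pivotal D v x A b"
  shows "pivotal D b v x" "conn_through D A v (fst b)" "conn_through D A v x"
proof -
  let ?S = "cluster_off D (ubond b) v"
  have b: "ubond b \<in> D" "E_prime D v (fst b) A" "\<not> conn (D - {ubond b}) v (snd b)"
    "conn (D - bonds_at ?S) (snd b) x"
    using f by (auto simp: first_pivotal_def in_cluster_off)
  show A: "conn_through D A v (fst b)" using b by (simp add: E_prime_def)
  then have "conn D v (fst b)" by (rule conn_through_imp_conn)
  then have u: "conn (D - {ubond b}) v (fst b)" using b conn_bottom_off by blast
  have "ubond b \<in> bonds_at ?S" using D b u by (auto simp: bonds_at_def in_cluster_off ubond_def)
  then have w: "conn (D - {ubond b}) (snd b) x" by (intro conn_mono[OF b(4)]) auto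
  have x: "\<not> conn (D - {ubond b}) v x"
    using conn_off_cluster(2)[OF _ w b(3)] D by auto
  show p: "pivotal D b v x" using u w x by (simp add: pivotal_iff)
  have vx: "conn D v x" using p b by (rule_tac pivotal_imp_conn)
  have "v \<noteq> x" using x by auto
  \<comment> \<open>A connection off \<open>A\<close> would still have to cross \<open>b\<close>,
    hence would reach \<open>fst b\<close> off \<open>A\<close>. This is compatible with
    \<open>conn_through D A v (fst b)\<close> only if \<open>v = fst b\<close> lies in
    \<open>A\<close>, and then \<open>v\<close> has no bonds left off \<open>A\<close>.\<close>
  moreover have "\<not> conn (D - bonds_at A) v x"
  proof
    assume c: "conn (D - bonds_at A) v x"
    have sub: "D - bonds_at A - {ubond b} \<subseteq> D - {ubond b}" by auto
    have nc: "\<not> conn (D - bonds_at A - {ubond b}) v x" using x conn_mono[OF _ sub] by blast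
    obtain u' w' where *: "ubond b = {u', w'}" "conn (D - bonds_at A - {ubond b}) v u'"
      using conn_leaves_cluster[OF c nc] by metis
    have "conn (D - {ubond b}) v u'" using *(2) sub by (rule conn_mono)
    then have "u' = fst b" using * b(3) by (auto simp: ubond_def doubleton_eq_iff)
    then have "conn (D - bonds_at A) v (fst b)" using *(2) by (auto intro: conn_mono)
    then have "v \<in> A" using A by (auto simp: conn_through_iff split: if_splits)
    then show False using conn_isolated[OF c _ D] \<open>v \<noteq> x\<close> by simp
  qed
  ultimately show "conn_through D A v x" using vx by (simp add: conn_through_iff)
qed

lemma pivotal_imp_first_off:
  assumes "D \<subseteq> bonds" "pivotal D b v x"
  shows "snd b \<notin> cluster_off D (ubond b) v" 
    "conn (D - bonds_at (cluster_off D (ubond b) v)) (snd b) x"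
proof -
  have n: "\<not> conn (D - {ubond b}) v (snd b)" using assms pivotal_imp_not_conn_top by blast
  then show "snd b \<notin> cluster_off D (ubond b) v" by (simp add: in_cluster_off)
  have "conn (D - {ubond b} - bonds_at (cluster (D - {ubond b}) v)) (snd b) x"
    using conn_off_cluster(1)[OF _ _ n, of x] assms by (auto simp: pivotal_iff)
  then show "conn (D - bonds_at (cluster_off D (ubond b) v)) (snd b) x"
    unfolding cluster_off_def by (rule conn_mono) auto
qed

text \<open>As \<open>b\<close> cannot be avoided, it suffices to know which end is reached without
  it: the crossing starts there, and the path after the last exit from the cluster avoids
  \<open>b\<close>.\<close>

lemma pivotal_orient:
  assumes "conn D v x" "\<not> conn (D - {ubond b}) v x" "conn (D - {ubond b}) v (fst b)"
    "\<not> conn (D - {ubond b}) v (snd b)"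
  shows "pivotal D b v x"
proof -
  obtain u w where *: "ubond b = {u, w}" "ubond b \<in> D" "conn (D - {ubond b}) v u"
    "conn (D - {b'. b' \<inter> cluster (D - {ubond b}) v \<noteq> {}}) w x"
    using conn_leaves_cluster[OF assms(1,2)] by metis
  then have "u = fst b" "w = snd b" using assms by (auto simp: ubond_def doubleton_eq_iff)
  moreover have "conn (D - {ubond b}) w x"
    using *(4) by (rule conn_mono) (use *(1,3) in \<open>auto simp: in_cluster\<close>)
  ultimately show ?thesis using assms by (simp add: pivotal_iff)
qed

text \<open>A path to \<open>x\<close> reaches \<open>fst b\<close> before it crosses
  \<open>b\<close>. If it avoided \<open>b'\<close>, so would its part up to
  \<open>fst b\<close>.\<close>

lemma pivotal_trans:
  assumes b: "pivotal D b v x" and b': "pivotal D b' v (fst b)" "ubond b' \<in> D"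
    and ne: "ubond b \<in> D"
  shows "pivotal D b' v x"
proof (rule pivotal_orient)
  show "conn D v x" using b ne by (rule pivotal_imp_conn)
  show "conn (D - {ubond b'}) v (fst b')" using b' by (simp add: pivotal_iff)
  show "\<not> conn (D - {ubond b'}) v (snd b')" using b' pivotal_imp_not_conn_top by blast
  show "\<not> conn (D - {ubond b'}) v x"
  proof
    assume c: "conn (D - {ubond b'}) v x"
    have sub: "D - {ubond b'} - {ubond b} \<subseteq> D - {ubond b}" by auto
    have "\<not> conn (D - {ubond b'} - {ubond b}) v x"
      using b conn_mono[OF _ sub] by (auto simp: pivotal_iff)
    then obtain u w where *: "ubond b = {u, w}" "conn (D - {ubond b'} - {ubond b}) v u"
      using conn_leaves_cluster[OF c] by metis
    have "conn (D - {ubond b}) v u" using *(2) sub by (rule conn_mono)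
    then have "u = fst b" using * b pivotal_imp_not_conn_top[OF b] by (auto simp: ubond_def doubleton_eq_iff)
    then have "conn (D - {ubond b'}) v (fst b)" using *(2) by (auto intro: conn_mono)
    then show False using b' by (simp add: pivotal_iff)
  qed
qed

text \<open>The pivotal bonds of a connection are ordered along every path. Walk lengths are a cheap
  substitute for this order: a walk to a vertex beyond a pivotal bond has visited the bottom of that
  bond at an earlier time.\<close>

fun steps :: "'d::finite bond set \<Rightarrow> int ^ 'd \<Rightarrow> nat \<Rightarrow> int ^ 'd \<Rightarrow> bool" where
  "steps D v 0 x \<longleftrightarrow> x = v"
| "steps D v (Suc n) x \<longleftrightarrow> (\<exists>u. steps D v n u \<and> {u, x} \<in> D)"

lemma conn_steps: "conn D v x \<Longrightarrow> \<exists>n. steps D v n x"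
proof (induction rule: conn_induct)
  case refl show ?case by (auto intro: exI[of _ 0])
next
  case (step a b)
  then show ?case by (metis steps.simps(2))
qed

lemma steps_pivotal:
  assumes "steps D v n x" "conn (D - {ubond b}) v (fst b)" "\<not> conn (D - {ubond b}) v (snd b)"
    "\<not> conn (D - {ubond b}) v x"
  shows "\<exists>m<n. steps D v m (fst b)"
  using assms(1,4)
proof (induction n arbitrary: x)
  case (Suc n)
  then obtain u where u: "steps D v n u" "{u, x} \<in> D" by auto
  show ?case
  proof (cases "conn (D - {ubond b}) v u")
    case True
    have "{u, x} = ubond b"
    proof (rule ccontr)
      assume "{u, x} \<noteq> ubond b"
      then have "conn (D - {ubond b}) u x" using u by (intro conn_edge) auto
      then show False using True conn_trans Suc.prems(2) by blast
    qed
    then have "u = fst b" using assms(3) True by (auto simp: ubond_def doubleton_eq_iff)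
    then show ?thesis using u by auto
  next
    case False
    then show ?thesis using Suc.IH[OF u(1)] by (meson less_Suc_eq)
  qed
qed simp

text \<open>Among the occupied pivotal bonds whose bottom is reached through \<open>A\<close>, take
  one whose bottom is reached by a shortest walk. Were \<open>E_prime\<close> to fail at its bottom,
  another such bond would be pivotal for the connection to \<open>fst b\<close>, hence for the one
  to \<open>x\<close>, with a strictly shorter walk.\<close>

lemma first_pivotal_exists:
  assumes D: "D \<subseteq> bonds" and t: "conn_through D A v x" and nE: "\<not> E_prime D v x A"
  shows "\<exists>b\<in>dbonds. first_pivotal D v x A b"
proof -
  define P where "P b n \<longleftrightarrow> b \<in> dbonds \<and> ubond b \<in> D \<and> pivotal D b v x \<and> conn_through D A v (fst b) \<and>
     steps D v n (fst b)" for b n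
  have "\<exists>n b. P b n"
    using nE t conn_steps conn_through_imp_conn unfolding E_prime_def P_def by meson
  then obtain n where n: "\<exists>b. P b n" "\<And>m. m < n \<Longrightarrow> \<not> (\<exists>b. P b m)"
    using exists_least_iff[of "\<lambda>n. \<exists>b. P b n"] by blast
  then obtain b where b: "P b n" by blast
  have "E_prime D v (fst b) A"
  proof (rule ccontr)
    assume "\<not> ?thesis"
    then obtain b' where b': "b' \<in> dbonds" "ubond b' \<in> D" "pivotal D b' v (fst b)" "conn_through D A v (fst b')"
      using b unfolding E_prime_def P_def by auto
    have "pivotal D b' v x" using pivotal_trans[of D b v x b'] b b' by (simp add: P_def)
    moreover obtain m where "m < n" "steps D v m (fst b')"
      using steps_pivotal[of D v n "fst b" b'] b b' pivotal_imp_not_conn_top[OF b'(3)]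
      by (auto simp: P_def pivotal_iff)
    ultimately show False using n(2) b' unfolding P_def by blast
  qed
  then have "first_pivotal D v x A b"
    using b pivotal_imp_first_off[OF D, of b v x] unfolding first_pivotal_def P_def by blast
  then show ?thesis using b by (auto simp: P_def)
qed

text \<open>Opposite orientations of one bond cannot both be pivotal. For different bonds,
  \<open>E_prime\<close> at each bottom prevents the other bond from separating \<open>v\<close>
  from it. So \<open>fst b\<close> is reached off \<open>b'\<close>; and the path from there through
  \<open>b\<close> to \<open>x\<close> avoids \<open>b'\<close>, because \<open>b'\<close> touches
  the cluster of \<open>v\<close> off \<open>b\<close>. Hence \<open>b'\<close> would not be
  pivotal.\<close>

lemma first_pivotal_unique:
  assumes D: "D \<subseteq> bonds" and f: "first_pivotal D v x A b" "first_pivotal D v x A b'"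
    and db: "b \<in> dbonds" "b' \<in> dbonds"
  shows "b = b'"
proof (rule ccontr)
  assume ne: "b \<noteq> b'"
  note p = first_pivotal_imp(1,2)[OF D f(1)] and p' = first_pivotal_imp(1,2)[OF D f(2)]
  have occ: "ubond b \<in> D" "ubond b' \<in> D" using f by (auto simp: first_pivotal_def)
  show False
  proof (cases "ubond b = ubond b'")
    case True
    then have "fst b' = snd b"
      using ne by (auto simp: ubond_def doubleton_eq_iff prod_eq_iff)
    then show False using p p' True pivotal_imp_not_conn_top[OF p(1)] by (auto simp: pivotal_iff)
  next
    case False
    have *: "conn (D - {ubond c}) v (fst c')"
      if "pivotal D c v x" "conn_through D A v (fst c)" "ubond c \<in> D" "c \<in> dbonds"
        "first_pivotal D v x A c'" for c c'
    proof (rule ccontr)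
      assume no: "\<not> ?thesis"
      have "conn D v (fst c')" using that(5) E_prime_imp_conn by (auto simp: first_pivotal_def)
      then have "pivotal D c v (fst c')"
        using pivotal_orient[OF _ no] that(1) pivotal_imp_not_conn_top[OF that(1)] by (auto simp: pivotal_iff)
      then show False using that unfolding first_pivotal_def E_prime_def by blast
    qed
    have 1: "conn (D - {ubond b}) v (fst b')" using * p db occ f by blast
    have 2: "conn (D - {ubond b'}) v (fst b)" using * p' db occ f by blast
    have "conn (D - {ubond b'}) (fst b) (snd b)" using False occ by (auto intro!: conn_edge simp: ubond_def)
    moreover have "conn (D - {ubond b'}) (snd b) x"
    proof (rule conn_mono)
      show "conn (D - bonds_at (cluster_off D (ubond b) v)) (snd b) x"
        using f by (simp add: first_pivotal_def)
      have "ubond b' \<in> bonds_at (cluster_off D (ubond b) v)"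
        using 1 occ D by (auto simp: bonds_at_def in_cluster_off ubond_def)
      then show "D - bonds_at (cluster_off D (ubond b) v) \<subseteq> D - {ubond b'}" by auto
    qed
    ultimately have "conn (D - {ubond b'}) v x" using 2 conn_trans[of "D - {ubond b'}"] by metis
    then show False using p' by (simp add: pivotal_iff)
  qed
qed

text \<open>Integrals over counting measures rather than \<open>infsum\<close>, so that sums and
  expectations can be interchanged by Tonelli's theorem.\<close>

abbreviation bond_sum :: "('d::finite dbond \<Rightarrow> ennreal) \<Rightarrow> ennreal" where
  "bond_sum \<equiv> nn_integral (count_space dbonds)"

text \<open>A first pivotal bond violates \<open>E_prime\<close> at \<open>x\<close>, and there is
  at most one such bond. Hence the sum is itself an indicator, of the event that
  \<open>E_prime\<close> fails although the through-connection holds.\<close>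

lemma conn_through_decomp:
  assumes D: "D \<subseteq> bonds"
  shows "(of_bool (conn_through D A v x) :: ennreal) =
     of_bool (E_prime D v x A) + bond_sum (\<lambda>b. of_bool (first_pivotal D v x A b))"
proof -
  consider (E) "E_prime D v x A" | (F) b where "b \<in> dbonds" "first_pivotal D v x A b"
    | (N) "\<not> conn_through D A v x"
    using first_pivotal_exists[OF D] by blast
  then show ?thesis
  proof cases
    case E
    then have "\<not> first_pivotal D v x A b" if "b \<in> dbonds" for b
      using first_pivotal_imp[OF D, of v x A b] that
      unfolding E_prime_def first_pivotal_def by blast
    then have "bond_sum (\<lambda>b. of_bool (first_pivotal D v x A b)) = (\<integral>\<^sup>+(b :: 'a dbond). 0 \<partial>count_space dbonds)"
      by (intro nn_integral_cong) simp
    then show ?thesis using E by (simp add: E_prime_def)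
  next
    case F
    then have nE: "\<not> E_prime D v x A" and t: "conn_through D A v x"
      using first_pivotal_imp[OF D F(2)] unfolding E_prime_def first_pivotal_def by blast+
    have "first_pivotal D v x A b' \<longleftrightarrow> b' = b" if "b' \<in> dbonds" for b'
      using first_pivotal_unique[OF D _ F(2) that F(1)] F(2) by blast
    then have "bond_sum (\<lambda>b. of_bool (first_pivotal D v x A b))
       = (\<integral>\<^sup>+b'. indicator {b} b' \<partial>count_space dbonds)"
      by (intro nn_integral_cong) simp
    also have "\<dots> = 1" using F by (simp add: emeasure_count_space)
    finally show ?thesis using nE t by simp
  next
    case N
    then have "\<not> first_pivotal D v x A b" for b
      using first_pivotal_imp[OF D] by blast
    then show ?thesis using N by (simp add: E_prime_def)
  qed
qed

section \<open>Locality\<close>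

text \<open>Closure of \<open>S\<close> under the bonds of \<open>X\<close> confines every
  connection from \<open>s\<close> to bonds at \<open>S\<close>. Locality of this kind identifies
  the bonds on which an event depends, as independence requires.\<close>

lemma conn_local:
  assumes X: "X \<subseteq> bonds" "Y \<subseteq> X" and S: "\<forall>a b. {a, b} \<in> X \<longrightarrow> a \<in> S \<longrightarrow> b \<in> S" and s: "s \<in> S"
  shows "conn Y s z \<longleftrightarrow> conn (Y \<inter> bonds_at S) s z"
proof
  assume "conn (Y \<inter> bonds_at S) s z" then show "conn Y s z" by (rule conn_mono) auto
next
  assume "conn Y s z"
  then have "conn (Y \<inter> bonds_at S) s z \<and> z \<in> S"
  proof (induction rule: conn_induct)
    case refl then show ?case using s by simp
  next
    case (step a b)
    then have "b \<in> S" "{a, b} \<in> Y \<inter> bonds_at S" using X S by (auto simp: bonds_at_def)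
    then show ?case using step conn_trans conn_edge by meson
  qed
  then show "conn (Y \<inter> bonds_at S) s z" by simp
qed

lemma conn_through_local:
  assumes X: "X \<subseteq> bonds" and S: "\<forall>a b. {a, b} \<in> X \<longrightarrow> a \<in> S \<longrightarrow> b \<in> S" and s: "s \<in> S"
  shows "conn_through X A s z \<longleftrightarrow> conn_through (X \<inter> bonds_at S) A s z"
proof -
  have "X \<inter> bonds_at S - bonds_at A = (X - bonds_at A) \<inter> bonds_at S" by auto
  then show ?thesis
    unfolding conn_through_iff
    using conn_local[OF X _ S s, where Y = X] conn_local[OF X _ S s, where Y = "X - bonds_at A"] by auto
qed

lemma E_prime_local:
  assumes X: "X \<subseteq> bonds" and S: "\<forall>a b. {a, b} \<in> X \<longrightarrow> a \<in> S \<longrightarrow> b \<in> S" and s: "v \<in> S"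
  shows "E_prime X v y A \<longleftrightarrow> E_prime (X \<inter> bonds_at S) v y A"
proof -
  have "ubond b \<in> X \<and> pivotal X b v y \<longleftrightarrow>
      ubond b \<in> X \<inter> bonds_at S \<and> pivotal (X \<inter> bonds_at S) b v y" for b
  proof -
    have eq: "X \<inter> bonds_at S - {ubond b} = (X - {ubond b}) \<inter> bonds_at S" by auto
    have c: "conn (X - {ubond b}) t z \<longleftrightarrow> conn (X \<inter> bonds_at S - {ubond b}) t z" if "t \<in> S" for t z
      unfolding eq using conn_local[OF X _ S that, where Y = "X - {ubond b}"] by blast
    have "ubond b \<in> bonds_at S \<and> snd b \<in> S" if "ubond b \<in> X" "conn (X - {ubond b}) v (fst b)"
    proof -
      have "conn X v (fst b)" using that(2) by (rule conn_mono) auto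
      then have "fst b \<in> S"
        by (induction rule: conn_induct) (use s S in auto)
      then show ?thesis using that X S by (auto simp: bonds_at_def ubond_def)
    qed
    then show ?thesis unfolding pivotal_iff using c[OF s] c[of "snd b" y] by blast
  qed
  then show ?thesis
    unfolding E_prime_def using conn_through_local[OF X S s] by meson
qed

lemma cluster_closed: "{a, b} \<in> X \<Longrightarrow> a \<in> cluster X v \<Longrightarrow> b \<in> cluster X v"
  by (auto simp: in_cluster intro: conn_trans conn_edge)

text \<open>Each side makes \<open>S\<close> a cluster by its first conjunct, and from either of
  them \<open>S\<close> is closed under the bonds of \<open>X\<close>, so that locality applies. The
  event is thus determined by the bonds at \<open>S\<close>.\<close>

lemma cluster_E_prime_local:
  assumes X: "X \<subseteq> bonds"
  shows "cluster X v = S \<and> E_prime X v y A \<longleftrightarrow>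
     cluster (X \<inter> bonds_at S) v = S \<and> E_prime (X \<inter> bonds_at S) v y A"
proof -
  have *: "cluster X v = cluster (X \<inter> bonds_at S) v \<and> (E_prime X v y A \<longleftrightarrow> E_prime (X \<inter> bonds_at S) v y A)"
    if "\<forall>a b. {a, b} \<in> X \<longrightarrow> a \<in> S \<longrightarrow> b \<in> S" "v \<in> S"
  proof -
    have "conn X v z \<longleftrightarrow> conn (X \<inter> bonds_at S) v z" for z
      using conn_local[OF X order_refl] that by blast
    moreover have "E_prime X v y A \<longleftrightarrow> E_prime (X \<inter> bonds_at S) v y A"
      using E_prime_local[OF X] that by blast
    ultimately show ?thesis by (auto simp: in_cluster)
  qed
  have v: "v \<in> cluster Z v" for Z by (simp add: in_cluster)
  have 1: "\<forall>a b. {a, b} \<in> X \<longrightarrow> a \<in> S \<longrightarrow> b \<in> S" if "cluster X v = S"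
    using cluster_closed that by blast
  have 2: "\<forall>a b. {a, b} \<in> X \<longrightarrow> a \<in> S \<longrightarrow> b \<in> S" if "cluster (X \<inter> bonds_at S) v = S"
  proof (intro allI impI)
    fix a b assume ab: "{a, b} \<in> X" "a \<in> S"
    then have "{a, b} \<in> X \<inter> bonds_at S" using X by (auto simp: bonds_at_def)
    then show "b \<in> S" using cluster_closed that ab by blast
  qed
  have 3: "v \<in> S" if "cluster X v = S" using v that by blast
  have 4: "v \<in> S" if "cluster (X \<inter> bonds_at S) v = S" using v that by blast
  show ?thesis
  proof (cases "cluster X v = S")
    case True
    then show ?thesis using *[OF 1[OF True] 3[OF True]] by simp
  next
    case False
    have "cluster (X \<inter> bonds_at S) v \<noteq> S"
    proof
      assume a: "cluster (X \<inter> bonds_at S) v = S"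
      show False using *[OF 2[OF a] 4[OF a]] a False by simp
    qed
    then show ?thesis using False by simp
  qed
qed

text \<open>Since the top is not reached off \<open>b\<close>, whatever lies beyond \<open>b\<close>
  can return only by \<open>b\<close> itself. The state of \<open>b\<close> therefore affects
  neither the connections to vertices reached off \<open>b\<close> nor their pivotal bonds. This
  separates \<open>b\<close> from \<open>E_prime\<close> and later produces the factor
  \<open>p\<close>.\<close>

lemma E_prime_remove_top:
  assumes D: "D \<subseteq> bonds" and n: "\<not> conn (D - {ubond b}) v (snd b)"
  shows "E_prime D v (fst b) A \<longleftrightarrow> E_prime (D - {ubond b}) v (fst b) A"
proof (cases "conn (D - {ubond b}) v (fst b)")
  case False
  then have "\<not> conn D v (fst b)" using conn_bottom_off n by blast
  then show ?thesis using False E_prime_imp_conn by blast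
next
  case True
  let ?D = "D - {ubond b}" and ?u = "fst b"
  have c: "conn Y v z \<longleftrightarrow> conn (Y - {ubond b}) v z" if "Y \<subseteq> D" "conn ?D v z" for Y z
    using conn_off_top_iff[OF n that] .
  have t: "conn_through D A v z \<longleftrightarrow> conn_through ?D A v z" if "conn ?D v z" for z
  proof -
    have "?D - bonds_at A = D - bonds_at A - {ubond b}" by auto
    then show ?thesis unfolding conn_through_iff using c[of D z] c[of "D - bonds_at A" z] that by auto
  qed
  have u: "conn D v ?u" using True by (rule conn_mono) auto
  have p: "ubond b' \<in> D \<and> pivotal D b' v ?u \<longleftrightarrow> ubond b' \<in> ?D \<and> pivotal ?D b' v ?u" for b'
  proof
    assume a: "ubond b' \<in> D \<and> pivotal D b' v ?u"
    have sub: "?D - {ubond b'} \<subseteq> D - {ubond b'}" by auto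
    have ne: "ubond b' \<noteq> ubond b" using a True by (auto simp: pivotal_iff)
    have nu: "\<not> conn (?D - {ubond b'}) v ?u" using a conn_mono[OF _ sub] by (auto simp: pivotal_iff)
    have ns: "\<not> conn (?D - {ubond b'}) v (snd b')"
      using a pivotal_imp_not_conn_top conn_mono[OF _ sub] by blast
    obtain u' w' where *: "ubond b' = {u', w'}" "conn (?D - {ubond b'}) v u'"
      using conn_leaves_cluster[OF True nu] by metis
    then have "u' = fst b'" using ns by (auto simp: ubond_def doubleton_eq_iff)
    then show "ubond b' \<in> ?D \<and> pivotal ?D b' v ?u"
      using pivotal_orient[OF True nu _ ns] * ne a by auto
  next
    assume a: "ubond b' \<in> ?D \<and> pivotal ?D b' v ?u"
    have eq: "D - {ubond b'} - {ubond b} = ?D - {ubond b'}" by auto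
    have "conn (?D - {ubond b'}) (snd b') ?u" using a by (simp add: pivotal_iff)
    then have "conn ?D ?u (snd b')" using conn_sym conn_mono by (metis Diff_subset)
    \<comment> \<open>\<open>c\<close> speaks of vertices that \<open>v\<close> reaches off
      \<open>b\<close>; the top of \<open>b'\<close> is one of them, by way of
      \<open>fst b\<close>.\<close>
    then have s: "conn ?D v (snd b')" using True conn_trans by blast
    have "\<not> conn (D - {ubond b'}) v ?u"
      using c[of "D - {ubond b'}" ?u] True a eq by (auto simp: pivotal_iff)
    moreover have "\<not> conn (D - {ubond b'}) v (snd b')"
      using c[of "D - {ubond b'}" "snd b'"] s pivotal_imp_not_conn_top[of ?D b' v ?u] a eq by auto
    moreover have "conn (D - {ubond b'}) v (fst b')"
      using a conn_mono[of "?D - {ubond b'}" v "fst b'" "D - {ubond b'}"] by (auto simp: pivotal_iff)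
    ultimately show "ubond b' \<in> D \<and> pivotal D b' v ?u"
      using pivotal_orient[OF u] a by auto
  qed
  have "(ubond b' \<in> D \<and> pivotal D b' v ?u \<and> conn_through D A v (fst b')) \<longleftrightarrow>
      (ubond b' \<in> ?D \<and> pivotal ?D b' v ?u \<and> conn_through ?D A v (fst b'))" for b'
  proof -
    have "conn ?D v (fst b')" if "pivotal ?D b' v ?u"
      using that conn_mono[of "?D - {ubond b'}" v "fst b'" ?D] by (auto simp: pivotal_iff)
    then show ?thesis using p[of b'] t[of "fst b'"] by blast
  qed
  then show ?thesis using t[OF True] unfolding E_prime_def by meson
qed

text \<open>
  Every level of the expansion has \<open>B = B(A')\<close>, except for the level 0 of \<open>\<Xi>\<^sup>\<iota>\<close> and \<open>\<Pi>\<^sup>\<iota>\<close>, at which only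
  the bond \<open>(0, e\<^sub>\<iota>)\<close> is made vacant.
\<close>

definition good ::
    "'d::finite bond set \<Rightarrow> (int ^ 'd) set \<Rightarrow> int ^ 'd \<Rightarrow> (int ^ 'd) set \<Rightarrow> bool" where
  "good B A' v A \<longleftrightarrow>
     B = bonds_at A' \<and> v \<notin> A' \<or> A' = {} \<and> (\<exists>e. e \<noteq> v \<and> B = {{v, e}} \<and> A = {e})"

text \<open>If \<open>B\<close> consists of the bonds at \<open>A'\<close>, a bond of
  \<open>B\<close> with top outside \<open>A'\<close> has its bottom in \<open>A'\<close>, which is
  isolated. If \<open>B = {{v, e}}\<close> and \<open>A = {e}\<close>, a bottom \<open>v\<close> is
  not reached through \<open>A\<close>, by the convention for equal ends, and a top \<open>v\<close>
  lies in the cluster of \<open>v\<close>.\<close>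

lemma good_not_in:
  assumes g: "good B A' v A" and C: "C \<subseteq> bonds" and E: "E_prime (C - B) v (fst b) A"
    and n: "snd b \<notin> cluster_off (C - B) (ubond b) v \<union> A'"
  shows "ubond b \<notin> B"
proof
  assume b: "ubond b \<in> B"
  from g show False unfolding good_def
  proof (elim disjE conjE exE)
    assume *: "B = bonds_at A'" "v \<notin> A'"
    then have u: "fst b \<in> A'" using b n by (auto simp: bonds_at_def ubond_def)
    have "conn (C - bonds_at A') v (fst b)" using E_prime_imp_conn[OF E] * by simp
    then have "v = fst b" using conn_isolated' u C by blast
    then show False using u * by simp
  next
    fix e assume *: "A' = {}" "e \<noteq> v" "B = {{v, e}}" "A = {e}"
    then have "fst b = v \<or> snd b = v" using b by (auto simp: ubond_def doubleton_eq_iff)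
    then show False
    proof
      assume "fst b = v"
      then show False using E * by (simp add: E_prime_def conn_through_iff)
    next
      assume "snd b = v"
      then show False using n by (simp add: in_cluster_off)
    qed
  qed
qed

lemma good_top_not_in:
  assumes g: "good B A' v A" and "b \<in> dbonds" "ubond b \<notin> B"
  shows "snd b \<notin> A'"
  using assms by (auto simp: good_def bonds_at_def ubond_in_bonds) (auto simp: ubond_def)

text \<open>A single vacated bond touches \<open>v \<in> S\<close> and disappears together with the
  bonds at \<open>S\<close>. In both cases of \<open>good\<close> the rest of the configuration is
  governed by the augmented cluster \<open>S \<union> A'\<close>.\<close>

lemma good_off:
  assumes g: "good B A' v A" and C: "C \<subseteq> bonds" and "v \<in> S"
  shows "C - B - bonds_at S = C \<inter> (bonds - bonds_at (S \<union> A'))"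
  using assms by (auto simp: good_def bonds_at_def)

text \<open>Reconciles two ways of demanding that \<open>b\<close> is not vacated: the coefficients
  of order 0 contain an indicator, those of higher order put \<open>A'\<close> into the
  cluster.\<close>

lemma good_Psi_iff:
  assumes "good B A' v A" "C \<subseteq> bonds" "b \<in> dbonds"
  shows "ubond b \<notin> B \<and> E_prime (C - B) v (fst b) A \<and> snd b \<notin> cluster_off (C - B) (ubond b) v \<longleftrightarrow>
     E_prime (C - B) v (fst b) A \<and> snd b \<notin> cluster_off (C - B) (ubond b) v \<union> A'"
  using good_not_in[OF assms(1,2)] good_top_not_in[OF assms(1,3)] by blast

definition cluster_E_prime where
  "cluster_E_prime v u A S X \<longleftrightarrow> cluster X v = S \<and> E_prime X v u A"

lemma E_prime_cluster_iff:
  assumes C: "C \<subseteq> bonds"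
  shows "E_prime (C - B) v (fst b) A \<and> snd b \<notin> cluster_off (C - B) (ubond b) v \<union> A' \<and>
       cluster_off (C - B) (ubond b) v = S \<longleftrightarrow>
     snd b \<notin> S \<union> A' \<and> fst b \<in> S \<and>
       cluster_E_prime v (fst b) A S (C \<inter> (bonds_at S - {ubond b} - B))"
proof -
  let ?X = "C - B - {ubond b}"
  have X: "?X \<subseteq> bonds" "C - B \<subseteq> bonds" using C by auto
  have eq: "?X \<inter> bonds_at S = C \<inter> (bonds_at S - {ubond b} - B)" by auto
  have "E_prime (C - B) v (fst b) A \<and> snd b \<notin> cluster_off (C - B) (ubond b) v \<union> A' \<and>
      cluster_off (C - B) (ubond b) v = S \<longleftrightarrow>
    snd b \<notin> S \<union> A' \<and> cluster ?X v = S \<and> E_prime ?X v (fst b) A"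
    using E_prime_remove_top[OF X(2), of b v A] by (auto simp: cluster_off_def in_cluster)
  also have "cluster ?X v = S \<and> E_prime ?X v (fst b) A \<longleftrightarrow>
      cluster_E_prime v (fst b) A S (C \<inter> (bonds_at S - {ubond b} - B))"
    unfolding cluster_E_prime_def cluster_E_prime_local[OF X(1)] eq ..
  also have "\<dots> \<longleftrightarrow> fst b \<in> S \<and> cluster_E_prime v (fst b) A S (C \<inter> (bonds_at S - {ubond b} - B))"
    unfolding cluster_E_prime_def using E_prime_imp_conn in_cluster by blast
  finally show ?thesis .
qed

text \<open>Once the cluster is fixed to be \<open>S\<close>, the three random conditions on the
  right concern disjoint sets of bonds: bonds at \<open>S\<close> other than \<open>b\<close>, the
  bond \<open>b\<close>, and bonds not touching \<open>S \<union> A'\<close>. This is the geometric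
  content of the cutting-bond lemma.\<close>

lemma first_pivotal_cluster_iff:
  assumes g: "good B A' v A" and C: "C \<subseteq> bonds" and b: "b \<in> dbonds"
  shows "first_pivotal (C - B) v x A b \<and> cluster_off (C - B) (ubond b) v = S \<longleftrightarrow>
     snd b \<notin> S \<union> A' \<and> fst b \<in> S \<and>
       cluster_E_prime v (fst b) A S (C \<inter> (bonds_at S - {ubond b} - B)) \<and>
       ubond b \<in> C \<and> conn (C \<inter> (bonds - bonds_at (S \<union> A'))) (snd b) x"
proof -
  have v: "v \<in> cluster_off (C - B) (ubond b) v" by (simp add: in_cluster_off)
  have "first_pivotal (C - B) v x A b \<and> cluster_off (C - B) (ubond b) v = S \<longleftrightarrow>
     (ubond b \<notin> B \<and> E_prime (C - B) v (fst b) A \<and> snd b \<notin> cluster_off (C - B) (ubond b) v) \<and>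
     cluster_off (C - B) (ubond b) v = S \<and>
     ubond b \<in> C \<and> conn (C - B - bonds_at S) (snd b) x"
    by (auto simp: first_pivotal_def)
  also have "\<dots> \<longleftrightarrow> (E_prime (C - B) v (fst b) A \<and> snd b \<notin> cluster_off (C - B) (ubond b) v \<union> A' \<and>
       cluster_off (C - B) (ubond b) v = S) \<and> ubond b \<in> C \<and> conn (C - B - bonds_at S) (snd b) x"
    unfolding good_Psi_iff[OF g C b] by blast
  also have "\<dots> \<longleftrightarrow> (E_prime (C - B) v (fst b) A \<and> snd b \<notin> cluster_off (C - B) (ubond b) v \<union> A' \<and>
       cluster_off (C - B) (ubond b) v = S) \<and> ubond b \<in> C \<and>
       conn (C \<inter> (bonds - bonds_at (S \<union> A'))) (snd b) x"
    using good_off[OF g C, of S] v by auto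
  also note E_prime_cluster_iff[OF C]
  finally show ?thesis by blast
qed

text \<open>As \<open>u \<in> S\<close>, avoiding the bonds at \<open>S\<close> includes avoiding
  those at \<open>u\<close>. With \<open>u\<close> the bottom of a bond, the random set
  \<open>S\<close> is replaced by a single vertex at the cost of a through-connection.\<close>

lemma conn_off_through:
  assumes "w \<notin> S" "u \<in> S"
  shows "(of_bool (conn (C - bonds_at {u}) w x) :: ennreal) =
     of_bool (conn (C - bonds_at S) w x) + of_bool (conn_through (C - bonds_at {u}) S w x)"
proof -
  have eq: "C - bonds_at {u} - bonds_at S = C - bonds_at S" using assms by (auto simp: bonds_at_def)
  have "conn (C - bonds_at {u}) w x" if "conn (C - bonds_at S) w x"
    by (rule conn_mono[OF that]) (use assms in \<open>auto simp: bonds_at_def\<close>)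
  then show ?thesis using assms by (auto simp: conn_through_iff eq)
qed

section \<open>Measurability and independence\<close>

text \<open>The \<sigma>-algebra generated by the membership events. It serves configurations as
  well as vertex sets, since a cluster of one level is a parameter of the next level and has to be
  integrated over.\<close>

definition set_space :: "'a set measure" where
  "set_space = sigma UNIV (range (\<lambda>b. {C. b \<in> C}))"

lemma space_set_space [simp]: "space set_space = UNIV"
  by (simp add: set_space_def)

lemma measurable_set_space_iff:
  "f \<in> measurable M set_space \<longleftrightarrow> (\<forall>b. Measurable.pred M (\<lambda>\<omega>. b \<in> f \<omega>))"
proof -
  have "f -` {C. b \<in> C} \<inter> space M = {\<omega> \<in> space M. b \<in> f \<omega>}" for b by auto
  then show ?thesis
    unfolding set_space_def by (subst measurable_iff_measure_of) (auto simp: pred_def)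
qed

lemma measurable_mem [measurable (raw)]:
  "f \<in> measurable M set_space \<Longrightarrow> Measurable.pred M (\<lambda>\<omega>. b \<in> f \<omega>)"
  by (simp add: measurable_set_space_iff)

lemma measurable_set_diff [measurable (raw)]:
  assumes [measurable]: "f \<in> measurable M set_space" "g \<in> measurable M set_space"
  shows "(\<lambda>\<omega>. f \<omega> - g \<omega>) \<in> measurable M set_space"
  unfolding measurable_set_space_iff Diff_iff by measurable

lemma measurable_set_Int [measurable (raw)]:
  assumes [measurable]: "f \<in> measurable M set_space" "g \<in> measurable M set_space"
  shows "(\<lambda>\<omega>. f \<omega> \<inter> g \<omega>) \<in> measurable M set_space"
  unfolding measurable_set_space_iff Int_iff by measurable

lemma measurable_set_Un [measurable (raw)]:
  assumes [measurable]: "f \<in> measurable M set_space" "g \<in> measurable M set_space"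
  shows "(\<lambda>\<omega>. f \<omega> \<union> g \<omega>) \<in> measurable M set_space"
  unfolding measurable_set_space_iff Un_iff by measurable

lemma measurable_subset_finite:
  assumes [measurable]: "f \<in> measurable M set_space" and "finite F"
  shows "Measurable.pred M (\<lambda>\<omega>. F \<subseteq> f \<omega>)"
  unfolding subset_eq using assms by (intro pred_intros_finite measurable_mem) auto

lemma finite_path_bonds: "finite (path_bonds vs)"
  by (induction vs rule: path_bonds.induct) auto

lemma measurable_conn [measurable (raw)]:
  assumes [measurable]: "f \<in> measurable M set_space"
  shows "Measurable.pred M (\<lambda>\<omega>. conn (f \<omega>) x y)"
proof -
  have "Measurable.pred M (\<lambda>\<omega>. occ_path (f \<omega>) vs x y)" for vs
    unfolding occ_path_def by (intro pred_intros_logic measurable_subset_finite assms finite_path_bonds) auto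
  then show ?thesis unfolding conn_def by (rule pred_intros_countable)
qed

lemma measurable_cluster [measurable (raw)]:
  assumes [measurable]: "f \<in> measurable M set_space"
  shows "(\<lambda>\<omega>. cluster (f \<omega>) x) \<in> measurable M set_space"
  unfolding measurable_set_space_iff in_cluster by measurable

lemma measurable_cluster_off [measurable (raw)]:
  assumes [measurable]: "f \<in> measurable M set_space"
  shows "(\<lambda>\<omega>. cluster_off (f \<omega>) b x) \<in> measurable M set_space"
  unfolding cluster_off_def by measurable

lemma measurable_bonds_at [measurable (raw)]:
  assumes [measurable]: "f \<in> measurable M set_space"
  shows "(\<lambda>\<omega>. bonds_at (f \<omega>)) \<in> measurable M set_space"
proof -
  have "b \<in> bonds_at (f \<omega>) \<longleftrightarrow> b \<in> bonds \<and> (\<exists>z. z \<in> b \<and> z \<in> f \<omega>)" for b \<omega>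
    by (auto simp: bonds_at_def)
  then show ?thesis unfolding measurable_set_space_iff
    by (simp only:) (intro allI pred_intros_logic pred_intros_countable measurable_mem assms, simp_all)
qed

lemma measurable_conn_through [measurable (raw)]:
  assumes [measurable]: "f \<in> measurable M set_space" "g \<in> measurable M set_space"
  shows "Measurable.pred M (\<lambda>\<omega>. conn_through (f \<omega>) (g \<omega>) x y)"
  unfolding conn_through_iff by (cases "x = y") simp_all

lemma measurable_pivotal [measurable (raw)]:
  assumes [measurable]: "f \<in> measurable M set_space"
  shows "Measurable.pred M (\<lambda>\<omega>. pivotal (f \<omega>) b x y)"
  unfolding pivotal_iff by measurable

lemma measurable_E_prime [measurable (raw)]:
  assumes [measurable]: "f \<in> measurable M set_space" "g \<in> measurable M set_space"
  shows "Measurable.pred M (\<lambda>\<omega>. E_prime (f \<omega>) x y (g \<omega>))"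
  unfolding E_prime_def Bex_def by measurable

lemma measurable_first_pivotal [measurable (raw)]:
  assumes [measurable]: "f \<in> measurable M set_space" "g \<in> measurable M set_space"
  shows "Measurable.pred M (\<lambda>\<omega>. first_pivotal (f \<omega>) x y (g \<omega>) b)"
  unfolding first_pivotal_def by measurable

section \<open>Countability of the bonds and independence under the percolation measure\<close>

lemma countable_bonds: "countable (bonds :: 'd::finite bond set)"
proof -
  have "(bonds :: 'd bond set) \<subseteq> (\<lambda>(x, \<iota>). {x, x + unit_vec \<iota>}) ` UNIV" by (auto simp: bonds_def)
  then show ?thesis by (rule countable_subset) (rule countable_image, simp)
qed

lemma finite_bonds_at: "finite S \<Longrightarrow> finite (bonds_at S :: 'd::finite bond set)"
proof -
  assume S: "finite S"
  have "bonds_at S \<subseteq> (\<lambda>(x, \<iota>). {x, x + unit_vec \<iota>}) ` (S \<times> (UNIV :: 'd dir set))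
     \<union> (\<lambda>(x, \<iota>). {x - unit_vec \<iota>, x}) ` (S \<times> (UNIV :: 'd dir set))"
  proof
    fix b assume "b \<in> bonds_at S"
    then obtain x \<iota> z where b: "b = {x, x + unit_vec \<iota>}" "z \<in> b" "z \<in> S" by (auto simp: bonds_at_def bonds_def)
    then consider "z = x" | "z = x + unit_vec \<iota>" by auto
    then show "b \<in> (\<lambda>(x, \<iota>). {x, x + unit_vec \<iota>}) ` (S \<times> (UNIV :: 'd dir set))
     \<union> (\<lambda>(x, \<iota>). {x - unit_vec \<iota>, x}) ` (S \<times> (UNIV :: 'd dir set))"
    proof cases
      case 1 then show ?thesis using b by blast
    next
      case 2
      then have "b = {z - unit_vec \<iota>, z}" using b by auto
      then show ?thesis using b(3) by blast
    qed
  qed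
  then show ?thesis by (rule finite_subset) (use S in simp)
qed

lemma occupied_subset: "occupied \<omega> \<subseteq> bonds"
  by (auto simp: occupied_def)

lemma measurable_true_set:
  "(\<lambda>f. {b \<in> J. f b}) \<in> measurable (PiM J (\<lambda>_. measure_pmf q)) set_space"
proof -
  have "Measurable.pred (PiM J (\<lambda>_. measure_pmf q)) (\<lambda>f. b \<in> J \<and> f b)" for b
  proof (cases "b \<in> J")
    case True
    then have "(\<lambda>\<omega>. \<omega> b) \<in> measurable (PiM J (\<lambda>_. measure_pmf q)) (measure_pmf q)"
      by (rule measurable_component_singleton)
    then have "(\<lambda>\<omega>. \<omega> b) \<in> measurable (PiM J (\<lambda>_. measure_pmf q)) (count_space UNIV)" by simp
    then show ?thesis using True by simp
  qed simp
  then show ?thesis by (simp add: measurable_set_space_iff)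
qed

lemma measurable_occupied [measurable]: "occupied \<in> measurable (perc p) set_space"
  using measurable_true_set[of bonds] by (simp add: perc_def occupied_def[abs_def])

lemma prob_space_perc: "prob_space (perc p)"
  unfolding perc_def by (intro prob_space_PiM prob_space_measure_pmf)

lemma bonds_ne: "(bonds :: 'd::finite bond set) \<noteq> {}"
  by (auto simp: bonds_def)

lemma indep_vars_coordinates:
  fixes M :: "'i \<Rightarrow> 'a measure"
  assumes "\<And>i. i \<in> I \<Longrightarrow> prob_space (M i)" "I \<noteq> {}"
  shows "prob_space.indep_vars (PiM I M) M (\<lambda>i \<omega>. \<omega> i) I"
proof -
  interpret prob_space "PiM I M" by (intro prob_space_PiM assms)
  have "distr (PiM I M) (PiM I M) (\<lambda>x. \<lambda>i\<in>I. x i) = distr (PiM I M) (PiM I M) (\<lambda>x. x)"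
    by (intro distr_cong) (auto simp: space_PiM PiE_def extensional_restrict)
  moreover have "PiM I (\<lambda>i. distr (PiM I M) (M i) (\<lambda>\<omega>. \<omega> i)) = PiM I M"
    by (intro PiM_cong refl distr_PiM_component assms)
  ultimately show ?thesis
    using assms by (subst indep_vars_iff_distr_eq_PiM') (auto simp: distr_id)
qed

lemma indep_var_occupied:
  assumes "K \<subseteq> bonds" "L \<subseteq> bonds" "K \<inter> L = {}"
  shows "prob_space.indep_var (perc p) set_space (\<lambda>\<omega>. occupied \<omega> \<inter> K) set_space (\<lambda>\<omega>. occupied \<omega> \<inter> L)"
proof -
  let ?M = "\<lambda>_. measure_pmf (bernoulli_pmf p)"
  interpret prob_space "perc p" by (rule prob_space_perc)
  have "indep_vars ?M (\<lambda>i \<omega>. \<omega> i) bonds"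
    unfolding perc_def by (intro indep_vars_coordinates prob_space_measure_pmf bonds_ne)
  then have "indep_vars (\<lambda>j. PiM (case_bool K L j) ?M) (\<lambda>j \<omega>. restrict (\<lambda>i. \<omega> i) (case_bool K L j)) UNIV"
    by (rule indep_vars_restrict) (use assms in \<open>auto simp: disjoint_family_on_def split: bool.splits\<close>)
  moreover have "(\<lambda>j. PiM (case_bool K L j) ?M) = case_bool (PiM K ?M) (PiM L ?M)"
    by (auto split: bool.split)
  moreover have "(\<lambda>j (\<omega> :: 'a bond \<Rightarrow> bool). restrict (\<lambda>i. \<omega> i) (case_bool K L j)) =
      case_bool (\<lambda>\<omega>. restrict \<omega> K) (\<lambda>\<omega>. restrict \<omega> L)"
    by (auto simp: fun_eq_iff split: bool.split)
  ultimately have ind: "indep_var (PiM K ?M) (\<lambda>\<omega>. restrict \<omega> K) (PiM L ?M) (\<lambda>\<omega>. restrict \<omega> L)"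
    unfolding indep_var_def by metis
  have "indep_var set_space ((\<lambda>f. {b \<in> K. f b}) \<circ> (\<lambda>\<omega>. restrict \<omega> K))
      set_space ((\<lambda>f. {b \<in> L. f b}) \<circ> (\<lambda>\<omega>. restrict \<omega> L))"
    by (rule indep_var_compose[OF ind measurable_true_set measurable_true_set])
  moreover have "(\<lambda>f. {b \<in> J. f b}) \<circ> (\<lambda>\<omega>. restrict \<omega> J) = (\<lambda>\<omega>. occupied \<omega> \<inter> J)"
    if "J \<subseteq> bonds" for J :: "'a bond set"
    using that by (auto simp: fun_eq_iff occupied_def)
  ultimately show ?thesis using assms by simp
qed

lemma perc_indep:
  assumes KL: "K \<subseteq> bonds" "L \<subseteq> bonds" "K \<inter> L = {}"
    and [measurable]: "Measurable.pred set_space f" "Measurable.pred set_space g"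
  shows "\<P>(\<omega> in perc p. f (occupied \<omega> \<inter> K) \<and> g (occupied \<omega> \<inter> L)) =
     \<P>(\<omega> in perc p. f (occupied \<omega> \<inter> K)) * \<P>(\<omega> in perc p. g (occupied \<omega> \<inter> L))"
proof -
  interpret prob_space "perc p" by (rule prob_space_perc)
  have s: "Collect f \<in> sets set_space" "Collect g \<in> sets set_space"
    using assms(4,5) by (auto simp: pred_def)
  have eq: "{\<omega> \<in> space (perc p). f (occupied \<omega> \<inter> K) \<and> g (occupied \<omega> \<inter> L)} =
     (\<lambda>x. (occupied x \<inter> K, occupied x \<inter> L)) -` (Collect f \<times> Collect g) \<inter> space (perc p)"
    "{\<omega> \<in> space (perc p). f (occupied \<omega> \<inter> K)} = (\<lambda>x. occupied x \<inter> K) -` Collect f \<inter> space (perc p)"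
    "{\<omega> \<in> space (perc p). g (occupied \<omega> \<inter> L)} = (\<lambda>x. occupied x \<inter> L) -` Collect g \<inter> space (perc p)"
    by auto
  show ?thesis unfolding eq by (rule indep_varD[OF indep_var_occupied[OF KL] s])
qed

lemma perc_bond:
  assumes "0 \<le> p" "p \<le> 1" "b \<in> bonds"
  shows "\<P>(\<omega> in perc p. b \<in> occupied \<omega>) = p"
proof -
  let ?M = "measure_pmf (bernoulli_pmf p)"
  interpret prob_space "perc p" by (rule prob_space_perc)
  have "distr (perc p) ?M (\<lambda>\<omega>. \<omega> b) = ?M"
    unfolding perc_def using assms by (intro distr_PiM_component prob_space_measure_pmf)
  moreover have "(\<lambda>\<omega>. \<omega> b) \<in> measurable (perc p) ?M"
    unfolding perc_def using assms(3) by (rule measurable_component_singleton)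
  then have "measure (distr (perc p) ?M (\<lambda>\<omega>. \<omega> b)) {True} =
      measure (perc p) ((\<lambda>\<omega>. \<omega> b) -` {True} \<inter> space (perc p))"
    by (rule measure_distr) simp
  ultimately have "measure (perc p) ((\<lambda>\<omega>. \<omega> b) -` {True} \<inter> space (perc p)) = measure ?M {True}"
    by simp
  also have "\<dots> = p" using assms by (simp add: measure_pmf_single)
  also have "(\<lambda>\<omega>. \<omega> b) -` {True} \<inter> space (perc p) = {\<omega> \<in> space (perc p). b \<in> occupied \<omega>}"
    using assms by (auto simp: occupied_def)
  finally show ?thesis .
qed

subsection \<open>Sums\<close>

text \<open>The coefficients are defined by \<open>infsum\<close>, the proof integrates over
  counting measures. Both are suprema of finite partial sums, an infinite \<open>A\<close> being
  enumerated.\<close>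

lemma infsum_ennreal_eq_nn_integral:
  fixes f :: "'a \<Rightarrow> ennreal"
  assumes "countable A"
  shows "infsum f A = (\<integral>\<^sup>+x. f x \<partial>count_space A)"
proof (rule antisym)
  have fin: "(\<integral>\<^sup>+x. f x \<partial>count_space F) = sum f F" if "finite F" for F
    using that by (rule nn_integral_count_space_finite)
  show "infsum f A \<le> (\<integral>\<^sup>+x. f x \<partial>count_space A)"
  proof (subst nonneg_infsum_complete)
    show "(SUP F\<in>{F. finite F \<and> F \<subseteq> A}. sum f F) \<le> (\<integral>\<^sup>+x. f x \<partial>count_space A)"
    proof (rule SUP_least)
      fix F assume F: "F \<in> {F. finite F \<and> F \<subseteq> A}"
      then have "sum f F = (\<integral>\<^sup>+x. f x * indicator F x \<partial>count_space A)"
        using fin[of F] by (subst nn_integral_restrict_space[symmetric]) (auto simp: restrict_count_space Int_absorb2)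
      also have "\<dots> \<le> (\<integral>\<^sup>+x. f x \<partial>count_space A)"
        by (intro nn_integral_mono) (auto simp: indicator_def)
      finally show "sum f F \<le> (\<integral>\<^sup>+x. f x \<partial>count_space A)" .
    qed
  qed simp
  show "(\<integral>\<^sup>+x. f x \<partial>count_space A) \<le> infsum f A"
  proof (cases "finite A")
    case True then show ?thesis by (simp add: fin)
  next
    case False
    let ?g = "from_nat_into A"
    have b: "bij_betw ?g UNIV A" by (rule bij_betw_from_nat_into[OF assms False])
    have "(\<integral>\<^sup>+x. f x \<partial>count_space A) = (\<integral>\<^sup>+n. f (?g n) \<partial>count_space UNIV)"
      using nn_integral_bij_count_space[OF b, of f] by simp
    also have "\<dots> = (\<Sum>n. f (?g n))" by (rule nn_integral_count_space_nat)
    also have "\<dots> = (SUP n. \<Sum>i<n. f (?g i))" by (rule suminf_eq_SUP)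
    also have "\<dots> \<le> infsum f A"
    proof (rule SUP_least)
      fix n
      have "(\<Sum>i<n. f (?g i)) = sum f (?g ` {..<n})"
        using b by (subst sum.reindex) (auto simp: bij_betw_def intro: inj_on_subset)
      also have "\<dots> \<le> infsum f A"
        by (subst nonneg_infsum_complete) (use b in \<open>auto simp: bij_betw_def intro!: SUP_upper\<close>)
      finally show "(\<Sum>i<n. f (?g i)) \<le> infsum f A" .
    qed
    finally show ?thesis .
  qed
qed

lemma measurable_nn_integral_count_space:
  assumes "countable I" and f [measurable]: "\<And>i. i \<in> I \<Longrightarrow> f i \<in> borel_measurable M"
  shows "(\<lambda>x. \<integral>\<^sup>+i. f i x \<partial>count_space I) \<in> borel_measurable M"
proof (cases "finite I")
  case True
  then show ?thesis by (simp add: nn_integral_count_space_finite)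
next
  case False
  then have b: "bij_betw (from_nat_into I) UNIV I" using assms by (intro bij_betw_from_nat_into)
  then have [measurable]: "f (from_nat_into I n) \<in> borel_measurable M" for n
    by (intro f) (auto simp: bij_betw_def)
  have "(\<integral>\<^sup>+i. f i x \<partial>count_space I) = (\<Sum>n. f (from_nat_into I n) x)" for x
    using nn_integral_bij_count_space[OF b, of "\<lambda>i. f i x"] by (simp flip: nn_integral_count_space_nat)
  then show ?thesis by simp
qed

lemma summable_iff_nn_integral_finite:
  fixes f :: "'a \<Rightarrow> real"
  assumes "\<And>x. x \<in> A \<Longrightarrow> 0 \<le> f x"
  shows "f summable_on A \<longleftrightarrow> (\<integral>\<^sup>+x. ennreal (f x) \<partial>count_space A) < \<infinity>"
proof -
  have "f summable_on A \<longleftrightarrow> (\<lambda>x. norm (f x)) summable_on A"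
    by (rule summable_on_iff_abs_summable_on_real)
  also have "\<dots> \<longleftrightarrow> integrable (count_space A) f"
    using abs_summable_equivalent[of f A] by (simp add: Infinite_Set_Sum.abs_summable_on_def)
  also have "\<dots> \<longleftrightarrow> (\<integral>\<^sup>+x. ennreal (f x) \<partial>count_space A) < \<infinity>"
  proof -
    have "(\<integral>\<^sup>+x. ennreal (f x) \<partial>count_space A) = (\<integral>\<^sup>+x. ennreal (norm (f x)) \<partial>count_space A)"
      using assms by (intro nn_integral_cong) auto
    then show ?thesis by (simp add: integrable_iff_bounded)
  qed
  finally show ?thesis .
qed

lemma ennreal_infsum:
  fixes f :: "'a \<Rightarrow> real"
  assumes "\<And>x. x \<in> A \<Longrightarrow> 0 \<le> f x" "f summable_on A"
  shows "ennreal (infsum f A) = (\<integral>\<^sup>+x. ennreal (f x) \<partial>count_space A)"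
proof -
  have "(\<lambda>x. norm (f x)) summable_on A" using assms(2) summable_on_iff_abs_summable_on_real by blast
  then have a: "Infinite_Set_Sum.abs_summable_on f A" by (subst abs_summable_equivalent[symmetric])
  then show ?thesis
    using nn_integral_conv_infsetsum[OF a assms(1)] infsetsum_infsum[OF a] by simp
qed

lemma expect_off_of_bool:
  assumes "Measurable.pred set_space E"
  shows "expect_off p B (\<lambda>C. of_bool (E C)) = ennreal (prob_off p B E)"
proof -
  interpret prob_space "perc p" by (rule prob_space_perc)
  have [measurable]: "Measurable.pred (perc p) (\<lambda>\<omega>. E (occupied \<omega> - B))"
    by (rule measurable_compose[OF _ assms]) measurable
  have "expect_off p B (\<lambda>C. of_bool (E C)) = (\<integral>\<^sup>+\<omega>. indicator {\<omega> \<in> space (perc p). E (occupied \<omega> - B)} \<omega> \<partial>perc p)"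
    unfolding expect_off_def by (intro nn_integral_cong) (auto simp: indicator_def)
  also have "\<dots> = emeasure (perc p) {\<omega> \<in> space (perc p). E (occupied \<omega> - B)}"
    by (rule nn_integral_indicator) measurable
  finally show ?thesis by (simp add: emeasure_eq_measure prob_off_def)
qed

lemma prob_off_mono:
  assumes "\<And>C. C \<subseteq> bonds \<Longrightarrow> E (C - B) \<Longrightarrow> E' (C - B')" "Measurable.pred set_space E'"
  shows "prob_off p B E \<le> prob_off p B' E'"
proof -
  interpret prob_space "perc p" by (rule prob_space_perc)
  have [measurable]: "Measurable.pred (perc p) (\<lambda>\<omega>. E' (occupied \<omega> - B'))"
    by (rule measurable_compose[OF _ assms(2)]) measurable
  show ?thesis unfolding prob_off_def
    by (intro finite_measure_mono) (use assms(1)[OF occupied_subset] in auto)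
qed

lemma prob_off_cong:
  assumes "\<And>C. C \<subseteq> bonds \<Longrightarrow> E (C - B) \<longleftrightarrow> E' (C - B')"
  shows "prob_off p B E = prob_off p B' E'"
  unfolding prob_off_def using assms[OF occupied_subset] by simp

lemma prob_off_nonneg: "0 \<le> prob_off p B E"
  by (simp add: prob_off_def)

lemma prob_off_le_1: "prob_off p B E \<le> 1"
  unfolding prob_off_def using prob_space.prob_le_1[OF prob_space_perc] .

subsection \<open>Symmetries of the lattice\<close>

definition lattice_auto :: "(int ^ 'd::finite \<Rightarrow> int ^ 'd) \<Rightarrow> bool" where
  "lattice_auto \<phi> \<longleftrightarrow> bij \<phi> \<and> (\<forall>\<beta>. \<phi> ` \<beta> \<in> bonds \<longleftrightarrow> \<beta> \<in> bonds)"

lemma conn_map: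
  assumes "conn C x y" "\<And>u v. {u, v} \<in> C \<Longrightarrow> {f u, f v} \<in> C'"
  shows "conn C' (f x) (f y)"
  using assms(1)
proof (induction rule: conn_induct)
  case (step u v)
  then show ?case using assms(2) conn_edge conn_trans by meson
qed simp

lemma conn_reindex:
  assumes \<phi>: "lattice_auto \<phi>" and C: "C \<subseteq> bonds"
  shows "conn {\<beta> \<in> bonds. \<phi> ` \<beta> \<in> C} x y \<longleftrightarrow> conn C (\<phi> x) (\<phi> y)"
proof
  assume "conn {\<beta> \<in> bonds. \<phi> ` \<beta> \<in> C} x y"
  then show "conn C (\<phi> x) (\<phi> y)" by (rule conn_map) auto
next
  have inv: "\<phi> (inv \<phi> z) = z" "inv \<phi> (\<phi> z) = z" for z
    using \<phi> by (simp_all add: lattice_auto_def bij_is_surj surj_f_inv_f bij_is_inj)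
  assume "conn C (\<phi> x) (\<phi> y)"
  then have "conn {\<beta> \<in> bonds. \<phi> ` \<beta> \<in> C} (inv \<phi> (\<phi> x)) (inv \<phi> (\<phi> y))"
  proof (rule conn_map)
    fix u v assume "{u, v} \<in> C"
    moreover have eq: "\<phi> ` {inv \<phi> u, inv \<phi> v} = {u, v}" by (simp add: inv)
    moreover have "\<phi> ` {inv \<phi> u, inv \<phi> v} \<in> bonds \<longleftrightarrow> {inv \<phi> u, inv \<phi> v} \<in> bonds"
      using \<phi> unfolding lattice_auto_def by blast
    ultimately show "{inv \<phi> u, inv \<phi> v} \<in> {\<beta> \<in> bonds. \<phi> ` \<beta> \<in> C}"
      using C by auto
  qed
  then show "conn {\<beta> \<in> bonds. \<phi> ` \<beta> \<in> C} x y" by (simp add: inv)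
qed

text \<open>A product of equal factors is invariant under injective reindexing of its coordinates;
  the reindexed configuration is the preimage under \<phi>.\<close>

lemma perc_reindex:
  assumes \<phi>: "lattice_auto \<phi>" and [measurable]: "Measurable.pred set_space F"
  shows "\<P>(\<omega> in perc p. F (occupied \<omega>)) = \<P>(\<omega> in perc p. F {\<beta> \<in> bonds. \<phi> ` \<beta> \<in> occupied \<omega>})"
proof -
  let ?t = "\<lambda>\<omega>. \<lambda>b\<in>bonds. \<omega> (\<phi> ` b) :: bool"
  have inj: "inj_on ((`) \<phi>) bonds"
    using \<phi> by (intro inj_onI) (simp add: lattice_auto_def bij_is_inj inj_image_eq_iff)
  have im: "(`) \<phi> \<in> bonds \<rightarrow> bonds"
    using \<phi> by (auto simp: lattice_auto_def)
  have d: "distr (perc p) (perc p) ?t = perc p"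
    unfolding perc_def using distr_PiM_reindex[OF _ inj im, of "\<lambda>_. measure_pmf (bernoulli_pmf p)"]
    by (simp add: prob_space_measure_pmf)
  have t: "?t \<in> measurable (perc p) (perc p)"
    unfolding perc_def using im by (intro measurable_restrict measurable_component_singleton) auto
  have "\<P>(\<omega> in perc p. F (occupied \<omega>)) = measure (distr (perc p) (perc p) ?t) {\<omega> \<in> space (perc p). F (occupied \<omega>)}"
    by (simp add: d)
  also have "\<dots> = measure (perc p) (?t -` {\<omega> \<in> space (perc p). F (occupied \<omega>)} \<inter> space (perc p))"
    by (rule measure_distr[OF t]) measurable
  also have "?t -` {\<omega> \<in> space (perc p). F (occupied \<omega>)} \<inter> space (perc p) =
      {\<omega> \<in> space (perc p). F {\<beta> \<in> bonds. \<phi> ` \<beta> \<in> occupied \<omega>}}"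
  proof -
    have "occupied (?t \<omega>) = {\<beta> \<in> bonds. \<phi> ` \<beta> \<in> occupied \<omega>}" for \<omega>
      using im by (auto simp: occupied_def)
    then show ?thesis using measurable_space[OF t] by auto
  qed
  finally show ?thesis .
qed

lemma prob_off_conn_reindex:
  assumes \<phi>: "lattice_auto \<phi>"
  shows "prob_off p B (\<lambda>C. conn C x y) = prob_off p ((`) \<phi> ` B) (\<lambda>C. conn C (\<phi> x) (\<phi> y))"
proof -
  have inj: "inj \<phi>" using \<phi> by (simp add: lattice_auto_def bij_is_inj)
  have "prob_off p B (\<lambda>C. conn C x y) = \<P>(\<omega> in perc p. conn ({\<beta> \<in> bonds. \<phi> ` \<beta> \<in> occupied \<omega>} - B) x y)"
    unfolding prob_off_def using perc_reindex[OF \<phi>, of "\<lambda>C. conn (C - B) x y"] by simp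
  also have "\<dots> = prob_off p ((`) \<phi> ` B) (\<lambda>C. conn C (\<phi> x) (\<phi> y))"
  proof -
    have eq: "{\<beta> \<in> bonds. \<phi> ` \<beta> \<in> C} - B = {\<beta> \<in> bonds. \<phi> ` \<beta> \<in> C - (`) \<phi> ` B}" for C
      using inj by (auto simp: inj_image_eq_iff)
    have "occupied \<omega> - (`) \<phi> ` B \<subseteq> bonds" for \<omega> using occupied_subset by blast
    then show ?thesis unfolding prob_off_def eq by (simp only: conn_reindex[OF \<phi>])
  qed
  finally show ?thesis .
qed

lemma bonds_iff: "{u, v} \<in> bonds \<longleftrightarrow> (\<exists>\<iota>. v = u + unit_vec \<iota>)"
proof
  assume "{u, v} \<in> bonds"
  then obtain x \<iota> where "{u, v} = {x, x + unit_vec \<iota>}" by (auto simp: bonds_def)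
  moreover have "unit_vec \<iota> + unit_vec (opp \<iota>) = 0"
    by (auto simp: unit_vec_def opp_def axis_def vec_eq_iff)
  ultimately have "v = u + unit_vec \<iota> \<or> v = u + unit_vec (opp \<iota>)"
    by (auto simp: doubleton_eq_iff add.assoc)
  then show "\<exists>\<iota>. v = u + unit_vec \<iota>" by blast
qed (auto simp: bonds_def)

lemma lattice_autoI:
  assumes "\<And>x. \<phi> (\<psi> x) = x" "\<And>x. \<psi> (\<phi> x) = x"
    "\<And>x \<iota>. \<exists>\<iota>'. \<phi> (x + unit_vec \<iota>) = \<phi> x + unit_vec \<iota>'"
    "\<And>x \<iota>. \<exists>\<iota>'. \<psi> (x + unit_vec \<iota>) = \<psi> x + unit_vec \<iota>'"
  shows "lattice_auto \<phi>"
proof -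
  have b: "bij \<phi>" using assms(1,2) by (intro o_bij[of \<psi>]) (auto simp: fun_eq_iff)
  have *: "f ` \<beta> \<in> bonds" if \<beta>: "\<beta> \<in> bonds" and f: "\<And>x \<iota>. \<exists>\<iota>'. f (x + unit_vec \<iota>) = f x + unit_vec \<iota>'"
    for f :: "int ^ 'a \<Rightarrow> int ^ 'a" and \<beta>
  proof -
    obtain x \<iota> where "\<beta> = {x, x + unit_vec \<iota>}" using \<beta> unfolding bonds_def by blast
    then have "f ` \<beta> = {f x, f (x + unit_vec \<iota>)}" by simp
    then show ?thesis using f[of x \<iota>] by (auto simp: bonds_iff)
  qed
  have "\<psi> ` \<phi> ` \<beta> = \<beta>" for \<beta> by (simp add: image_image assms(2))
  then have "\<phi> ` \<beta> \<in> bonds \<longleftrightarrow> \<beta> \<in> bonds" for \<beta>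
    using *[of \<beta> \<phi>] *[of "\<phi> ` \<beta>" \<psi>] assms(3,4) by auto
  then show ?thesis using b by (simp add: lattice_auto_def)
qed

lemma lattice_auto_translate: "lattice_auto (\<lambda>z. z + a)"
  by (rule lattice_autoI[of _ "\<lambda>z. z - a"]) (auto simp: algebra_simps)

lemma tau_translate: "prob_off p {} (\<lambda>C. conn C v y) = tau p (y - v)"
  using prob_off_conn_reindex[OF lattice_auto_translate[of v], of p "{}" 0 "y - v"] by (simp add: tau_def)

lemma image_bonds_at:
  assumes \<phi>: "lattice_auto \<phi>"
  shows "(`) \<phi> ` bonds_at A = bonds_at (\<phi> ` A)"
proof -
  have inj: "inj \<phi>" and s: "surj \<phi>" using \<phi> by (simp_all add: lattice_auto_def bij_is_inj bij_is_surj)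
  show ?thesis
  proof (intro set_eqI iffI)
    fix \<beta> assume "\<beta> \<in> (`) \<phi> ` bonds_at A"
    then show "\<beta> \<in> bonds_at (\<phi> ` A)" using \<phi> by (auto simp: bonds_at_def lattice_auto_def)
  next
    fix \<beta> assume \<beta>: "\<beta> \<in> bonds_at (\<phi> ` A)"
    have eq: "\<beta> = \<phi> ` (\<phi> -` \<beta>)" using s by (simp add: surj_image_vimage_eq)
    have "\<phi> -` \<beta> \<in> bonds" using \<beta> \<phi> eq by (metis (no_types, lifting) lattice_auto_def bonds_at_def mem_Collect_eq)
    then have "\<phi> -` \<beta> \<in> bonds_at A" using \<beta> by (auto simp: bonds_at_def)
    then show "\<beta> \<in> (`) \<phi> ` bonds_at A" using eq by blast
  qed
qed

lemma tau_dir_translate: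
  "prob_off p (bonds_at {y}) (\<lambda>C. conn C (y - unit_vec \<kappa>) x) = tau_dir p \<kappa> (x - y + unit_vec \<kappa>)"
proof -
  let ?\<phi> = "\<lambda>z. z + (y - unit_vec \<kappa>)"
  have "(`) ?\<phi> ` bonds_at {unit_vec \<kappa>} = bonds_at {y}"
    using image_bonds_at[OF lattice_auto_translate[of "y - unit_vec \<kappa>"], of "{unit_vec \<kappa>}"] by simp
  then show ?thesis
    using prob_off_conn_reindex[OF lattice_auto_translate[of "y - unit_vec \<kappa>"], of p "bonds_at {unit_vec \<kappa>}" 0 "x - y + unit_vec \<kappa>"]
    by (simp add: tau_dir_def)
qed

text \<open>Transposing two coordinates and, if the signs differ, negating everything moves any
  direction to any other. The map is an involution and hence serves as its own inverse in
  \<open>lattice_autoI\<close>.\<close>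

lemma lattice_auto_exists:
  fixes \<kappa> \<kappa>' :: "'d::finite dir"
  shows "\<exists>\<phi>. lattice_auto \<phi> \<and> \<phi> 0 = 0 \<and> \<phi> (unit_vec \<kappa>) = unit_vec \<kappa>'"
proof -
  obtain s i s' j where \<kappa>: "\<kappa> = (s, i)" "\<kappa>' = (s', j)" by (cases \<kappa>, cases \<kappa>')
  define c :: int where "c = (if s = s' then 1 else - 1)"
  have cc: "c * c = 1" by (simp add: c_def)
  define t where "t = Transposition.transpose i j"
  have tt: "t (t k) = k" for k by (simp add: t_def)
  define \<phi> :: "int ^ 'd \<Rightarrow> int ^ 'd" where "\<phi> z = (\<chi> k. c * z $ t k)" for z
  have inv: "\<phi> (\<phi> z) = z" for z by (simp add: \<phi>_def vec_eq_iff tt mult.assoc[symmetric] cc)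
  have u: "\<phi> (unit_vec \<iota>) = unit_vec (fst \<iota> = (s = s'), t (snd \<iota>))" for \<iota>
    by (auto simp: \<phi>_def unit_vec_def vec_eq_iff axis_def c_def tt) (metis tt)+
  have add: "\<phi> (x + y) = \<phi> x + \<phi> y" for x y by (simp add: \<phi>_def vec_eq_iff distrib_left)
  have "lattice_auto \<phi>" using inv add u by (intro lattice_autoI[of \<phi> \<phi>]) auto
  moreover have "\<phi> 0 = 0" by (simp add: \<phi>_def vec_eq_iff)
  moreover have "\<phi> (unit_vec \<kappa>) = unit_vec \<kappa>'" by (cases s; cases s') (auto simp: u \<kappa> t_def)
  ultimately show ?thesis by blast
qed

lemma prob_off_conn_dir:
  fixes \<kappa> \<kappa>' :: "'d::finite dir"
  shows "prob_off p {{0, unit_vec \<kappa>}} (\<lambda>C. conn C 0 (unit_vec \<kappa>)) =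
   prob_off p {{0, unit_vec \<kappa>'}} (\<lambda>C. conn C 0 (unit_vec \<kappa>'))"
proof -
  obtain \<phi> where "lattice_auto \<phi>" "\<phi> 0 = 0" "\<phi> (unit_vec \<kappa>) = unit_vec \<kappa>'"
    using lattice_auto_exists by blast
  then show ?thesis using prob_off_conn_reindex[of \<phi> p "{{0, unit_vec \<kappa>}}" 0 "unit_vec \<kappa>"] by simp
qed

subsection \<open>Monotonicity in \<open>p\<close> and finiteness of clusters\<close>

lemma distr_PiM_map_pmf:
  assumes "map_pmf f q = bernoulli_pmf p"
  shows "distr (PiM bonds (\<lambda>_. measure_pmf q)) (perc p) (\<lambda>\<omega>. \<lambda>b\<in>bonds. f (\<omega> b)) =
     (perc p :: ('d::finite bond \<Rightarrow> bool) measure)"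
proof -
  let ?M = "\<lambda>_. measure_pmf (bernoulli_pmf p)" and ?N = "\<lambda>_. measure_pmf q"
  interpret prob_space "PiM (bonds :: 'd bond set) ?N" by (intro prob_space_PiM prob_space_measure_pmf)
  have "indep_vars ?N (\<lambda>i \<omega>. \<omega> i) bonds"
    by (intro indep_vars_coordinates prob_space_measure_pmf bonds_ne)
  then have ind: "indep_vars ?M (\<lambda>i \<omega>. f (\<omega> i)) bonds"
    by (rule indep_vars_compose2) simp
  have d: "distr (PiM (bonds :: 'd bond set) ?N) (measure_pmf (bernoulli_pmf p)) (\<lambda>\<omega>. f (\<omega> i)) = measure_pmf (bernoulli_pmf p)"
    if i: "i \<in> bonds" for i
  proof -
    have c: "(\<lambda>\<omega>. \<omega> i) \<in> measurable (PiM (bonds :: 'd bond set) ?N) (measure_pmf q)"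
      using i by (rule measurable_component_singleton)
    have "distr (PiM (bonds :: 'd bond set) ?N) (measure_pmf (bernoulli_pmf p)) (\<lambda>\<omega>. f (\<omega> i)) =
        distr (distr (PiM (bonds :: 'd bond set) ?N) (measure_pmf q) (\<lambda>\<omega>. \<omega> i)) (measure_pmf (bernoulli_pmf p)) f"
      by (subst distr_distr[OF _ c]) (auto simp: comp_def)
    also have "distr (PiM (bonds :: 'd bond set) ?N) (measure_pmf q) (\<lambda>\<omega>. \<omega> i) = measure_pmf q"
      using i by (intro distr_PiM_component prob_space_measure_pmf)
    also have "distr (measure_pmf q) (measure_pmf (bernoulli_pmf p)) f = distr (measure_pmf q) (count_space UNIV) f"
      by (intro distr_cong) auto
    also have "\<dots> = measure_pmf (bernoulli_pmf p)" by (simp flip: map_pmf_rep_eq add: assms)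
    finally show ?thesis .
  qed
  have "distr (PiM bonds ?N) (PiM bonds ?M) (\<lambda>\<omega>. \<lambda>b\<in>bonds. f (\<omega> b)) =
      (PiM (bonds :: 'd bond set) (\<lambda>i. distr (PiM bonds ?N) (measure_pmf (bernoulli_pmf p)) (\<lambda>\<omega>. f (\<omega> i))))"
    using ind by (subst (asm) indep_vars_iff_distr_eq_PiM'[OF bonds_ne])
      (auto intro: measurable_compose[OF measurable_component_singleton])
  also have "\<dots> = PiM bonds ?M" by (intro PiM_cong d refl)
  finally show ?thesis unfolding perc_def .
qed

text \<open>A coupling: both configurations are read off from independent pairs of bond states, of
  which the second implies the first.\<close>

lemma tau_mono:
  assumes "0 \<le> p" "p \<le> p'" "p' \<le> 1" "0 < p'"
  shows "tau p x \<le> tau p' (x :: int ^ 'd::finite)"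
proof -
  \<comment> \<open>The pair is \<open>(a, a \<and> b)\<close> with \<open>a\<close> of parameter
    \<open>p'\<close> and an independent \<open>b\<close> of parameter \<open>p / p'\<close>, so
    that the second component has parameter \<open>p' * (p / p') = p\<close>.\<close>
  define q where "q = bind_pmf (bernoulli_pmf p') (\<lambda>a. map_pmf (\<lambda>b. (a, a \<and> b)) (bernoulli_pmf (p / p')))"
  have r: "0 \<le> p / p'" "p / p' \<le> 1" using assms by (auto simp: divide_simps)
  have q1: "map_pmf fst q = bernoulli_pmf p'"
    by (simp add: q_def map_bind_pmf map_pmf_comp bind_return_pmf')
  have q2: "map_pmf snd q = bernoulli_pmf p"
  proof -
    have and_eq: "(\<and>) True = id" "(\<and>) False = (\<lambda>_. False)" by (auto simp: fun_eq_iff)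
    have "pmf (map_pmf snd q) True = p"
      using assms r
      by (simp add: q_def map_bind_pmf map_pmf_comp pmf_bind measure_pmf_single and_eq map_pmf_id)
    then show ?thesis using assms by (intro pmf_eqI) (metis (full_types) bernoulli_pmf.rep_eq pmf_False_conv_True pmf_bernoulli_True order_trans)
  qed
  let ?N = "PiM (bonds :: 'd bond set) (\<lambda>_. measure_pmf q)"
  interpret prob_space ?N by (intro prob_space_PiM prob_space_measure_pmf)
  let ?t = "\<lambda>f \<omega>. \<lambda>b\<in>bonds. f (\<omega> b) :: bool"
  have t: "?t f \<in> measurable ?N (perc r)" for f :: "bool \<times> bool \<Rightarrow> bool" and r
    unfolding perc_def
    by (intro measurable_restrict measurable_compose[OF measurable_component_singleton]) auto
  have *: "tau r x = measure ?N {\<omega> \<in> space ?N. conn (occupied (?t f \<omega>)) 0 x}"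
    if "map_pmf f q = bernoulli_pmf r" for f r
  proof -
    have "tau r x = measure (distr ?N (perc r) (?t f)) {\<omega> \<in> space (perc r). conn (occupied \<omega>) 0 x}"
      using that by (simp add: tau_def prob_off_def distr_PiM_map_pmf)
    also have "\<dots> = measure ?N (?t f -` {\<omega> \<in> space (perc r). conn (occupied \<omega>) 0 x} \<inter> space ?N)"
      by (rule measure_distr[OF t]) measurable
    also have "?t f -` {\<omega> \<in> space (perc r). conn (occupied \<omega>) 0 x} \<inter> space ?N =
        {\<omega> \<in> space ?N. conn (occupied (?t f \<omega>)) 0 x}"
      using measurable_space[OF t] by auto
    finally show ?thesis .
  qed
  have ae: "AE \<omega> in ?N. \<forall>b\<in>bonds. snd (\<omega> b) \<longrightarrow> fst (\<omega> b)"
  proof (subst AE_ball_countable[OF countable_bonds], intro ballI)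
    fix b :: "'d bond" assume b: "b \<in> bonds"
    have "AE z in measure_pmf q. snd z \<longrightarrow> fst z" by (auto simp: AE_measure_pmf_iff q_def)
    then show "AE \<omega> in ?N. snd (\<omega> b) \<longrightarrow> fst (\<omega> b)"
      using b by (intro AE_PiM_component) (auto intro: prob_space_measure_pmf)
  qed
  have "measure ?N {\<omega> \<in> space ?N. conn (occupied (?t snd \<omega>)) 0 x} \<le>
      measure ?N {\<omega> \<in> space ?N. conn (occupied (?t fst \<omega>)) 0 x}"
  proof (rule finite_measure_mono_AE)
    show "AE \<omega> in ?N. \<omega> \<in> {\<omega> \<in> space ?N. conn (occupied (?t snd \<omega>)) 0 x} \<longrightarrow>
        \<omega> \<in> {\<omega> \<in> space ?N. conn (occupied (?t fst \<omega>)) 0 x}"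
      using ae
    proof (rule AE_mp, intro AE_I2 impI)
      fix \<omega> assume "\<forall>b\<in>bonds. snd (\<omega> b) \<longrightarrow> fst (\<omega> b)"
        and c: "\<omega> \<in> {\<omega> \<in> space ?N. conn (occupied (?t snd \<omega>)) 0 x}"
      then have "occupied (?t snd \<omega>) \<subseteq> occupied (?t fst \<omega>)" by (auto simp: occupied_def)
      then show "\<omega> \<in> {\<omega> \<in> space ?N. conn (occupied (?t fst \<omega>)) 0 x}"
        using c conn_mono by blast
    qed
    have "(\<lambda>\<omega>. occupied (?t fst \<omega>)) \<in> measurable ?N set_space"
      by (rule measurable_compose[OF t[of _ 0]]) measurable
    then show "{\<omega> \<in> space ?N. conn (occupied (?t fst \<omega>)) 0 x} \<in> events"
      by measurable
  qed
  then show ?thesis using *[OF q1] *[OF q2] by simp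
qed

lemma tau_0: "tau 0 (x :: int ^ 'd::finite) = of_bool (x = 0)"
proof -
  interpret prob_space "perc 0 :: ('d bond \<Rightarrow> bool) measure" by (rule prob_space_perc)
  have *: "AE \<omega> in (perc 0 :: ('d bond \<Rightarrow> bool) measure). \<forall>b\<in>bonds. b \<notin> occupied \<omega>"
  proof (subst AE_ball_countable[OF countable_bonds], intro ballI)
    fix b :: "'d bond" assume "b \<in> bonds"
    then have "prob {\<omega> \<in> space (perc 0). b \<in> occupied \<omega>} = 0" by (simp add: perc_bond)
    then show "AE \<omega> in perc 0. b \<notin> occupied \<omega>"
      by (subst (asm) prob_eq_0) auto
  qed
  have "AE \<omega> in (perc 0 :: ('d bond \<Rightarrow> bool) measure). occupied \<omega> = {}"
    using * by eventually_elim (auto simp: occupied_def)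
  then have **: "AE \<omega> in (perc 0 :: ('d bond \<Rightarrow> bool) measure). conn (occupied \<omega>) 0 x \<longleftrightarrow> x = 0"
  proof eventually_elim
    case (elim \<omega>)
    have "conn {} 0 x \<Longrightarrow> x = 0" by (simp add: conn_iff_rtrancl)
    then show ?case using elim by auto
  qed
  show ?thesis
  proof (cases "x = 0")
    case True then show ?thesis by (simp add: tau_def prob_off_def prob_space)
  next
    case False
    then have "prob {\<omega> \<in> space (perc 0). conn (occupied \<omega>) 0 x} = 0"
      using ** by (subst prob_eq_0) auto
    then show ?thesis using False by (simp add: tau_def prob_off_def)
  qed
qed

definition chi :: "'d::finite itself \<Rightarrow> real \<Rightarrow> ennreal" where
  "chi _ p = (\<integral>\<^sup>+y. ennreal (tau p (y :: int ^ 'd)) \<partial>count_space UNIV)"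

text \<open>A supremum only yields some \<open>p' > p\<close> with summable two-point function;
  monotonicity brings summability down to \<open>p\<close>. The parameter 0 shows that the supremum
  is over a nonempty set.\<close>

lemma subcritical:
  assumes "0 < p" "p < p_crit TYPE('d::finite)"
  shows "p < 1" "chi TYPE('d) p < \<infinity>"
proof -
  let ?X = "{p \<in> {0..1}. (tau p :: int ^ 'd \<Rightarrow> real) summable_on UNIV}"
  have "(tau 0 :: int ^ 'd \<Rightarrow> real) summable_on UNIV"
    using summable_on_cong_neutral[of "{0}" UNIV "tau 0 :: int ^ 'd \<Rightarrow> real" "tau 0"] by (auto simp: tau_0)
  then have "0 \<in> ?X" by simp
  then have "?X \<noteq> {}" by blast
  with assms(2) obtain p' where p': "p < p'" "p' \<in> ?X"
    unfolding p_crit_def by (auto elim: less_cSupE)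
  then show "p < 1" by auto
  have "(tau p :: int ^ 'd \<Rightarrow> real) summable_on UNIV"
  proof (rule summable_on_comparison_test)
    show "(tau p' :: int ^ 'd \<Rightarrow> real) summable_on UNIV" using p' by simp
    show "tau p x \<le> tau p' x" for x :: "int ^ 'd" using p' assms by (intro tau_mono) auto
  qed (simp add: tau_def prob_off_nonneg)
  then show "chi TYPE('d) p < \<infinity>"
    unfolding chi_def by (subst (asm) summable_iff_nn_integral_finite) (auto simp: tau_def prob_off_nonneg)
qed

lemma chi_translate: "(\<integral>\<^sup>+y. ennreal (tau p (y - v)) \<partial>count_space UNIV) = chi TYPE('d::finite) p"
  for v :: "int ^ 'd"
proof -
  have "bij_betw (\<lambda>y. y - v) UNIV UNIV"
    by (rule bij_betw_byWitness[of _ "\<lambda>y. y + v"]) auto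
  from nn_integral_bij_count_space[OF this, of "\<lambda>y. ennreal (tau p y)"] show ?thesis
    by (simp add: chi_def)
qed

text \<open>The expected size of the cluster is the susceptibility, by Tonelli's theorem and
  translation invariance.\<close>

lemma AE_finite_cluster:
  assumes "chi TYPE('d::finite) p < \<infinity>"
  shows "AE \<omega> in perc p. finite (cluster (occupied \<omega>) (v :: int ^ 'd))"
proof -
  let ?f = "\<lambda>\<omega>. \<integral>\<^sup>+y. of_bool (conn (occupied \<omega>) v y) \<partial>count_space UNIV :: ennreal"
  have m: "(\<lambda>\<omega>. of_bool (conn (occupied \<omega>) v y) :: ennreal) \<in> borel_measurable (perc p)" for y by measurable
  have "(\<integral>\<^sup>+\<omega>. ?f \<omega> \<partial>perc p) = (\<integral>\<^sup>+y. (\<integral>\<^sup>+\<omega>. of_bool (conn (occupied \<omega>) v y) \<partial>perc p) \<partial>count_space UNIV)"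
    by (intro nn_integral_count_space_nn_integral m) simp
  also have "\<dots> = (\<integral>\<^sup>+y. ennreal (tau p (y - v)) \<partial>count_space UNIV)"
  proof (intro nn_integral_cong)
    fix y
    have "expect_off p {} (\<lambda>C. of_bool (conn C v y)) = ennreal (prob_off p {} (\<lambda>C. conn C v y))"
      by (rule expect_off_of_bool) measurable
    then show "(\<integral>\<^sup>+\<omega>. of_bool (conn (occupied \<omega>) v y) \<partial>perc p) = ennreal (tau p (y - v))"
      by (simp add: expect_off_def tau_translate)
  qed
  finally have "(\<integral>\<^sup>+\<omega>. ?f \<omega> \<partial>perc p) \<noteq> \<infinity>" using assms by (simp add: chi_translate)
  moreover have "?f \<in> borel_measurable (perc p)"
    by (rule measurable_nn_integral_count_space[OF _ m]) simp
  ultimately have "AE \<omega> in perc p. ?f \<omega> \<noteq> \<infinity>" by (rule_tac nn_integral_PInf_AE)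
  then show ?thesis
  proof eventually_elim
    case (elim \<omega>)
    have "?f \<omega> = (\<integral>\<^sup>+y. indicator (cluster (occupied \<omega>) v) y \<partial>count_space UNIV)"
      by (intro nn_integral_cong) (auto simp: indicator_def in_cluster)
    also have "\<dots> = emeasure (count_space UNIV) (cluster (occupied \<omega>) v)" by simp
    finally show ?case using elim by (auto simp: emeasure_count_space split: if_splits)
  qed
qed

subsection \<open>The constant \<open>\<mu>\<^sub>p\<close>\<close>

lemma perc_vacant:
  assumes "0 \<le> p" "p \<le> 1" "b \<in> bonds"
  shows "\<P>(\<omega> in perc p. b \<notin> occupied \<omega>) = 1 - p"
proof -
  interpret prob_space "perc p" by (rule prob_space_perc)
  have "\<P>(\<omega> in perc p. \<not> b \<in> occupied \<omega>) = 1 - \<P>(\<omega> in perc p. b \<in> occupied \<omega>)"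
    by (rule prob_neg) measurable
  then show ?thesis using perc_bond[OF assms] by simp
qed

lemma perc_all_vacant_pos:
  assumes "0 \<le> p" "p < 1" "finite J" "J \<subseteq> bonds"
  shows "0 < \<P>(\<omega> in perc p. \<forall>\<beta>\<in>J. \<beta> \<notin> occupied \<omega>)"
  using assms(3,4)
proof (induction J rule: finite_induct)
  case empty
  show ?case by (simp add: prob_space.prob_space[OF prob_space_perc])
next
  case (insert b J)
  have m: "Measurable.pred set_space (\<lambda>X. \<forall>\<beta>\<in>J. \<beta> \<notin> X)"
    using insert(1) by simp
  have "\<P>(\<omega> in perc p. b \<notin> occupied \<omega> \<inter> {b} \<and> (\<forall>\<beta>\<in>J. \<beta> \<notin> occupied \<omega> \<inter> J)) =
      \<P>(\<omega> in perc p. b \<notin> occupied \<omega> \<inter> {b}) * \<P>(\<omega> in perc p. \<forall>\<beta>\<in>J. \<beta> \<notin> occupied \<omega> \<inter> J)"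
    using insert by (intro perc_indep[OF _ _ _ _ m]) auto
  moreover have "\<P>(\<omega> in perc p. b \<notin> occupied \<omega> \<inter> {b}) = 1 - p"
    using perc_vacant[of p b] assms insert by (simp only: Int_iff insert_iff) simp
  moreover have "(\<forall>\<beta>\<in>J. \<beta> \<notin> occupied \<omega> \<inter> J) \<longleftrightarrow> (\<forall>\<beta>\<in>J. \<beta> \<notin> occupied \<omega>)" for \<omega> by auto
  moreover have "b \<notin> occupied \<omega> \<inter> {b} \<longleftrightarrow> b \<notin> occupied \<omega>" for \<omega> by auto
  ultimately show ?case using insert assms by (simp only: ball_simps(7)) simp
qed

lemma unit_vec_opp: "unit_vec (opp \<kappa>) = - unit_vec \<kappa>"
  by (auto simp: unit_vec_def opp_def axis_def vec_eq_iff)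

lemma unit_vec_ne_0: "unit_vec \<kappa> \<noteq> 0"
proof
  assume "unit_vec \<kappa> = 0"
  then have "unit_vec \<kappa> $ snd \<kappa> = 0" by simp
  then show False by (auto simp: unit_vec_def axis_def split: if_splits)
qed

lemma prob_off_neg:
  assumes "Measurable.pred set_space E"
  shows "prob_off p B (\<lambda>C. \<not> E C) = 1 - prob_off p B E"
proof -
  interpret prob_space "perc p" by (rule prob_space_perc)
  have [measurable]: "Measurable.pred (perc p) (\<lambda>\<omega>. E (occupied \<omega> - B))"
    by (rule measurable_compose[OF _ assms]) measurable
  show ?thesis unfolding prob_off_def by (rule prob_neg) measurable
qed

text \<open>On vacancy of the bond, being outside the cluster is an event off that bond and so
  independent of its state; the probability \<open>1 - p\<close> of the condition cancels, which is
  where \<open>p < 1\<close> enters.\<close>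

lemma mu_first:
  assumes "0 \<le> p" "p < 1"
  shows "mu TYPE('d::{finite,linorder}) p =
     p * (1 - prob_off p {{0, unit_vec first_dir :: int ^ ('d::{finite,linorder})}} (\<lambda>C. conn C 0 (unit_vec first_dir)))"
proof -
  let ?e = "unit_vec first_dir :: (int, 'd) vec"
  let ?b = "{0, ?e}"
  have b: "?b \<in> bonds" unfolding bonds_iff by (intro exI[of _ first_dir]) simp
  have "\<P>(\<omega> in perc p. ?e \<notin> cluster (occupied \<omega>) 0 \<and> ?b \<notin> occupied \<omega>) =
      \<P>(\<omega> in perc p. \<not> conn (occupied \<omega> \<inter> (bonds - {?b})) 0 ?e \<and> ?b \<notin> occupied \<omega> \<inter> {?b})"
  proof -
    have "?e \<notin> cluster (occupied \<omega>) 0 \<and> ?b \<notin> occupied \<omega> \<longleftrightarrow>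
      \<not> conn (occupied \<omega> \<inter> (bonds - {?b})) 0 ?e \<and> ?b \<notin> occupied \<omega> \<inter> {?b}" for \<omega>
    proof (cases "?b \<in> occupied \<omega>")
      case False
      then have "occupied \<omega> \<inter> (bonds - {?b}) = occupied \<omega>" using occupied_subset by auto
      then show ?thesis using False by (simp add: in_cluster)
    qed simp
    then show ?thesis by simp
  qed
  also have "\<dots> = \<P>(\<omega> in perc p. \<not> conn (occupied \<omega> \<inter> (bonds - {?b})) 0 ?e) * \<P>(\<omega> in perc p. ?b \<notin> occupied \<omega> \<inter> {?b})"
    using b by (intro perc_indep) auto
  also have "\<P>(\<omega> in perc p. ?b \<notin> occupied \<omega> \<inter> {?b}) = 1 - p" using perc_vacant[of p ?b] assms b by simp
  also have "\<P>(\<omega> in perc p. \<not> conn (occupied \<omega> \<inter> (bonds - {?b})) 0 ?e) = prob_off p {?b} (\<lambda>C. \<not> conn C 0 ?e)"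
  proof -
    have "occupied \<omega> \<inter> (bonds - {?b}) = occupied \<omega> - {?b}" for \<omega> using occupied_subset by auto
    then show ?thesis by (simp add: prob_off_def)
  qed
  also have "\<dots> = 1 - prob_off p {?b} (\<lambda>C. conn C 0 ?e)" by (rule prob_off_neg) measurable
  finally show ?thesis
    using perc_vacant[of p ?b] assms b by (simp add: mu_def cond_prob_def)
qed

lemma mu_eq:
  fixes \<kappa> :: "('d::{finite,linorder}) dir"
  assumes "0 \<le> p" "p < 1"
  shows "mu TYPE('d) p =
     p * prob_off p {} (\<lambda>C. unit_vec \<kappa> \<notin> cluster_off C {0, unit_vec \<kappa>} 0)"
proof -
  have "prob_off p {} (\<lambda>C. unit_vec \<kappa> \<notin> cluster_off C {0, unit_vec \<kappa>} 0) =
      prob_off p {{0, unit_vec \<kappa>}} (\<lambda>C. \<not> conn C 0 (unit_vec \<kappa>))"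
    by (rule prob_off_cong) (simp add: in_cluster_off)
  also have "\<dots> = 1 - prob_off p {{0, unit_vec \<kappa>}} (\<lambda>C. conn C 0 (unit_vec \<kappa>))"
    by (rule prob_off_neg) measurable
  finally show ?thesis
    using mu_first[OF assms, where 'd = 'd] prob_off_conn_dir[of p \<kappa> first_dir] by simp
qed

text \<open>With positive probability all of the finitely many bonds at the origin are vacant.
  Positivity makes the division by \<mu> in \<open>Psi\<close> meaningful.\<close>

lemma mu_pos:
  assumes "0 < p" "p < 1"
  shows "0 < mu TYPE('d::{finite,linorder}) p"
proof -
  fix \<kappa> :: "'d dir"
  let ?e = "unit_vec \<kappa> :: (int, 'd) vec"
  interpret prob_space "perc p :: ('d bond \<Rightarrow> bool) measure" by (rule prob_space_perc)
  have "0 < \<P>(\<omega> in perc p. \<forall>\<beta>\<in>bonds_at {0 :: (int, 'd) vec}. \<beta> \<notin> occupied \<omega>)"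
    using assms by (intro perc_all_vacant_pos finite_bonds_at) (auto simp: bonds_at_def)
  also have "\<dots> \<le> prob_off p {} (\<lambda>C. ?e \<notin> cluster_off C {0, ?e} 0)"
    unfolding prob_off_def
  proof (rule finite_measure_mono)
    show "{\<omega> \<in> space (perc p). \<forall>\<beta>\<in>bonds_at {0}. \<beta> \<notin> occupied \<omega>} \<subseteq>
      {\<omega> \<in> space (perc p). ?e \<notin> cluster_off (occupied \<omega> - {}) {0, ?e} 0}"
    proof safe
      fix \<omega> assume e: "\<forall>\<beta>\<in>bonds_at {0}. \<beta> \<notin> occupied \<omega>" "?e \<in> cluster_off (occupied \<omega> - {}) {0, ?e} 0"
      have "occupied \<omega> - {{0, ?e}} = occupied \<omega> - {{0, ?e}} - bonds_at {0}" using e by auto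
      moreover have "conn (occupied \<omega> - {{0, ?e}}) 0 ?e" using e by (simp add: in_cluster_off)
      ultimately have "0 = ?e" using conn_isolated[of "occupied \<omega> - {{0, ?e}}" "{0}" 0 ?e] occupied_subset[of \<omega>] by auto
      then show False using unit_vec_ne_0[of \<kappa>] by simp
    qed
    show "{\<omega> \<in> space (perc p). ?e \<notin> cluster_off (occupied \<omega> - {}) {0, ?e} 0} \<in> events" by measurable
  qed
  finally show ?thesis using assms by (simp add: mu_eq[of p \<kappa>])
qed

section \<open>Cutting a bond\<close>

lemma expect_off_cong:
  assumes "\<And>C. C \<subseteq> bonds \<Longrightarrow> F (C - B) = G (C - B)"
  shows "expect_off p B F = expect_off p B G"
  unfolding expect_off_def using assms[OF occupied_subset] by simp

lemma expect_off_mono: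
  assumes "\<And>C. C \<subseteq> bonds \<Longrightarrow> F (C - B) \<le> G (C - B)"
  shows "expect_off p B F \<le> expect_off p B G"
  unfolding expect_off_def by (intro nn_integral_mono assms occupied_subset)

lemma measurable_off:
  assumes "F \<in> measurable set_space N"
  shows "(\<lambda>\<omega>. F (occupied \<omega> - B)) \<in> measurable (perc p) N"
  by (rule measurable_compose[OF _ assms]) measurable

lemma expect_off_add:
  assumes "F \<in> borel_measurable set_space" "G \<in> borel_measurable set_space"
  shows "expect_off p B (\<lambda>C. F C + G C) = expect_off p B F + expect_off p B G"
  unfolding expect_off_def using assms by (intro nn_integral_add measurable_off)

lemma expect_off_cmult:
  assumes "F \<in> borel_measurable set_space"
  shows "expect_off p B (\<lambda>C. c * F C) = c * expect_off p B F"
  unfolding expect_off_def using assms by (intro nn_integral_cmult measurable_off)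

lemma expect_off_sum:
  assumes "countable I" "\<And>i. i \<in> I \<Longrightarrow> F i \<in> borel_measurable set_space"
  shows "expect_off p B (\<lambda>C. \<integral>\<^sup>+i. F i C \<partial>count_space I) = (\<integral>\<^sup>+i. expect_off p B (F i) \<partial>count_space I)"
  unfolding expect_off_def using assms by (intro nn_integral_count_space_nn_integral measurable_off)

lemma measurable_expect_off:
  assumes F: "(\<lambda>(C, A). F C A) \<in> borel_measurable (set_space \<Otimes>\<^sub>M set_space)"
  shows "(\<lambda>A. expect_off p B (\<lambda>C. F C A)) \<in> borel_measurable set_space"
proof -
  interpret prob_space "perc p" by (rule prob_space_perc)
  have m: "(\<lambda>(A, \<omega>). (occupied \<omega> - B, A)) \<in> measurable (set_space \<Otimes>\<^sub>M perc p) (set_space \<Otimes>\<^sub>M set_space)"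
    by measurable
  have "(\<lambda>(A, \<omega>). F (occupied \<omega> - B) A) \<in> borel_measurable (set_space \<Otimes>\<^sub>M perc p)"
    using measurable_compose[OF m F] by (simp add: case_prod_beta)
  then show ?thesis unfolding expect_off_def by (rule borel_measurable_nn_integral)
qed

text \<open>The bond \<open>b\<close> is grouped with \<open>K\<close> and then split off again, so
  that independence of pairs is applied twice.\<close>

lemma perc_indep3:
  assumes KL: "K \<subseteq> bonds" "L \<subseteq> bonds" "b \<in> bonds" "K \<inter> L = {}" "b \<notin> K" "b \<notin> L" and p: "0 \<le> p" "p \<le> 1"
    and [measurable]: "Measurable.pred set_space f" "Measurable.pred set_space g"
  shows "\<P>(\<omega> in perc p. f (occupied \<omega> \<inter> K) \<and> b \<in> occupied \<omega> \<and> g (occupied \<omega> \<inter> L)) =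
     p * (\<P>(\<omega> in perc p. f (occupied \<omega> \<inter> K)) * \<P>(\<omega> in perc p. g (occupied \<omega> \<inter> L)))"
proof -
  let ?h = "\<lambda>X. f (X \<inter> K) \<and> b \<in> X"
  have "\<P>(\<omega> in perc p. ?h (occupied \<omega> \<inter> insert b K) \<and> g (occupied \<omega> \<inter> L)) =
      \<P>(\<omega> in perc p. ?h (occupied \<omega> \<inter> insert b K)) * \<P>(\<omega> in perc p. g (occupied \<omega> \<inter> L))"
    using KL by (intro perc_indep) auto
  moreover have "\<P>(\<omega> in perc p. f (occupied \<omega> \<inter> K) \<and> b \<in> occupied \<omega> \<inter> {b}) =
      \<P>(\<omega> in perc p. f (occupied \<omega> \<inter> K)) * \<P>(\<omega> in perc p. b \<in> occupied \<omega> \<inter> {b})"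
    using KL by (intro perc_indep) auto
  moreover have "occupied \<omega> \<inter> insert b K \<inter> K = occupied \<omega> \<inter> K" for \<omega> by auto
  ultimately show ?thesis using perc_bond[OF p KL(3)] by (simp add: conj_assoc)
qed

lemma measurable_cluster_eq:
  assumes [measurable]: "f \<in> measurable M set_space"
  shows "Measurable.pred M (\<lambda>\<omega>. cluster (f \<omega>) v = S)"
proof -
  have "cluster X v = S \<longleftrightarrow> (\<forall>z. conn X v z \<longleftrightarrow> z \<in> S)" for X
    unfolding set_eq_iff in_cluster by (rule refl)
  then show ?thesis by (simp only:) measurable
qed

lemma measurable_cluster_E_prime:
  "Measurable.pred set_space (cluster_E_prime v u A S)"
  unfolding cluster_E_prime_def[abs_def] by (intro pred_intros_logic measurable_cluster_eq measurable_E_prime) auto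

text \<open>
  The cluster is almost surely finite and hence almost surely takes one of countably many values.
\<close>

lemma expect_off_cluster_sum:
  fixes F :: "'d::finite bond set \<Rightarrow> ennreal"
  assumes chi: "chi TYPE('d) p < \<infinity>" and [measurable]: "F \<in> borel_measurable set_space"
  shows "expect_off p B F =
     (\<integral>\<^sup>+S. expect_off p B (\<lambda>C. of_bool (cluster_off C \<beta> v = S) * F C) \<partial>count_space {S. finite S})"
proof -
  have "countable {S :: (int ^ 'd) set. finite S}" by (rule countable_Collect_finite)
  moreover have "(\<lambda>C. of_bool (cluster_off C \<beta> v = S) * F C) \<in> borel_measurable set_space" for S
  proof -
    have [measurable]: "Measurable.pred set_space (\<lambda>C. cluster_off C \<beta> v = S)"
      unfolding cluster_off_def by (intro measurable_cluster_eq) auto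
    show ?thesis by measurable
  qed
  ultimately have "(\<integral>\<^sup>+S. expect_off p B (\<lambda>C. of_bool (cluster_off C \<beta> v = S) * F C) \<partial>count_space {S. finite S}) =
     expect_off p B (\<lambda>C. \<integral>\<^sup>+S. of_bool (cluster_off C \<beta> v = S) * F C \<partial>count_space {S. finite S})"
    by (intro expect_off_sum[symmetric])
  also have "\<dots> = expect_off p B F"
    unfolding expect_off_def
  proof (rule nn_integral_cong_AE)
    show "AE \<omega> in perc p. (\<integral>\<^sup>+S. of_bool (cluster_off (occupied \<omega> - B) \<beta> v = S) * F (occupied \<omega> - B) \<partial>count_space {S. finite S}) =
        F (occupied \<omega> - B)"
      using AE_finite_cluster[OF chi, of v]
    proof eventually_elim
      case (elim \<omega>)
      let ?S = "cluster_off (occupied \<omega> - B) \<beta> v"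
      have "?S \<subseteq> cluster (occupied \<omega>) v"
        by (auto simp: in_cluster_off in_cluster intro: conn_mono)
      then have "finite ?S" using elim finite_subset by blast
      have "(\<integral>\<^sup>+S. of_bool (?S = S) * F (occupied \<omega> - B) \<partial>count_space {S. finite S}) =
          (\<integral>\<^sup>+S. F (occupied \<omega> - B) * indicator {?S} S \<partial>count_space {S. finite S})"
        by (intro nn_integral_cong) (auto simp: indicator_def)
      also have "\<dots> = F (occupied \<omega> - B)"
        using \<open>finite ?S\<close> by (subst nn_integral_cmult_indicator) (auto simp: emeasure_count_space)
      finally show ?case .
    qed
  qed
  finally show ?thesis by simp
qed

text \<open>The conditional probability of a connection in the unexplored part, given the explored
  set \<open>S\<close>; it is evaluated at random clusters.\<close>

definition tau_off :: "real \<Rightarrow> (int ^ 'd::finite) set \<Rightarrow> int ^ 'd \<Rightarrow> int ^ 'd \<Rightarrow> ennreal" where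
  "tau_off p S w x = expect_off p {} (\<lambda>C. of_bool (conn (C - bonds_at S) w x))"

lemma measurable_of_bool_pred:
  "Measurable.pred M P \<Longrightarrow> (\<lambda>x. of_bool (P x) :: ennreal) \<in> borel_measurable M"
  by measurable

lemma measurable_tau_off: "(\<lambda>S. tau_off p S w x) \<in> borel_measurable set_space"
  unfolding tau_off_def
  by (rule measurable_expect_off) measurable

text \<open>
  The cutting-bond lemma: given that the cluster \<open>S\<close> of \<open>v\<close> off \<open>b\<close> satisfies the constraints, the
  state of \<open>b\<close> and the connection from the top of \<open>b\<close> off \<open>S\<close> are independent of \<open>S\<close>.
\<close>

lemma expect_first_pivotal:
  fixes b :: "'d::finite dbond"
  assumes chi: "chi TYPE('d) p < \<infinity>" and p: "0 \<le> p" "p \<le> 1" and g: "good B A' v A" and b: "b \<in> dbonds"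
  shows "expect_off p B (\<lambda>C. of_bool (first_pivotal C v x A b)) =
     ennreal p * expect_off p B (\<lambda>C. of_bool (E_prime C v (fst b) A) *
       of_bool (snd b \<notin> cluster_off C (ubond b) v \<union> A') *
       tau_off p (cluster_off C (ubond b) v \<union> A') (snd b) x)"
proof -
  let ?S = "\<lambda>C. cluster_off C (ubond b) v"
  let ?F = "\<lambda>C. of_bool (E_prime C v (fst b) A) * of_bool (snd b \<notin> ?S C \<union> A') * tau_off p (?S C \<union> A') (snd b) x"
  have mF: "?F \<in> borel_measurable set_space"
  proof -
    have "(\<lambda>C. ?S C \<union> A') \<in> measurable set_space set_space" by measurable
    then have [measurable]: "(\<lambda>C. tau_off p (?S C \<union> A') (snd b) x) \<in> borel_measurable set_space"
      by (rule measurable_compose[OF _ measurable_tau_off])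
    show ?thesis by measurable
  qed
  have mG: "(\<lambda>C. of_bool (first_pivotal C v x A b) :: ennreal) \<in> borel_measurable set_space" by measurable
  \<comment> \<open>With the cluster fixed to be \<open>S\<close>, the sets of bonds involved are
    deterministic and independence applies.\<close>
  have eq: "expect_off p B (\<lambda>C. of_bool (?S C = S) * of_bool (first_pivotal C v x A b)) =
      ennreal p * expect_off p B (\<lambda>C. of_bool (?S C = S) * ?F C)" if "finite S" for S
  proof -
    let ?K = "bonds_at S - {ubond b} - B" and ?L = "bonds - bonds_at (S \<union> A')"
    let ?c = "snd b \<notin> S \<union> A' \<and> fst b \<in> S"
    let ?G = "cluster_E_prime v (fst b) A S"
    let ?H = "\<lambda>X. conn X (snd b) x"
    have E1: "expect_off p B (\<lambda>C. of_bool (?S C = S) * of_bool (first_pivotal C v x A b)) =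
        expect_off p {} (\<lambda>C. of_bool (?c \<and> ?G (C \<inter> ?K) \<and> ubond b \<in> C \<and> ?H (C \<inter> ?L)))"
      unfolding expect_off_def
    proof (intro nn_integral_cong)
      fix \<omega> :: "'d bond \<Rightarrow> bool"
      show "of_bool (?S (occupied \<omega> - B) = S) * of_bool (first_pivotal (occupied \<omega> - B) v x A b) =
         (of_bool (?c \<and> ?G ((occupied \<omega> - {}) \<inter> ?K) \<and> ubond b \<in> occupied \<omega> - {} \<and> ?H ((occupied \<omega> - {}) \<inter> ?L)) :: ennreal)"
        using first_pivotal_cluster_iff[OF g occupied_subset b, of \<omega> x S] by auto
    qed
    have E2: "expect_off p B (\<lambda>C. of_bool (?S C = S) * ?F C) =
        expect_off p {} (\<lambda>C. tau_off p (S \<union> A') (snd b) x * of_bool (?c \<and> ?G (C \<inter> ?K)))"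
      unfolding expect_off_def
    proof (intro nn_integral_cong)
      fix \<omega> :: "'d bond \<Rightarrow> bool"
      show "of_bool (?S (occupied \<omega> - B) = S) * ?F (occupied \<omega> - B) =
         tau_off p (S \<union> A') (snd b) x * of_bool (?c \<and> ?G ((occupied \<omega> - {}) \<inter> ?K))"
        using E_prime_cluster_iff[OF occupied_subset, of \<omega> B v b A A' S] by (auto simp: ac_simps)
    qed
    show ?thesis
    proof (cases ?c)
      case False
      then show ?thesis unfolding E1 E2 by (auto simp: expect_off_def)
    next
      case True
      have mK [measurable]: "Measurable.pred set_space (\<lambda>C. ?G (C \<inter> ?K))"
        by (rule measurable_compose[OF _ measurable_cluster_E_prime]) measurable
      have "prob_off p {} (\<lambda>C. ?G (C \<inter> ?K) \<and> ubond b \<in> C \<and> ?H (C \<inter> ?L)) =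
          p * (prob_off p {} (\<lambda>C. ?G (C \<inter> ?K)) * prob_off p {} (\<lambda>C. ?H (C \<inter> ?L)))"
        unfolding prob_off_def Diff_empty
      proof (rule perc_indep3)
        show "ubond b \<in> bonds" using b by (simp add: ubond_in_bonds)
        \<comment> \<open>\<open>fst b \<in> S\<close> puts \<open>b\<close> among the bonds at
          \<open>S\<close>.\<close>
        then show "ubond b \<notin> ?L" using True by (auto simp: bonds_at_def ubond_def)
        show "Measurable.pred set_space ?G" by (rule measurable_cluster_E_prime)
      qed (use p in \<open>auto simp: bonds_at_def\<close>)
      moreover have "ennreal (prob_off p {} (\<lambda>C. ?H (C \<inter> ?L))) = tau_off p (S \<union> A') (snd b) x"
      proof -
        have "tau_off p (S \<union> A') (snd b) x = ennreal (prob_off p {} (\<lambda>C. conn (C - bonds_at (S \<union> A')) (snd b) x))"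
          unfolding tau_off_def by (rule expect_off_of_bool) measurable
        also have "prob_off p {} (\<lambda>C. conn (C - bonds_at (S \<union> A')) (snd b) x) = prob_off p {} (\<lambda>C. ?H (C \<inter> ?L))"
        proof (rule prob_off_cong)
          fix C :: "'d bond set" assume "C \<subseteq> bonds"
          then have "C \<inter> ?L = C - bonds_at (S \<union> A')" by auto
          then show "conn (C - {} - bonds_at (S \<union> A')) (snd b) x \<longleftrightarrow> ?H ((C - {}) \<inter> ?L)" by simp
        qed
        finally show ?thesis by simp
      qed
      moreover have "expect_off p {} (\<lambda>C. of_bool (?G (C \<inter> ?K) \<and> ubond b \<in> C \<and> ?H (C \<inter> ?L))) =
          ennreal (prob_off p {} (\<lambda>C. ?G (C \<inter> ?K) \<and> ubond b \<in> C \<and> ?H (C \<inter> ?L)))"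
        by (rule expect_off_of_bool) measurable
      moreover have "expect_off p {} (\<lambda>C. tau_off p (S \<union> A') (snd b) x * of_bool (?G (C \<inter> ?K))) =
          tau_off p (S \<union> A') (snd b) x * ennreal (prob_off p {} (\<lambda>C. ?G (C \<inter> ?K)))"
        using mK by (subst expect_off_cmult) (auto simp: expect_off_of_bool)
      ultimately show ?thesis
        unfolding E1 E2 using True p by (simp add: ennreal_mult prob_off_nonneg ac_simps)
    qed
  qed
  have "expect_off p B (\<lambda>C. of_bool (first_pivotal C v x A b)) =
      (\<integral>\<^sup>+S. expect_off p B (\<lambda>C. of_bool (?S C = S) * of_bool (first_pivotal C v x A b)) \<partial>count_space {S. finite S})"
    by (rule expect_off_cluster_sum[OF chi mG])
  also have "\<dots> = (\<integral>\<^sup>+S. ennreal p * expect_off p B (\<lambda>C. of_bool (?S C = S) * ?F C) \<partial>count_space {S. finite S})"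
    by (intro nn_integral_cong eq) simp
  also have "\<dots> = ennreal p * (\<integral>\<^sup>+S. expect_off p B (\<lambda>C. of_bool (?S C = S) * ?F C) \<partial>count_space {S. finite S})"
    by (rule nn_integral_cmult) simp
  also have "(\<integral>\<^sup>+S. expect_off p B (\<lambda>C. of_bool (?S C = S) * ?F C) \<partial>count_space {S. finite S}) = expect_off p B ?F"
    by (rule expect_off_cluster_sum[OF chi mF, symmetric])
  finally show ?thesis .
qed

lemma tau_off_split:
  assumes "w \<notin> S" "u \<in> S"
  shows "ennreal (prob_off p (bonds_at {u}) (\<lambda>C. conn C w x)) =
     tau_off p S w x + expect_off p (bonds_at {u}) (\<lambda>C. of_bool (conn_through C S w x))"
proof -
  have "ennreal (prob_off p (bonds_at {u}) (\<lambda>C. conn C w x)) =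
      expect_off p (bonds_at {u}) (\<lambda>C. of_bool (conn C w x))"
    by (rule expect_off_of_bool[symmetric]) measurable
  also have "\<dots> = expect_off p {} (\<lambda>C. of_bool (conn (C - bonds_at S) w x) +
      of_bool (conn_through (C - bonds_at {u}) S w x))"
    unfolding expect_off_def using conn_off_through[OF assms, of _ x] by simp
  also have "\<dots> = tau_off p S w x + expect_off p {} (\<lambda>C. of_bool (conn_through (C - bonds_at {u}) S w x))"
    unfolding tau_off_def by (rule expect_off_add) measurable
  also have "expect_off p {} (\<lambda>C. of_bool (conn_through (C - bonds_at {u}) S w x)) =
      expect_off p (bonds_at {u}) (\<lambda>C. of_bool (conn_through C S w x))"
    by (simp add: expect_off_def)
  finally show ?thesis .
qed

section \<open>The expansion of nested expectations\<close>

lemma measurable_nested: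
  assumes F: "\<And>A' v. Measurable.pred (set_space \<Otimes>\<^sub>M set_space) (\<lambda>(C, A). F C A' v A)"
  shows "(\<lambda>A. nested p F B A' v A bs) \<in> borel_measurable set_space"
proof (induction bs arbitrary: B A' v)
  case Nil
  have "(\<lambda>(C, A). of_bool (F C A' v A) :: ennreal) \<in> borel_measurable (set_space \<Otimes>\<^sub>M set_space)"
    using measurable_of_bool_pred[OF F[of A' v]] by (simp add: case_prod_beta)
  then show ?case by (simp add: measurable_expect_off)
next
  case (Cons b bs)
  have "(\<lambda>z. cluster_off (fst z) (ubond b) v \<union> A') \<in> measurable (set_space \<Otimes>\<^sub>M set_space) set_space"
    by measurable
  from measurable_compose[OF this Cons[of "bonds_at {fst b}" "{fst b}" "snd b"]]
  have [measurable]: "(\<lambda>z. nested p F (bonds_at {fst b}) {fst b} (snd b) (cluster_off (fst z) (ubond b) v \<union> A') bs)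
      \<in> borel_measurable (set_space \<Otimes>\<^sub>M set_space)" .
  show ?case
    unfolding nested.simps by (rule measurable_expect_off) (unfold case_prod_beta, measurable)
qed

text \<open>One of three innermost events to be inserted into \<open>nested\<close>, with the
  arguments that \<open>nested\<close> hands over: this one yields the remainders,
  \<open>E_event\<close> the coefficients \<Xi> and \<open>Psi_event\<close> the coefficients
  \<Psi>.\<close>

definition thr_event :: "int ^ 'd::finite \<Rightarrow> 'd bond set \<Rightarrow> (int ^ 'd) set \<Rightarrow> int ^ 'd \<Rightarrow> (int ^ 'd) set \<Rightarrow> bool" where
  "thr_event x C A' v A \<longleftrightarrow> conn_through C A v x"

definition E_event :: "int ^ 'd::finite \<Rightarrow> 'd bond set \<Rightarrow> (int ^ 'd) set \<Rightarrow> int ^ 'd \<Rightarrow> (int ^ 'd) set \<Rightarrow> bool" where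
  "E_event x C A' v A \<longleftrightarrow> E_prime C v x A"

definition Psi_event :: "'d::finite dbond \<Rightarrow> 'd bond set \<Rightarrow> (int ^ 'd) set \<Rightarrow> int ^ 'd \<Rightarrow> (int ^ 'd) set \<Rightarrow> bool" where
  "Psi_event b C A' v A \<longleftrightarrow> E_prime C v (fst b) A \<and> snd b \<notin> cluster_off C (ubond b) v \<union> A'"

text \<open>For \<open>b = (y, y - unit_vec \<kappa>)\<close> this is
  \<open>tau_dir p \<kappa> (x - y + unit_vec \<kappa>)\<close> before translation to the
  origin.\<close>

definition t_conn :: "real \<Rightarrow> int ^ 'd::finite \<Rightarrow> 'd dbond \<Rightarrow> ennreal" where
  "t_conn p x b = ennreal (prob_off p (bonds_at {fst b}) (\<lambda>C. conn C (snd b) x))"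

lemma measurable_events:
  "Measurable.pred (set_space \<Otimes>\<^sub>M set_space) (\<lambda>(C, A). thr_event x C A' v A)"
  "Measurable.pred (set_space \<Otimes>\<^sub>M set_space) (\<lambda>(C, A). E_event x C A' v A)"
  "Measurable.pred (set_space \<Otimes>\<^sub>M set_space) (\<lambda>(C, A). Psi_event b C A' v A)"
  unfolding thr_event_def E_event_def Psi_event_def case_prod_beta by measurable

lemmas measurable_nested_events = measurable_events[THEN measurable_nested]

lemma E_prime_bottom_in_cluster:
  assumes "E_prime C v (fst b) A" "snd b \<notin> cluster_off C (ubond b) v \<union> A'"
  shows "fst b \<in> cluster_off C (ubond b) v"
  using assms(2) conn_bottom_off[OF E_prime_imp_conn[OF assms(1)]] by (auto simp: in_cluster_off)

text \<open>Integrates \<open>tau_off_split\<close> with \<open>u = fst b\<close>, which belongs to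
  the explored cluster. The through-connection that would be subtracted from the two-point function
  is exactly one further level of nesting; it stands on the left with a plus sign.\<close>

lemma nested_thr_single:
  assumes "b \<in> dbonds"
  shows "expect_off p B (\<lambda>C. of_bool (E_prime C v (fst b) A) *
       of_bool (snd b \<notin> cluster_off C (ubond b) v \<union> A') *
       tau_off p (cluster_off C (ubond b) v \<union> A') (snd b) x) +
     nested p (thr_event x) B A' v A [b] = t_conn p x b * nested p (Psi_event b) B A' v A []"
proof -
  let ?S = "\<lambda>C. cluster_off C (ubond b) v \<union> A'"
  let ?W = "\<lambda>C. of_bool (E_prime C v (fst b) A) * of_bool (snd b \<notin> ?S C) :: ennreal"
  let ?N = "\<lambda>S. nested p (thr_event x) (bonds_at {fst b}) {fst b} (snd b) S []"
  have [measurable]: "(\<lambda>C. ?S C) \<in> measurable set_space set_space" by measurable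
  have [measurable]: "(\<lambda>C. tau_off p (?S C) (snd b) x) \<in> borel_measurable set_space"
    by (rule measurable_compose[OF _ measurable_tau_off]) measurable
  have [measurable]: "(\<lambda>C. ?N (?S C)) \<in> borel_measurable set_space"
    by (rule measurable_compose[OF _ measurable_nested_events(1)]) measurable
  have pt: "?W C * tau_off p (?S C) (snd b) x + ?W C * ?N (?S C) = t_conn p x b * of_bool (Psi_event b C A' v A)" for C
  proof (cases "E_prime C v (fst b) A \<and> snd b \<notin> ?S C")
    case True
    then have "fst b \<in> ?S C" using E_prime_bottom_in_cluster by blast
    then have "t_conn p x b = tau_off p (?S C) (snd b) x + ?N (?S C)"
      using tau_off_split[of "snd b" "?S C" "fst b" p x] True by (simp add: t_conn_def thr_event_def)
    then show ?thesis using True by (simp add: Psi_event_def)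
  qed (auto simp: Psi_event_def)
  have "expect_off p B (\<lambda>C. ?W C * tau_off p (?S C) (snd b) x) + nested p (thr_event x) B A' v A [b] =
     expect_off p B (\<lambda>C. ?W C * tau_off p (?S C) (snd b) x + ?W C * ?N (?S C))"
    by (simp only: nested.simps(2)) (rule expect_off_add[symmetric]; measurable)
  also have "\<dots> = expect_off p B (\<lambda>C. t_conn p x b * of_bool (Psi_event b C A' v A))"
    by (simp only: pt)
  also have "\<dots> = t_conn p x b * nested p (Psi_event b) B A' v A []"
    unfolding nested.simps Psi_event_def by (rule expect_off_cmult) measurable
  finally show ?thesis .
qed

text \<open>The decomposition by the first pivotal bond is integrated, and the cutting-bond lemma
  evaluates each term. Adding the remainders with one more bond completes the connections off
  clusters to connections off single vertices.\<close>

lemma nested_one_step: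
  fixes x :: "int ^ 'd::finite"
  assumes chi: "chi TYPE('d) p < \<infinity>" and p: "0 \<le> p" "p \<le> 1" and g: "good B A' v A"
  shows "nested p (thr_event x) B A' v A [] + ennreal p * bond_sum (\<lambda>b. nested p (thr_event x) B A' v A [b]) =
     nested p (E_event x) B A' v A [] +
     ennreal p * bond_sum (\<lambda>b. t_conn p x b * nested p (Psi_event b) B A' v A [])"
proof -
  let ?f = "\<lambda>b. expect_off p B (\<lambda>C. of_bool (E_prime C v (fst b) A) *
       of_bool (snd b \<notin> cluster_off C (ubond b) v \<union> A') *
       tau_off p (cluster_off C (ubond b) v \<union> A') (snd b) x)"
  have "nested p (thr_event x) B A' v A [] =
      expect_off p B (\<lambda>C. of_bool (E_prime C v x A) + bond_sum (\<lambda>b. of_bool (first_pivotal C v x A b)))"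
    unfolding nested.simps thr_event_def
    by (rule expect_off_cong, rule conn_through_decomp) auto
  also have "\<dots> = expect_off p B (\<lambda>C. of_bool (E_prime C v x A)) +
      expect_off p B (\<lambda>C. bond_sum (\<lambda>b. of_bool (first_pivotal C v x A b)))"
    by (intro expect_off_add measurable_nn_integral_count_space countableI_type; measurable)
  also have "expect_off p B (\<lambda>C. bond_sum (\<lambda>b. of_bool (first_pivotal C v x A b))) =
      bond_sum (\<lambda>b. expect_off p B (\<lambda>C. of_bool (first_pivotal C v x A b)))"
    by (intro expect_off_sum countableI_type; measurable)
  also have "\<dots> = bond_sum (\<lambda>b. ennreal p * ?f b)"
    by (intro nn_integral_cong expect_first_pivotal[OF chi p g]) simp
  also have "\<dots> = ennreal p * bond_sum (\<lambda>b. ?f b)"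
    by (rule nn_integral_cmult) simp
  finally have 1: "nested p (thr_event x) B A' v A [] =
      nested p (E_event x) B A' v A [] + ennreal p * bond_sum (\<lambda>b. ?f b)"
    by (simp add: E_event_def)
  have "bond_sum (\<lambda>b. ?f b) + bond_sum (\<lambda>b. nested p (thr_event x) B A' v A [b]) =
      bond_sum (\<lambda>b. ?f b + nested p (thr_event x) B A' v A [b])"
    by (rule nn_integral_add[symmetric]) simp_all
  also have "\<dots> = bond_sum (\<lambda>b. t_conn p x b * nested p (Psi_event b) B A' v A [])"
    by (intro nn_integral_cong nested_thr_single) simp
  finally have 2: "bond_sum (\<lambda>b. ?f b) + bond_sum (\<lambda>b. nested p (thr_event x) B A' v A [b]) =
     bond_sum (\<lambda>b. t_conn p x b * nested p (Psi_event b) B A' v A [])" .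
  show ?thesis unfolding 1 2[symmetric] by (simp add: distrib_left add.assoc)
qed

lemma good_next: "c \<in> dbonds \<Longrightarrow> good (bonds_at {fst c}) {fst c} (snd c) S"
  using dbonds_ne[of c] by (auto simp: good_def)

text \<open>The one-step identity holds at the innermost level for every set passed in from outside.
  The outer levels act on it as expectations with nonnegative weights, which preserve it.\<close>

lemma nested_expand:
  fixes x :: "int ^ 'd::finite"
  assumes chi: "chi TYPE('d) p < \<infinity>" and p: "0 \<le> p" "p \<le> 1"
  shows "good B A' v A \<Longrightarrow> set bs \<subseteq> dbonds \<Longrightarrow>
     nested p (thr_event x) B A' v A bs + ennreal p * bond_sum (\<lambda>b. nested p (thr_event x) B A' v A (bs @ [b])) =
     nested p (E_event x) B A' v A bs +
     ennreal p * bond_sum (\<lambda>b. t_conn p x b * nested p (Psi_event b) B A' v A bs)"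
proof (induction bs arbitrary: B A' v A)
  case Nil
  then show ?case using nested_one_step[OF chi p, of B A' v A x] by simp
next
  case (Cons c bs)
  let ?S = "\<lambda>C. cluster_off C (ubond c) v \<union> A'"
  let ?W = "\<lambda>C. of_bool (E_prime C v (fst c) A) * of_bool (snd c \<notin> ?S C) :: ennreal"
  let ?n = "\<lambda>F S bs. nested p F (bonds_at {fst c}) {fst c} (snd c) S bs"
  have IH: "?n (thr_event x) S bs + ennreal p * bond_sum (\<lambda>b. ?n (thr_event x) S (bs @ [b])) =
      ?n (E_event x) S bs + ennreal p * bond_sum (\<lambda>b. t_conn p x b * ?n (Psi_event b) S bs)" for S
    using Cons.prems by (intro Cons.IH good_next) auto
  have S: "?S \<in> measurable set_space set_space" by measurable
  have W [measurable]: "?W \<in> borel_measurable set_space" by measurable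
  note m = measurable_nested_events[THEN measurable_compose[OF S]]
  \<comment> \<open>Moves the outermost expectation and its weight out of a sum over bonds with
    deterministic weights \<open>k\<close>. It is used with \<open>k\<close> constantly 1 for the
    additional bond on the left, and with \<open>t_conn\<close> on the right.\<close>
  have lin: "expect_off p B (\<lambda>C. ?W C * f (?S C)) + ennreal p * bond_sum (\<lambda>b. k b * expect_off p B (\<lambda>C. ?W C * h b (?S C))) =
      expect_off p B (\<lambda>C. ?W C * (f (?S C) + ennreal p * bond_sum (\<lambda>b. k b * h b (?S C))))"
    if f [measurable]: "(\<lambda>C. f (?S C)) \<in> borel_measurable set_space"
      and h [measurable]: "\<And>b. (\<lambda>C. h b (?S C)) \<in> borel_measurable set_space" for f k and h :: "'d dbond \<Rightarrow> _ \<Rightarrow> ennreal"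
  proof -
    have mh [measurable]: "(\<lambda>C. bond_sum (\<lambda>b. k b * (?W C * h b (?S C)))) \<in> borel_measurable set_space"
      by (intro measurable_nn_integral_count_space countableI_type) measurable
    have "bond_sum (\<lambda>b. k b * expect_off p B (\<lambda>C. ?W C * h b (?S C))) =
       bond_sum (\<lambda>b. expect_off p B (\<lambda>C. k b * (?W C * h b (?S C))))"
      by (intro nn_integral_cong expect_off_cmult[symmetric]) measurable
    also have "\<dots> = expect_off p B (\<lambda>C. bond_sum (\<lambda>b. k b * (?W C * h b (?S C))))"
      by (intro expect_off_sum[symmetric] countableI_type) measurable
    finally have "expect_off p B (\<lambda>C. ?W C * f (?S C)) + ennreal p * bond_sum (\<lambda>b. k b * expect_off p B (\<lambda>C. ?W C * h b (?S C))) =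
      expect_off p B (\<lambda>C. ?W C * f (?S C)) + expect_off p B (\<lambda>C. ennreal p * bond_sum (\<lambda>b. k b * (?W C * h b (?S C))))"
      by (simp only: expect_off_cmult[OF mh])
    also have "\<dots> = expect_off p B (\<lambda>C. ?W C * f (?S C) + ennreal p * bond_sum (\<lambda>b. k b * (?W C * h b (?S C))))"
      by (rule expect_off_add[symmetric]) measurable
    also have "\<dots> = expect_off p B (\<lambda>C. ?W C * (f (?S C) + ennreal p * bond_sum (\<lambda>b. k b * h b (?S C))))"
    proof -
      have "bond_sum (\<lambda>b. k b * (?W C * h b (?S C))) = ?W C * bond_sum (\<lambda>b. k b * h b (?S C))" for C
        by (subst nn_integral_cmult[symmetric]) (auto intro!: nn_integral_cong simp: ac_simps)
      then show ?thesis by (simp add: distrib_left ac_simps)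
    qed
    finally show ?thesis .
  qed
  have "nested p (thr_event x) B A' v A (c # bs) + ennreal p * bond_sum (\<lambda>b. nested p (thr_event x) B A' v A ((c # bs) @ [b])) =
      expect_off p B (\<lambda>C. ?W C * (?n (thr_event x) (?S C) bs + ennreal p * bond_sum (\<lambda>b. ?n (thr_event x) (?S C) (bs @ [b]))))"
    using lin[OF m(1) m(1), where k = "\<lambda>_. 1"] by simp
  also have "\<dots> = expect_off p B (\<lambda>C. ?W C * (?n (E_event x) (?S C) bs + ennreal p * bond_sum (\<lambda>b. t_conn p x b * ?n (Psi_event b) (?S C) bs)))"
    by (simp only: IH)
  also have "\<dots> = nested p (E_event x) B A' v A (c # bs) +
     ennreal p * bond_sum (\<lambda>b. t_conn p x b * nested p (Psi_event b) B A' v A (c # bs))"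
    using lin[OF m(2) m(3), where k = "t_conn p x"] by simp
  finally show ?case .
qed

text \<open>In the innermost connection the requirement to pass through the cluster is dropped; what
  is left is a connection from the top of \<open>b\<close> avoiding its bottom. This is the source
  of the bounds on the remainders.\<close>

lemma nested_thr_le:
  "nested p (thr_event x) B A' v A (bs @ [b]) \<le> t_conn p x b * nested p (Psi_event b) B A' v A bs"
proof (induction bs arbitrary: B A' v A)
  case Nil
  have le: "expect_off p (bonds_at {fst b}) (\<lambda>C. of_bool (thr_event x C {fst b} (snd b) S)) \<le> t_conn p x b" for S
  proof -
    have "t_conn p x b = expect_off p (bonds_at {fst b}) (\<lambda>C. of_bool (conn C (snd b) x))"
      unfolding t_conn_def by (rule expect_off_of_bool[symmetric]) measurable
    then show ?thesis
      by (simp only:) (rule expect_off_mono, auto simp: thr_event_def conn_through_imp_conn)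
  qed
  have "nested p (thr_event x) B A' v A [b] \<le> expect_off p B (\<lambda>C. t_conn p x b * of_bool (Psi_event b C A' v A))"
    unfolding nested.simps
    by (rule expect_off_mono) (use le in \<open>auto simp: Psi_event_def\<close>)
  also have "\<dots> = t_conn p x b * nested p (Psi_event b) B A' v A []"
    unfolding nested.simps Psi_event_def by (rule expect_off_cmult) measurable
  finally show ?case by simp
next
  case (Cons c bs)
  let ?S = "\<lambda>C. cluster_off C (ubond c) v \<union> A'"
  have S: "?S \<in> measurable set_space set_space" by measurable
  note [measurable] = measurable_nested_events(3)[THEN measurable_compose[OF S]]
  have "nested p (thr_event x) B A' v A ((c # bs) @ [b]) \<le>
     expect_off p B (\<lambda>C. t_conn p x b * (of_bool (E_prime C v (fst c) A) * of_bool (snd c \<notin> ?S C) *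
        nested p (Psi_event b) (bonds_at {fst c}) {fst c} (snd c) (?S C) bs))"
    unfolding append_Cons nested.simps
    by (rule expect_off_mono) (use Cons.IH in \<open>auto\<close>)
  also have "\<dots> = t_conn p x b * nested p (Psi_event b) B A' v A (c # bs)"
    unfolding nested.simps by (rule expect_off_cmult) measurable
  finally show ?case .
qed

section \<open>Sums over lists of directed bonds\<close>

definition bond_lists :: "nat \<Rightarrow> 'd::finite dbond list set" where
  "bond_lists N = {bs. set bs \<subseteq> dbonds \<and> length bs = N}"

abbreviation list_sum :: "nat \<Rightarrow> ('d::finite dbond list \<Rightarrow> ennreal) \<Rightarrow> ennreal" where
  "list_sum N \<equiv> nn_integral (count_space (bond_lists N))"

lemma nn_integral_count_space_prod:
  fixes f :: "'a \<times> 'b \<Rightarrow> ennreal"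
  assumes "countable A" "countable B"
  shows "(\<integral>\<^sup>+z. f z \<partial>count_space (A \<times> B)) = (\<integral>\<^sup>+x. \<integral>\<^sup>+y. f (x, y) \<partial>count_space B \<partial>count_space A)"
proof -
  interpret sigma_finite_measure "count_space B"
    using assms(2) by (rule sigma_finite_measure_count_space_countable)
  have "f \<in> borel_measurable (count_space A \<Otimes>\<^sub>M count_space B)"
    by (simp add: pair_measure_countable[OF assms])
  from nn_integral_fst[OF this] show ?thesis by (simp add: pair_measure_countable[OF assms])
qed

lemma nn_integral_count_space_swap:
  fixes f :: "'a \<Rightarrow> 'b \<Rightarrow> ennreal"
  assumes "countable B"
  shows "(\<integral>\<^sup>+x. \<integral>\<^sup>+y. f x y \<partial>count_space B \<partial>count_space A) =
     (\<integral>\<^sup>+y. \<integral>\<^sup>+x. f x y \<partial>count_space A \<partial>count_space B)"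
  by (rule nn_integral_count_space_nn_integral[OF assms]) simp

lemma bond_lists_0: "bond_lists 0 = {[]}"
  by (auto simp: bond_lists_def)

lemma nn_integral_bond_lists_0: "list_sum 0 (\<lambda>bs. f bs) = f []"
  unfolding bond_lists_0 by (simp add: nn_integral_count_space_finite)

text \<open>The last entry is the innermost bond, where the expansion adds a level;
  \<open>nn_integral_bond_lists_Cons\<close> splits off the outermost bond for the recursive
  bounds.\<close>

lemma nn_integral_bond_lists_snoc:
  "list_sum (Suc N) (\<lambda>bs. f bs) =
   list_sum N (\<lambda>bs. bond_sum (\<lambda>b. f (bs @ [b])))"
proof -
  have "bij_betw (\<lambda>(bs, b). bs @ [b]) (bond_lists N \<times> dbonds) (bond_lists (Suc N))"
    by (rule bij_betw_byWitness[of _ "\<lambda>bs. (butlast bs, last bs)"])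
      (auto simp: bond_lists_def length_Suc_conv_rev)
  from nn_integral_bij_count_space[OF this, of f] show ?thesis
    by (simp add: case_prod_beta nn_integral_count_space_prod)
qed

lemma nn_integral_bond_lists_Cons:
  "list_sum (Suc N) (\<lambda>bs. f bs) =
   bond_sum (\<lambda>b. list_sum N (\<lambda>bs. f (b # bs)))"
proof -
  have "bij_betw (\<lambda>(b, bs). b # bs) (dbonds \<times> bond_lists N) (bond_lists (Suc N))"
    by (rule bij_betw_byWitness[of _ "\<lambda>bs. (hd bs, tl bs)"])
      (auto simp: bond_lists_def length_Suc_conv)
  from nn_integral_bij_count_space[OF this, of f] show ?thesis
    by (simp add: case_prod_beta nn_integral_count_space_prod)
qed

lemma unit_vec_inj: "unit_vec \<kappa> = unit_vec \<kappa>' \<Longrightarrow> \<kappa> = \<kappa>'"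
proof -
  assume eq: "unit_vec \<kappa> = unit_vec \<kappa>'"
  have "snd \<kappa> = snd \<kappa>'"
    using arg_cong[OF eq, of "\<lambda>z. z $ snd \<kappa>"] by (auto simp: unit_vec_def axis_def split: if_splits)
  moreover have "fst \<kappa> = fst \<kappa>'"
    using arg_cong[OF eq, of "\<lambda>z. z $ snd \<kappa>"] calculation by (auto simp: unit_vec_def axis_def split: if_splits)
  ultimately show ?thesis by (simp add: prod_eq_iff)
qed

lemma in_dbonds: "(y, y - unit_vec \<kappa>) \<in> dbonds"
  unfolding dbonds_def using bonds_iff[of y "y - unit_vec \<kappa>"] unit_vec_opp[of \<kappa>]
  by (auto intro!: exI[of _ "fst (opp \<kappa>)"] exI[of _ "snd (opp \<kappa>)"])

text \<open>Parametrizing a bond by its bottom and the direction opposite to its step produces the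
  index pairs \<open>(y, \<kappa>)\<close> of the theorem.\<close>

lemma nn_integral_dbonds:
  "bond_sum (\<lambda>b. g b) = (\<integral>\<^sup>+z. g (fst z, fst z - unit_vec (snd z)) \<partial>count_space UNIV)"
proof -
  have "bij_betw (\<lambda>z. (fst z, fst z - unit_vec (snd z))) UNIV (dbonds :: 'a dbond set)"
    unfolding bij_betw_def
  proof
    show "inj (\<lambda>z :: (int ^ 'a) \<times> 'a dir. (fst z, fst z - unit_vec (snd z)))"
    proof (rule injI)
      fix z z' :: "(int ^ 'a) \<times> 'a dir"
      assume "(fst z, fst z - unit_vec (snd z)) = (fst z', fst z' - unit_vec (snd z'))"
      then have "fst z = fst z'" "fst z - unit_vec (snd z) = fst z' - unit_vec (snd z')" by blast+
      then have "fst z = fst z'" "unit_vec (snd z) = unit_vec (snd z')" by simp_all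
      then show "z = z'" using unit_vec_inj by (simp add: prod_eq_iff[of z z'])
    qed
    show "range (\<lambda>z. (fst z, fst z - unit_vec (snd z))) = (dbonds :: 'a dbond set)"
    proof
      show "range (\<lambda>z. (fst z, fst z - unit_vec (snd z))) \<subseteq> (dbonds :: 'a dbond set)"
        using in_dbonds by auto
      show "(dbonds :: 'a dbond set) \<subseteq> range (\<lambda>z. (fst z, fst z - unit_vec (snd z)))"
      proof
        fix b :: "'a dbond" assume "b \<in> dbonds"
        then have "{fst b, snd b} \<in> bonds" by (cases b) (simp add: dbonds_def)
        then obtain \<iota> where "snd b = fst b + unit_vec \<iota>" unfolding bonds_iff by blast
        then have "b = (\<lambda>z. (fst z, fst z - unit_vec (snd z))) (fst b, opp \<iota>)"
          by (simp add: unit_vec_opp prod_eq_iff)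
        then show "b \<in> range (\<lambda>z. (fst z, fst z - unit_vec (snd z)))" by blast
      qed
    qed
  qed
  from nn_integral_bij_count_space[OF this, of g] show ?thesis by simp
qed

lemma nested_sum_eq:
  "nested_sum p F B A' N v A = ennreal (p ^ N) * list_sum N (\<lambda>bs. nested p F B A' v A bs)"
  unfolding nested_sum_def bond_lists_def by (simp add: infsum_ennreal_eq_nn_integral)

lemma nested_sum_0: "nested_sum p F B A' 0 v A = nested p F B A' v A []"
  by (simp add: nested_sum_eq nn_integral_bond_lists_0)

lemma measurable_nested_sum:
  assumes "\<And>A' v. Measurable.pred (set_space \<Otimes>\<^sub>M set_space) (\<lambda>(C, A). F C A' v A)"
  shows "(\<lambda>A. nested_sum p F B A' N v A) \<in> borel_measurable set_space"
proof -
  have [measurable]: "(\<lambda>A. list_sum N (\<lambda>bs. nested p F B A' v A bs)) \<in> borel_measurable set_space"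
    by (rule measurable_nn_integral_count_space[OF _ measurable_nested[OF assms]]) simp
  show ?thesis unfolding nested_sum_eq by measurable
qed

text \<open>With \<open>B = A' = {}\<close>, start \<open>0\<close> and \<open>A = {0}\<close> this
  is \<mu> times the convolution of \<open>Psi p N\<close> with the functions
  \<open>tau_dir\<close>, except that order 0 also contains the term of the Kronecker delta.\<close>

definition Psi_sum where
  "Psi_sum p x B A' N v A =
     ennreal p * bond_sum (\<lambda>b. t_conn p x b * nested_sum p (Psi_event b) B A' N v A)"

lemma Psi_sum_eq:
  "Psi_sum p x B A' N v A = ennreal (p ^ N) *
     list_sum N (\<lambda>bs. ennreal p * bond_sum (\<lambda>b. t_conn p x b * nested p (Psi_event b) B A' v A bs))"
proof -
  have "bond_sum (\<lambda>b. t_conn p x b * nested_sum p (Psi_event b) B A' N v A) =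
     bond_sum (\<lambda>b. ennreal (p ^ N) * list_sum N (\<lambda>bs. t_conn p x b * nested p (Psi_event b) B A' v A bs))"
    by (intro nn_integral_cong) (simp add: nested_sum_eq nn_integral_cmult ac_simps)
  also have "\<dots> = ennreal (p ^ N) * bond_sum (\<lambda>b. list_sum N (\<lambda>bs. t_conn p x b * nested p (Psi_event b) B A' v A bs))"
    by (rule nn_integral_cmult) simp
  also have "bond_sum (\<lambda>b. list_sum N (\<lambda>bs. t_conn p x b * nested p (Psi_event b) B A' v A bs)) =
      list_sum N (\<lambda>bs. bond_sum (\<lambda>b. t_conn p x b * nested p (Psi_event b) B A' v A bs))"
    by (rule nn_integral_count_space_swap) simp
  finally show ?thesis unfolding Psi_sum_def by (simp add: nn_integral_cmult ac_simps)
qed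

lemma nested_sum_Suc:
  assumes "0 \<le> p"
  shows "nested_sum p F B A' (Suc N) v A = ennreal (p ^ N) *
     list_sum N (\<lambda>bs. ennreal p * bond_sum (\<lambda>b. nested p F B A' v A (bs @ [b])))"
  using assms by (simp add: nested_sum_eq nn_integral_bond_lists_snoc nn_integral_cmult ennreal_mult ac_simps)

lemma nested_sum_expand:
  fixes x :: "int ^ 'd::finite"
  assumes chi: "chi TYPE('d) p < \<infinity>" and p: "0 \<le> p" "p \<le> 1" and g: "good B A' v A"
  shows "nested_sum p (thr_event x) B A' N v A + nested_sum p (thr_event x) B A' (Suc N) v A =
     nested_sum p (E_event x) B A' N v A + Psi_sum p x B A' N v A"
proof -
  have "nested_sum p (thr_event x) B A' N v A + nested_sum p (thr_event x) B A' (Suc N) v A =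
    ennreal (p ^ N) * list_sum N (\<lambda>bs. nested p (thr_event x) B A' v A bs +
      ennreal p * bond_sum (\<lambda>b. nested p (thr_event x) B A' v A (bs @ [b])))"
    unfolding nested_sum_Suc[OF p(1)] unfolding nested_sum_eq by (simp add: nn_integral_add distrib_left)
  also have "\<dots> = ennreal (p ^ N) * list_sum N (\<lambda>bs. nested p (E_event x) B A' v A bs +
      ennreal p * bond_sum (\<lambda>b. t_conn p x b * nested p (Psi_event b) B A' v A bs))"
    by (intro arg_cong[where f = "(*) _"] nn_integral_cong nested_expand[OF chi p g]) (simp add: bond_lists_def)
  also have "\<dots> = nested_sum p (E_event x) B A' N v A + Psi_sum p x B A' N v A"
    unfolding Psi_sum_eq unfolding nested_sum_eq by (simp add: nn_integral_add distrib_left)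
  finally show ?thesis .
qed

lemma nested_sum_thr_le:
  assumes "0 \<le> p"
  shows "nested_sum p (thr_event x) B A' (Suc N) v A \<le> Psi_sum p x B A' N v A"
  unfolding nested_sum_Suc[OF assms] Psi_sum_eq
  by (intro mult_left_mono nn_integral_mono nested_thr_le) simp_all

subsection \<open>Bounds in terms of the susceptibility\<close>

text \<open>Product of two-point functions along the chain from \<open>v\<close> to the bottom of
  the first bond, from its top to the bottom of the next one, and so on to \<open>y\<close>. It
  dominates nested expectations because vacating bonds only hinders connections and the other
  indicators are at most 1.\<close>

fun walk_weight :: "real \<Rightarrow> int ^ 'd::finite \<Rightarrow> 'd dbond list \<Rightarrow> int ^ 'd \<Rightarrow> ennreal" where
  "walk_weight p v [] y = ennreal (tau p (y - v))"
| "walk_weight p v (b # bs) y = ennreal (tau p (fst b - v)) * walk_weight p (snd b) bs y"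

lemma expect_off_conn_le: "expect_off p B (\<lambda>C. of_bool (conn C v y)) \<le> ennreal (tau p (y - v))"
proof -
  have "expect_off p B (\<lambda>C. of_bool (conn C v y)) = ennreal (prob_off p B (\<lambda>C. conn C v y))"
    by (rule expect_off_of_bool) measurable
  also have "\<dots> \<le> ennreal (prob_off p {} (\<lambda>C. conn C v y))"
    by (intro ennreal_leI prob_off_mono) (auto intro: conn_mono)
  finally show ?thesis by (simp add: tau_translate)
qed

lemma nested_le_walk_weight:
  assumes "\<And>C A' v A. F C A' v A \<Longrightarrow> conn C v y"
  shows "nested p F B A' v A bs \<le> walk_weight p v bs y"
proof (induction bs arbitrary: B A' v A)
  case Nil
  have "nested p F B A' v A [] \<le> expect_off p B (\<lambda>C. of_bool (conn C v y))"
    unfolding nested.simps by (rule expect_off_mono) (use assms in auto)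
  then show ?case using expect_off_conn_le[of p B v y] by simp
next
  case (Cons c bs)
  let ?w = "walk_weight p (snd c) bs y"
  have "nested p F B A' v A (c # bs) \<le> expect_off p B (\<lambda>C. ?w * of_bool (conn C v (fst c)))"
    unfolding nested.simps
  proof (rule expect_off_mono)
    fix C :: "'a bond set"
    let ?D = "C - B"
    let ?S = "cluster_off ?D (ubond c) v \<union> A'"
    show "of_bool (E_prime ?D v (fst c) A) * of_bool (snd c \<notin> ?S) *
        nested p F (bonds_at {fst c}) {fst c} (snd c) ?S bs \<le> ?w * of_bool (conn ?D v (fst c))"
      using Cons.IH[of "bonds_at {fst c}" "{fst c}" "snd c" ?S] E_prime_imp_conn[of ?D v "fst c" A]
      by (cases "E_prime ?D v (fst c) A"; cases "snd c \<in> ?S") simp_all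
  qed
  also have "\<dots> = ?w * expect_off p B (\<lambda>C. of_bool (conn C v (fst c)))"
    by (rule expect_off_cmult) measurable
  also have "\<dots> \<le> ?w * ennreal (tau p (fst c - v))"
    by (intro mult_left_mono expect_off_conn_le) simp
  finally show ?case by (simp add: mult.commute)
qed

text \<open>Each of the \<open>N + 1\<close> links of the chain contributes the susceptibility, from
  the sum over its endpoint, and the number \<open>CARD('d dir)\<close> of bonds that can follow
  there. The last link is followed by a bond too, because of the sum over \<kappa>.\<close>

definition coeff_bound :: "'d::finite itself \<Rightarrow> real \<Rightarrow> nat \<Rightarrow> ennreal" where
  "coeff_bound _ p N = ennreal (p ^ N) * (of_nat CARD('d dir) * chi TYPE('d) p) ^ Suc N"

lemma coeff_bound_finite: "chi TYPE('d::finite) p < \<infinity> \<Longrightarrow> coeff_bound TYPE('d) p N < \<infinity>"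
  unfolding coeff_bound_def by (simp add: ennreal_mult_less_top power_less_top_ennreal of_nat_less_top)

lemma sum_tau_dbonds:
  fixes v :: "int ^ 'd::finite"
  shows "bond_sum (\<lambda>b. ennreal (tau p (fst b - v))) = of_nat CARD('d dir) * chi TYPE('d) p"
proof -
  have "bond_sum (\<lambda>b. ennreal (tau p (fst b - v))) =
      (\<integral>\<^sup>+z. ennreal (tau p (fst z - v)) \<partial>count_space (UNIV \<times> (UNIV :: 'd dir set)))"
    by (simp add: nn_integral_dbonds)
  also have "\<dots> = (\<integral>\<^sup>+y. of_nat CARD('d dir) * ennreal (tau p (y - v)) \<partial>count_space UNIV)"
    by (subst nn_integral_count_space_prod) (simp_all add: mult.commute emeasure_count_space)
  also have "\<dots> = of_nat CARD('d dir) * chi TYPE('d) p"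
    by (simp add: nn_integral_cmult chi_translate)
  finally show ?thesis .
qed

text \<open>By translation invariance the sum over everything after the first bond does not depend
  on the top of that bond, so the links factorize.\<close>

lemma sum_walk_weight:
  fixes v :: "int ^ 'd::finite"
  shows "list_sum N (\<lambda>bs. bond_sum (\<lambda>b. walk_weight p v bs (fst b))) =
     (of_nat CARD('d dir) * chi TYPE('d) p) ^ Suc N"
proof (induction N arbitrary: v)
  case 0
  show ?case by (simp add: nn_integral_bond_lists_0 sum_tau_dbonds)
next
  case (Suc N)
  show ?case
    by (simp add: nn_integral_bond_lists_Cons nn_integral_cmult nn_integral_multc sum_tau_dbonds Suc del: power_Suc)
      simp
qed

lemma sum_nested_Psi_le:
  fixes v :: "int ^ 'd::finite"
  shows "bond_sum (\<lambda>b. nested_sum p (Psi_event b) B A' N v A) \<le> coeff_bound TYPE('d) p N"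
proof -
  have "bond_sum (\<lambda>b. nested_sum p (Psi_event b) B A' N v A) =
      ennreal (p ^ N) * bond_sum (\<lambda>b. list_sum N (\<lambda>bs. nested p (Psi_event b) B A' v A bs))"
    unfolding nested_sum_eq by (rule nn_integral_cmult) simp
  also have "\<dots> = ennreal (p ^ N) * list_sum N (\<lambda>bs. bond_sum (\<lambda>b. nested p (Psi_event b) B A' v A bs))"
    by (subst nn_integral_count_space_swap) simp_all
  also have "\<dots> \<le> ennreal (p ^ N) * list_sum N (\<lambda>bs. bond_sum (\<lambda>b. walk_weight p v bs (fst b)))"
    by (intro mult_left_mono nn_integral_mono nested_le_walk_weight)
      (auto simp: Psi_event_def E_prime_imp_conn)
  finally show ?thesis by (simp add: sum_walk_weight coeff_bound_def)
qed

text \<open>The chain ending at \<open>y\<close> is one term of the sum over all final bonds, so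
  remainders and coefficients share one bound.\<close>

lemma nested_sum_le:
  fixes v :: "int ^ 'd::finite"
  assumes "\<And>C A' v A. F C A' v A \<Longrightarrow> conn C v y"
  shows "nested_sum p F B A' N v A \<le> coeff_bound TYPE('d) p N"
proof -
  fix \<kappa> :: "'d dir"
  have w: "walk_weight p v bs y \<le> bond_sum (\<lambda>b. walk_weight p v bs (fst b))" for bs
    using nn_integral_ge_point[OF in_dbonds[of y \<kappa>], of "\<lambda>b. walk_weight p v bs (fst b)"] by simp
  have "nested p F B A' v A bs \<le> bond_sum (\<lambda>b. walk_weight p v bs (fst b))" for bs
    by (rule order_trans[OF nested_le_walk_weight w], rule assms)
  then have "nested_sum p F B A' N v A \<le>
      ennreal (p ^ N) * list_sum N (\<lambda>bs. bond_sum (\<lambda>b. walk_weight p v bs (fst b)))"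
    unfolding nested_sum_eq by (intro mult_left_mono nn_integral_mono) simp_all
  then show ?thesis by (simp add: sum_walk_weight coeff_bound_def)
qed

lemma nested_sum_events_le:
  fixes x y :: "int ^ 'd::finite"
  shows "nested_sum p (thr_event x) B A' N v A \<le> coeff_bound TYPE('d) p N"
    "nested_sum p (E_event x) B A' N v A \<le> coeff_bound TYPE('d) p N"
    "nested_sum p (Psi_event (y, y - unit_vec \<kappa>)) B A' N v A \<le> coeff_bound TYPE('d) p N"
proof -
  show "nested_sum p (thr_event x) B A' N v A \<le> coeff_bound TYPE('d) p N"
    by (rule nested_sum_le[of _ x]) (simp add: thr_event_def conn_through_imp_conn)
  show "nested_sum p (E_event x) B A' N v A \<le> coeff_bound TYPE('d) p N"
    by (rule nested_sum_le[of _ x]) (simp add: E_event_def E_prime_imp_conn)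
  show "nested_sum p (Psi_event (y, y - unit_vec \<kappa>)) B A' N v A \<le> coeff_bound TYPE('d) p N"
    by (rule nested_sum_le[of _ y]) (auto simp: Psi_event_def intro: E_prime_imp_conn)
qed

lemma t_conn_le_1: "t_conn p x b \<le> 1"
  unfolding t_conn_def using prob_off_le_1 ennreal_le_1 by blast

lemma Psi_sum_le: "Psi_sum p x B A' N v A \<le> ennreal p * coeff_bound TYPE('d::finite) p N"
  for x :: "int ^ 'd"
proof -
  have "bond_sum (\<lambda>b. t_conn p x b * nested_sum p (Psi_event b) B A' N v A) \<le>
      bond_sum (\<lambda>b. nested_sum p (Psi_event b) B A' N v A)"
    by (intro nn_integral_mono) (use mult_right_mono[OF t_conn_le_1] in fastforce)
  also note sum_nested_Psi_le
  finally show ?thesis unfolding Psi_sum_def by (intro mult_left_mono) simp_all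
qed

subsection \<open>The general coefficients as nested sums\<close>

lemma Xi_gen_eq: "Xi_gen p B A' N v x A = nested_sum p (E_event x) B A' N v A"
proof (cases "N = 0")
  case True
  have "expect_off p B (\<lambda>C. of_bool (E_prime C v x A)) = ennreal (prob_off p B (\<lambda>C. E_prime C v x A))"
    by (rule expect_off_of_bool) measurable
  then show ?thesis using True by (simp add: Xi_gen_def nested_sum_0 E_event_def)
next
  case False
  have "E_event x = (\<lambda>C _ v A. E_prime C v x A)" by (simp add: fun_eq_iff E_event_def)
  then show ?thesis using False unfolding Xi_gen_def by simp
qed

lemma Psi_gen_eq:
  assumes g: "good B A' v A"
  shows "Psi_gen p B A' N \<kappa> v y A = nested_sum p (Psi_event (y, y - unit_vec \<kappa>)) B A' N v A"
proof -
  let ?z = "y - unit_vec \<kappa>"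
  show ?thesis
  proof (cases "N = 0")
    case True
    let ?E = "\<lambda>C. E_prime C v y A \<and> ?z \<notin> cluster_off C {y, ?z} v"
    have m: "expect_off p B (\<lambda>C. of_bool (?E C)) = ennreal (prob_off p B ?E)"
      by (rule expect_off_of_bool) measurable
    have iff: "{y, ?z} \<notin> B \<and> ?E (C - B) \<longleftrightarrow> Psi_event (y, ?z) (C - B) A' v A" if "C \<subseteq> bonds" for C
      using good_Psi_iff[OF g that in_dbonds[of y \<kappa>]] by (simp add: Psi_event_def ubond_def)
    have "of_bool ({y, ?z} \<notin> B) * expect_off p B (\<lambda>C. of_bool (?E C)) =
        expect_off p B (\<lambda>C. of_bool ({y, ?z} \<notin> B) * of_bool (?E C))"
      by (rule expect_off_cmult[symmetric]) measurable
    also have "\<dots> = expect_off p B (\<lambda>C. of_bool (Psi_event (y, ?z) C A' v A))"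
      by (rule expect_off_cong) (use iff in \<open>simp add: of_bool_conj[symmetric] del: of_bool_conj\<close>)
    finally show ?thesis using True by (simp add: Psi_gen_def m nested_sum_0)
  next
    case False
    have "Psi_event (y, ?z) = (\<lambda>C A' v A. E_prime C v y A \<and> ?z \<notin> cluster_off C {y, ?z} v \<union> A')"
      by (simp add: fun_eq_iff Psi_event_def ubond_def)
    then show ?thesis using False unfolding Psi_gen_def Let_def by simp
  qed
qed

lemma t_conn_eq: "t_conn p x (y, y - unit_vec \<kappa>) = ennreal (tau_dir p \<kappa> (x - y + unit_vec \<kappa>))"
  by (simp add: t_conn_def tau_dir_translate)

section \<open>The two expansions\<close>

lemma alternating_expansion:
  fixes r q :: "nat \<Rightarrow> real"
  assumes "\<And>N. r N + r (Suc N) = q N"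
  shows "r 0 = (\<Sum>N=0..M. (- 1) ^ N * q N) + (- 1) ^ Suc M * r (Suc M)"
proof (induction M)
  case 0
  show ?case using assms[of 0] by simp
next
  case (Suc M)
  have "(- 1) ^ Suc M * q (Suc M) + (- 1) ^ Suc (Suc M) * r (Suc (Suc M)) = (- 1) ^ Suc M * r (Suc M)"
    by (simp add: assms[of "Suc M", symmetric] algebra_simps)
  then show ?case using Suc by simp
qed

text \<open>The left-hand side telescopes to \<open>(- 1) ^ Suc M * r (Suc M)\<close>, which is at
  most \<open>r (Suc M)\<close> for either parity. Nonnegativity is asked for at
  \<open>Suc M\<close> only: in one application \<open>r 0\<close> is a difference.\<close>

lemma alternating_remainder_le:
  fixes r q \<xi> s :: "nat \<Rightarrow> real"
  assumes "\<And>N. r N + r (Suc N) = \<xi> N + s N" "0 \<le> r (Suc M)" "r (Suc M) \<le> s M"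
  shows "r 0 - (\<Sum>N=0..M. (- 1) ^ N * s N) - (\<Sum>N=0..M. (- 1) ^ N * \<xi> N) \<le> s M"
proof -
  have "r 0 = (\<Sum>N=0..M. (- 1) ^ N * (\<xi> N + s N)) + (- 1) ^ Suc M * r (Suc M)"
    by (rule alternating_expansion) (rule assms(1))
  then have "r 0 - (\<Sum>N=0..M. (- 1) ^ N * s N) - (\<Sum>N=0..M. (- 1) ^ N * \<xi> N) = (- 1) ^ Suc M * r (Suc M)"
    by (simp add: distrib_left sum.distrib)
  also have "\<dots> \<le> r (Suc M)"
    using assms(2) by (cases "even M") auto
  finally show ?thesis using assms(3) by simp
qed

lemma coeff_has_sum:
  fixes P :: "'a \<Rightarrow> ennreal" and T :: "'a \<Rightarrow> real"
  assumes P: "\<And>z. P z < \<infinity>" and T: "\<And>z. 0 \<le> T z"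
    and sum: "(\<integral>\<^sup>+z. P z * ennreal (T z) \<partial>count_space UNIV) = s" and fin: "s < \<infinity>"
  shows "((\<lambda>z. enn2real (P z) * T z) has_sum enn2real s) UNIV"
proof -
  let ?f = "\<lambda>z. enn2real (P z) * T z"
  have eq: "ennreal (?f z) = P z * ennreal (T z)" for z
    using P[of z] T[of z] by (simp add: ennreal_mult)
  have f: "?f summable_on UNIV"
    by (subst summable_iff_nn_integral_finite) (use T sum fin in \<open>simp_all add: eq\<close>)
  have "ennreal (infsum ?f UNIV) = s"
    by (subst ennreal_infsum[OF _ f]) (use T sum in \<open>simp_all add: eq\<close>)
  moreover have "0 \<le> infsum ?f UNIV"
    by (rule infsum_nonneg) (use T in simp)
  ultimately have "infsum ?f UNIV = enn2real s" by (metis enn2real_ennreal)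
  then show ?thesis using f has_sum_infsum by metis
qed

lemma alternating_has_sum:
  fixes q :: "nat \<Rightarrow> 'a \<Rightarrow> real"
  assumes "\<And>N. (q N has_sum s N) A"
  shows "((\<lambda>z. \<Sum>N=0..M. (- 1) ^ N * q N z) has_sum (\<Sum>N=0..M. (- 1) ^ N * s N)) A"
proof (induction M)
  case 0
  show ?case using assms[of 0] by simp
next
  case (Suc M)
  show ?case
    unfolding sum.atLeast0_atMost_Suc by (intro has_sum_add Suc has_sum_cmult_right assms)
qed

lemma of_bool_exclusive_or:
  assumes "R \<Longrightarrow> P \<and> \<not> Q" "P \<Longrightarrow> \<not> Q \<Longrightarrow> R" "Q \<Longrightarrow> P"
  shows "(of_bool P :: ennreal) = of_bool Q + of_bool R"
  using assms by (cases P; cases Q; cases R) simp_all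

lemma tau_dir_nonneg: "0 \<le> tau_dir p \<kappa> x"
  by (simp add: tau_dir_def prob_off_nonneg)

text \<open>Every connection from \<open>v\<close> to another vertex uses a bond at
  \<open>v\<close>, so passing through \<open>{v}\<close> is automatic. What remains of
  \<open>E_prime\<close> is the absence of occupied pivotal bonds, which is double connection by
  Menger's theorem.\<close>

lemma E_prime_iff_doubly_conn:
  assumes C: "C \<subseteq> bonds"
  shows "E_prime C v x {v} \<longleftrightarrow> doubly_conn C v x"
proof -
  have t: "conn_through C {v} v z \<longleftrightarrow> conn C v z" for z
    using conn_isolated[of C "{v}" v z] C by (auto simp: conn_through_iff)
  show ?thesis
  proof
    assume E: "E_prime C v x {v}"
    then have c: "conn C v x" by (rule E_prime_imp_conn)
    show "doubly_conn C v x"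
      unfolding doubly_conn_iff
    proof (intro allI, rule ccontr)
      fix \<beta> assume n: "\<not> conn (C - {\<beta>}) v x"
      obtain u w where *: "\<beta> = {u, w}" "\<beta> \<in> C" "conn (C - {\<beta>}) v u" "\<not> conn (C - {\<beta>}) v w"
        using conn_leaves_cluster[OF c n] by metis
      have u: "ubond (u, w) = \<beta>" using *(1) by (simp add: ubond_def)
      have "pivotal C (u, w) v x" using pivotal_orient[OF c, of "(u, w)"] * n u by simp
      moreover have "(u, w) \<in> dbonds" using * C by (auto simp: dbonds_def)
      moreover have "conn C v u" using *(3) by (rule conn_mono) auto
      ultimately show False using E *(2) u t unfolding E_prime_def by force
    qed
  next
    assume d: "doubly_conn C v x"
    then have "conn C v x" unfolding doubly_conn_iff by (metis Diff_subset conn_mono)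
    then show "E_prime C v x {v}"
      using d unfolding E_prime_def t doubly_conn_iff pivotal_iff by blast
  qed
qed

lemma good_origin: "good {} {} v A"
  by (simp add: good_def bonds_at_def)

section \<open>The expansion without a fixed first bond\<close>

context
  fixes p :: real
  assumes p: "0 < p" "p < p_crit TYPE('d::{finite,linorder})"
begin

lemma p_le_1: "0 \<le> p" "p \<le> 1" "p < 1"
  using subcritical[OF p] p by auto

lemma chi_finite: "chi TYPE('d) p < \<infinity>"
  using subcritical[OF p] by simp

lemma mu_ne_0: "mu TYPE('d) p \<noteq> 0"
  using mu_pos[of p, where 'd = 'd] p p_le_1 by simp

lemma nested_sum_finite:
  fixes x y :: "(int, 'd) vec"
  shows "nested_sum p (thr_event x) B A' N v A < \<infinity>" "nested_sum p (E_event x) B A' N v A < \<infinity>"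
    "nested_sum p (Psi_event (y, y - unit_vec \<kappa>)) B A' N v A < \<infinity>"
  by (rule le_less_trans[OF nested_sum_events_le(1) coeff_bound_finite[OF chi_finite]]
      le_less_trans[OF nested_sum_events_le(2) coeff_bound_finite[OF chi_finite]]
      le_less_trans[OF nested_sum_events_le(3) coeff_bound_finite[OF chi_finite]])+

lemma Psi_sum_finite: "Psi_sum p x B A' N v A < \<infinity>"
  for x :: "(int, 'd) vec"
  using Psi_sum_le by (rule le_less_trans) (simp add: ennreal_mult_less_top coeff_bound_finite[OF chi_finite, simplified])

definition Psi_coeff :: "nat \<Rightarrow> (int, 'd) vec \<times> 'd dir \<Rightarrow> ennreal" where
  "Psi_coeff N z = ennreal p * nested_sum p (Psi_event (fst z, fst z - unit_vec (snd z))) {} {} N 0 {0}"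

text \<open>\<open>Psi\<close> excludes \<open>y = 0\<close> at order 0, but
  \<open>Psi_coeff\<close> does not. At that point double connection is trivial and the probability
  left is the one in \<open>mu_eq\<close>, which gives the additional term \<mu>.\<close>

lemma Psi_coeff_eq:
  fixes y :: "(int, 'd) vec"
  shows "enn2real (Psi_coeff N (y, \<kappa>)) =
     mu TYPE('d) p * ((if N = 0 then of_bool (y = 0) else 0) + Psi p N \<kappa> y)"
proof -
  let ?z = "y - unit_vec \<kappa>"
  have c: "enn2real (Psi_coeff N (y, \<kappa>)) = p * enn2real (Psi_gen p {} {} N \<kappa> 0 y {0})"
    using p by (simp add: Psi_coeff_def Psi_gen_eq[OF good_origin] enn2real_mult)
  show ?thesis
  proof (cases "N = 0")
    case False
    then show ?thesis using c mu_ne_0 by (simp add: Psi_def)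
  next
    case True
    have "enn2real (Psi_gen p {} {} N \<kappa> 0 y {0}) =
        prob_off p {} (\<lambda>C. E_prime C 0 y {0} \<and> ?z \<notin> cluster_off C {y, ?z} 0)"
      using True by (simp add: Psi_gen_def Let_def prob_off_nonneg)
    also have "\<dots> = prob_off p {} (\<lambda>C. doubly_conn C 0 y \<and> ?z \<notin> cluster_off C {y, ?z} y)"
    proof (rule prob_off_cong)
      fix C :: "'d bond set" assume "C \<subseteq> bonds"
      then have "E_prime C 0 y {0} \<longleftrightarrow> doubly_conn C 0 y" by (rule E_prime_iff_doubly_conn)
      \<comment> \<open>Double connection keeps \<open>0\<close> and \<open>y\<close> connected when
        one bond is removed, so their clusters off that bond agree.\<close>
      moreover have "conn (C - {{y, ?z}}) 0 w \<longleftrightarrow> conn (C - {{y, ?z}}) y w" if "doubly_conn C 0 y" for w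
      proof -
        have "conn (C - {{y, ?z}}) 0 y" using that unfolding doubly_conn_iff by blast
        then show ?thesis using conn_trans conn_sym by meson
      qed
      ultimately show "(E_prime (C - {}) 0 y {0} \<and> ?z \<notin> cluster_off (C - {}) {y, ?z} 0) \<longleftrightarrow>
          (doubly_conn (C - {}) 0 y \<and> ?z \<notin> cluster_off (C - {}) {y, ?z} y)"
        unfolding Diff_empty in_cluster_off by blast
    qed
    finally have *: "enn2real (Psi_gen p {} {} N \<kappa> 0 y {0}) =
        prob_off p {} (\<lambda>C. doubly_conn C 0 y \<and> ?z \<notin> cluster_off C {y, ?z} y)" .
    show ?thesis
    proof (cases "y = 0")
      case False
      then show ?thesis using c * True mu_ne_0 by (simp add: Psi_def)
    next
      case y: True
      have "doubly_conn C 0 (0 :: (int, 'd) vec)" for C by (simp add: doubly_conn_iff)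
      then have "mu TYPE('d) p = p * prob_off p {} (\<lambda>C. doubly_conn C 0 y \<and> ?z \<notin> cluster_off C {y, ?z} y)"
        using mu_eq[OF p_le_1(1,3), of "opp \<kappa>"] y by (simp add: unit_vec_opp)
      then show ?thesis using c * True y by (simp add: Psi_def)
    qed
  qed
qed

lemma Psi_coeff_sum:
  fixes x :: "(int, 'd) vec"
  shows "(\<integral>\<^sup>+z. Psi_coeff N z * ennreal (tau_dir p (snd z) (x - fst z + unit_vec (snd z))) \<partial>count_space UNIV) =
     Psi_sum p x {} {} N 0 {0}"
  unfolding Psi_sum_def Psi_coeff_def nn_integral_dbonds t_conn_eq
  by (subst nn_integral_cmult[symmetric]) (auto intro!: nn_integral_cong simp: ac_simps)

lemma tau_eq_nested_sum: "ennreal (tau p x) = nested_sum p (thr_event x) {} {} 0 0 {0}"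
  for x :: "(int, 'd) vec"
proof -
  have "ennreal (tau p x) = expect_off p {} (\<lambda>C. of_bool (conn C 0 x))"
    unfolding tau_def by (rule expect_off_of_bool[symmetric]) measurable
  also have "\<dots> = expect_off p {} (\<lambda>C. of_bool (thr_event x C {} 0 {0}))"
  proof (rule expect_off_cong)
    fix C :: "'d bond set" assume "C \<subseteq> bonds"
    then have "conn_through C {0} 0 x \<longleftrightarrow> conn C 0 x"
      using conn_isolated[of C "{0}" 0 x] by (auto simp: conn_through_iff)
    then show "(of_bool (conn (C - {}) 0 x) :: ennreal) = of_bool (thr_event x (C - {}) {} 0 {0})"
      by (simp add: thr_event_def)
  qed
  finally show ?thesis by (simp add: nested_sum_0)
qed

lemma Xi_eq: "enn2real (nested_sum p (E_event x) {} {} N 0 {0}) = of_bool (N = 0 \<and> x = 0) + Xi p N x"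
  for x :: "(int, 'd) vec"
proof (cases "N = 0")
  case False
  then show ?thesis by (simp add: Xi_def Xi_gen_eq)
next
  case True
  have "nested_sum p (E_event x) {} {} N 0 {0} = ennreal (prob_off p {} (\<lambda>C. E_prime C 0 x {0}))"
    using True Xi_gen_eq[of p "{}" "{}" 0 0 x "{0}"] by (simp add: Xi_gen_def)
  also have "prob_off p {} (\<lambda>C. E_prime C 0 x {0}) = prob_off p {} (\<lambda>C. doubly_conn C 0 x)"
    by (rule prob_off_cong) (simp add: E_prime_iff_doubly_conn)
  finally have *: "enn2real (nested_sum p (E_event x) {} {} N 0 {0}) = prob_off p {} (\<lambda>C. doubly_conn C 0 x)"
    by (simp add: prob_off_nonneg)
  show ?thesis
  proof (cases "x = 0")
    case x: True
    have "prob_off p {} (\<lambda>C. doubly_conn C 0 x) = 1"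
      using x prob_space.prob_space[OF prob_space_perc[of p]] by (simp add: prob_off_def doubly_conn_iff)
    then show ?thesis using * True x by (simp add: Xi_def)
  qed (use * True in \<open>simp add: Xi_def\<close>)
qed

lemma enn2real_sum_eq:
  assumes "a + b = c + d" "a < \<infinity>" "b < \<infinity>" "c < \<infinity>" "d < \<infinity>"
  shows "enn2real a + enn2real b = enn2real c + enn2real d"
  using assms by (metis enn2real_plus infinity_ennreal_def)

lemma first_expansion:
  fixes x :: "(int, 'd) vec"
  assumes M: "M \<ge> 1"
  defines "T \<equiv> \<lambda>\<kappa> y. tau_dir p \<kappa> (x - y + unit_vec \<kappa>)"
  defines "f \<equiv> \<lambda>(y, \<kappa>). (of_bool (y = 0) + (\<Sum>N=0..M. (- 1) ^ N * Psi p N \<kappa> y)) * T \<kappa> y"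
  defines "r \<equiv> \<lambda>(y, \<kappa>). Psi p M \<kappa> y * T \<kappa> y"
  shows "f summable_on UNIV" "r summable_on UNIV"
    "tau p x - of_bool (x = 0) - mu TYPE('d) p * (\<Sum>\<^sub>\<infinity>z\<in>UNIV. f z) - (\<Sum>N=0..M. (- 1) ^ N * Xi p N x) \<le>
       mu TYPE('d) p * (\<Sum>\<^sub>\<infinity>z\<in>UNIV. r z)"
proof -
  let ?\<mu> = "mu TYPE('d) p"
  let ?T = "\<lambda>z :: (int, 'd) vec \<times> 'd dir. tau_dir p (snd z) (x - fst z + unit_vec (snd z))"
  define q where "q N z = enn2real (Psi_coeff N z) * ?T z" for N z
  define s where "s N = enn2real (Psi_sum p x {} {} N 0 {0})" for N
  have fin: "Psi_coeff N z < \<infinity>" for N and z :: "(int, 'd) vec \<times> 'd dir"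
    unfolding Psi_coeff_def using nested_sum_finite(3) by (simp add: ennreal_mult_less_top)
  have q: "(q N has_sum s N) UNIV" for N
    unfolding q_def[abs_def] s_def by (intro coeff_has_sum fin tau_dir_nonneg Psi_coeff_sum Psi_sum_finite)
  have f: "f z = inverse ?\<mu> * (\<Sum>N=0..M. (- 1) ^ N * q N z)" for z
  proof -
    obtain y \<kappa> where z: "z = (y, \<kappa>)" by (cases z)
    have "(\<Sum>N=0..M. (- 1) ^ N * q N z) =
        ?\<mu> * ((\<Sum>N=0..M. (- 1) ^ N * (if N = 0 then of_bool (y = 0) else 0)) + (\<Sum>N=0..M. (- 1) ^ N * Psi p N \<kappa> y)) * T \<kappa> y"
      unfolding q_def z Psi_coeff_eq T_def fst_conv snd_conv
      by (simp only: sum_distrib_left sum_distrib_right sum.distrib[symmetric] distrib_left distrib_right mult.assoc mult.left_commute)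
    also have "(\<Sum>N=0..M. (- 1) ^ N * (if N = 0 then of_bool (y = 0) else 0)) = (of_bool (y = 0) :: real)"
      by (subst sum.remove[of _ 0]) auto
    finally show ?thesis using mu_ne_0 by (simp add: f_def z)
  qed
  from has_sum_cmult_right[OF alternating_has_sum[where q = q and s = s and M = M, OF q], of "inverse ?\<mu>"]
  have hf: "(f has_sum (inverse ?\<mu> * (\<Sum>N=0..M. (- 1) ^ N * s N))) UNIV" by (simp only: ext[of f, OF f])
  then show "f summable_on UNIV" by (rule has_sum_imp_summable)
  from hf have F: "?\<mu> * infsum f UNIV = (\<Sum>N=0..M. (- 1) ^ N * s N)"
    using mu_ne_0 by (simp add: infsumI)
  \<comment> \<open>Here \<open>M \<ge> 1\<close> enters: at order 0, \<open>Psi_coeff\<close>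
    contains the term of the Kronecker delta, which is not part of \<open>Psi\<close>.\<close>
  have r: "r z = inverse ?\<mu> * q M z" for z
    using M mu_ne_0 by (cases z) (simp add: r_def q_def Psi_coeff_eq T_def)
  then have r: "r = (\<lambda>z. inverse ?\<mu> * q M z)" by (rule ext)
  then have hr: "(r has_sum (inverse ?\<mu> * s M)) UNIV" using has_sum_cmult_right[OF q] by simp
  then show "r summable_on UNIV" by (rule has_sum_imp_summable)
  from hr have R: "?\<mu> * infsum r UNIV = s M" using mu_ne_0 by (simp add: infsumI)
  let ?\<rho> = "\<lambda>N. enn2real (nested_sum p (thr_event x) {} {} N 0 {0})"
  let ?\<xi> = "\<lambda>N. enn2real (nested_sum p (E_event x) {} {} N 0 {0})"
  have "?\<rho> 0 - (\<Sum>N=0..M. (- 1) ^ N * s N) - (\<Sum>N=0..M. (- 1) ^ N * ?\<xi> N) \<le> s M"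
  proof (rule alternating_remainder_le)
    show "?\<rho> N + ?\<rho> (Suc N) = ?\<xi> N + s N" for N
      unfolding s_def
      by (intro enn2real_sum_eq nested_sum_expand[OF chi_finite p_le_1(1,2) good_origin]
          nested_sum_finite(1) nested_sum_finite(2) Psi_sum_finite)
    show "?\<rho> (Suc M) \<le> s M"
      unfolding s_def using nested_sum_thr_le[OF p_le_1(1)] Psi_sum_finite by (intro enn2real_mono) auto
  qed simp
  moreover have "?\<rho> 0 = tau p x"
    by (simp flip: tau_eq_nested_sum add: tau_def prob_off_nonneg)
  moreover have "(\<Sum>N=0..M. (- 1) ^ N * ?\<xi> N) = of_bool (x = 0) + (\<Sum>N=0..M. (- 1) ^ N * Xi p N x)"
  proof -
    have "(\<Sum>N=0..M. (- 1) ^ N * ?\<xi> N) =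
       (\<Sum>N=0..M. (- 1) ^ N * of_bool (N = 0 \<and> x = 0)) + (\<Sum>N=0..M. (- 1) ^ N * Xi p N x)"
      by (simp only: Xi_eq distrib_left sum.distrib)
    also have "(\<Sum>N=0..M. (- 1) ^ N * of_bool (N = 0 \<and> x = 0)) = (of_bool (x = 0) :: real)"
      by (subst sum.remove[of _ 0]) auto
    finally show ?thesis .
  qed
  ultimately show "tau p x - of_bool (x = 0) - ?\<mu> * (\<Sum>\<^sub>\<infinity>z\<in>UNIV. f z) - (\<Sum>N=0..M. (- 1) ^ N * Xi p N x) \<le>
       ?\<mu> * (\<Sum>\<^sub>\<infinity>z\<in>UNIV. r z)"
    unfolding F R by linarith
qed

section \<open>The expansion with the bond from the origin in direction \<iota> treated
  separately\<close>

lemma expect_off_le_const: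
  assumes "\<And>C. F C \<le> c"
  shows "expect_off p B F \<le> c"
proof -
  interpret prob_space "perc p :: ('a bond \<Rightarrow> bool) measure" by (rule prob_space_perc)
  have "expect_off p B F \<le> (\<integral>\<^sup>+\<omega>. c \<partial>(perc p :: ('a bond \<Rightarrow> bool) measure))"
    unfolding expect_off_def by (intro nn_integral_mono assms)
  then show ?thesis by (simp add: emeasure_space_1)
qed

text \<open>
  The two terms in the definitions of \<open>\<Xi>\<^sup>\<iota>\<close> and \<open>\<Pi>\<^sup>\<iota>\<close>: \<open>dir_tail\<close> is the one that starts with an
  occupied pivotal bond \<open>(0, e\<^sub>\<iota>)\<close>, without its factor \<open>p\<close>.
\<close>

definition dir_tail where
  "dir_tail F \<iota> N = expect_off p {{0, unit_vec \<iota>}} (\<lambda>C.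
     of_bool (unit_vec \<iota> \<notin> cluster_off C {0, unit_vec \<iota>} 0) *
     nested_sum p F (bonds_at {0}) {0} N (unit_vec \<iota>) (cluster_off C {0, unit_vec \<iota>} 0))"

text \<open>The tail is shifted by one because its pivotal bond at the origin counts as a level;
  hence order 0 has no tail.\<close>

definition dir_sum where
  "dir_sum F \<iota> N = nested_sum p F {{0, unit_vec \<iota>}} {} N 0 {unit_vec \<iota>} +
     (if N = 0 then 0 else ennreal p * dir_tail F \<iota> (N - 1))"

lemma good_dir: "good {{0, unit_vec \<iota>}} {} 0 {unit_vec \<iota>}"
  using unit_vec_ne_0[of \<iota>] by (auto simp: good_def)

lemma good_tail: "good (bonds_at {0}) {0} (unit_vec \<iota>) S"
  using unit_vec_ne_0[of \<iota>] by (auto simp: good_def)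

lemma dir_tail_le:
  assumes "\<And>A. nested_sum p F (bonds_at {0}) {0} N (unit_vec \<iota>) A \<le> c"
  shows "dir_tail F \<iota> N \<le> c"
  unfolding dir_tail_def by (rule expect_off_le_const) (use assms in \<open>auto simp: of_bool_def\<close>)

lemma dir_tail_finite:
  fixes x y :: "(int, 'd) vec"
  shows "dir_tail (thr_event x) \<iota> N < \<infinity>" "dir_tail (E_event x) \<iota> N < \<infinity>"
    "dir_tail (Psi_event (y, y - unit_vec \<kappa>)) \<iota> N < \<infinity>"
  by (rule le_less_trans[OF dir_tail_le[OF nested_sum_events_le(1)] coeff_bound_finite[OF chi_finite]]
      le_less_trans[OF dir_tail_le[OF nested_sum_events_le(2)] coeff_bound_finite[OF chi_finite]]
      le_less_trans[OF dir_tail_le[OF nested_sum_events_le(3)] coeff_bound_finite[OF chi_finite]])+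

definition dir_tail_Psi_sum where
  "dir_tail_Psi_sum x \<iota> N = ennreal p * bond_sum (\<lambda>b. t_conn p x b * dir_tail (Psi_event b) \<iota> N)"

lemma measurable_dir_tail:
  fixes f :: "(int ^ 'e::finite) set \<Rightarrow> ennreal"
  assumes "f \<in> borel_measurable set_space"
  shows "(\<lambda>C. of_bool (unit_vec \<iota> \<notin> cluster_off C {0, unit_vec \<iota>} 0) * f (cluster_off C {0, unit_vec \<iota>} 0))
     \<in> borel_measurable set_space"
proof -
  have [measurable]: "(\<lambda>C. f (cluster_off C {0, unit_vec \<iota>} 0)) \<in> borel_measurable set_space"
    by (rule measurable_compose[OF _ assms]) measurable
  show ?thesis by measurable
qed

lemma measurable_nested_sum_events:
  "(\<lambda>A. nested_sum p (thr_event x) B A' N v A) \<in> borel_measurable set_space"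
  "(\<lambda>A. nested_sum p (E_event x) B A' N v A) \<in> borel_measurable set_space"
  "(\<lambda>A. nested_sum p (Psi_event b) B A' N v A) \<in> borel_measurable set_space"
  by (rule measurable_nested_sum, rule measurable_events)+

lemma measurable_Psi_sum: "(\<lambda>A. Psi_sum p x B A' N v A) \<in> borel_measurable set_space"
proof -
  have [measurable]: "(\<lambda>A. bond_sum (\<lambda>b. t_conn p x b * nested_sum p (Psi_event b) B A' N v A)) \<in> borel_measurable set_space"
    by (intro measurable_nn_integral_count_space countableI_type borel_measurable_times_ennreal
        measurable_nested_sum_events borel_measurable_const)
  show ?thesis unfolding Psi_sum_def by measurable
qed

lemma dir_tail_Psi_sum_eq:
  "dir_tail_Psi_sum x \<iota> N = expect_off p {{0, unit_vec \<iota>}} (\<lambda>C.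
     of_bool (unit_vec \<iota> \<notin> cluster_off C {0, unit_vec \<iota>} 0) *
     Psi_sum p x (bonds_at {0}) {0} N (unit_vec \<iota>) (cluster_off C {0, unit_vec \<iota>} 0))"
proof -
  let ?B = "{{0, unit_vec \<iota>}}"
  let ?S = "\<lambda>C. cluster_off C {0, unit_vec \<iota>} 0"
  let ?W = "\<lambda>C. of_bool (unit_vec \<iota> \<notin> ?S C) :: ennreal"
  let ?n = "\<lambda>b C. nested_sum p (Psi_event b) (bonds_at {0}) {0} N (unit_vec \<iota>) (?S C)"
  note m = measurable_dir_tail[OF measurable_nested_sum_events(3)]
  have m': "(\<lambda>C. bond_sum (\<lambda>b. t_conn p x b * (?W C * ?n b C))) \<in> borel_measurable set_space"
    by (intro measurable_nn_integral_count_space countableI_type borel_measurable_times_ennreal[OF _ m] borel_measurable_const)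
  have "dir_tail_Psi_sum x \<iota> N = ennreal p * bond_sum (\<lambda>b. expect_off p ?B (\<lambda>C. t_conn p x b * (?W C * ?n b C)))"
    unfolding dir_tail_Psi_sum_def dir_tail_def by (simp only: expect_off_cmult[OF m])
  also have "\<dots> = ennreal p * expect_off p ?B (\<lambda>C. bond_sum (\<lambda>b. t_conn p x b * (?W C * ?n b C)))"
    by (subst expect_off_sum[OF countableI_type]) (intro borel_measurable_times_ennreal[OF _ m] borel_measurable_const, rule refl)
  also have "\<dots> = expect_off p ?B (\<lambda>C. ennreal p * bond_sum (\<lambda>b. t_conn p x b * (?W C * ?n b C)))"
    by (rule expect_off_cmult[OF m', symmetric])
  also have "\<dots> = expect_off p ?B (\<lambda>C. ?W C * Psi_sum p x (bonds_at {0}) {0} N (unit_vec \<iota>) (?S C))"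
  proof -
    have "bond_sum (\<lambda>b. t_conn p x b * (?W C * ?n b C)) = ?W C * bond_sum (\<lambda>b. t_conn p x b * ?n b C)" for C
      by (subst nn_integral_cmult[symmetric]) (auto intro!: nn_integral_cong simp: ac_simps)
    then show ?thesis by (simp add: Psi_sum_def ac_simps)
  qed
  finally show ?thesis .
qed

lemma dir_tail_Psi_sum_finite: "dir_tail_Psi_sum x \<iota> N < \<infinity>" for x :: "(int, 'd) vec"
proof -
  have "dir_tail_Psi_sum x \<iota> N \<le> ennreal p * coeff_bound TYPE('d) p N"
    unfolding dir_tail_Psi_sum_eq by (rule expect_off_le_const) (use Psi_sum_le in \<open>auto simp: of_bool_def\<close>)
  also have "\<dots> < \<infinity>" using coeff_bound_finite[OF chi_finite] by (simp add: ennreal_mult_less_top)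
  finally show ?thesis .
qed

text \<open>\<open>nested_sum_expand\<close> holds for every fixed value of the cluster of the
  origin and is integrated over that cluster.\<close>

lemma dir_tail_expand:
  fixes x :: "(int, 'd) vec"
  shows "dir_tail (thr_event x) \<iota> N + dir_tail (thr_event x) \<iota> (Suc N) =
     dir_tail (E_event x) \<iota> N + dir_tail_Psi_sum x \<iota> N"
  unfolding dir_tail_Psi_sum_eq unfolding dir_tail_def
  by (subst (1 2) expect_off_add[symmetric])
    (simp_all only: measurable_dir_tail measurable_nested_sum_events measurable_Psi_sum distrib_left[symmetric]
      nested_sum_expand[OF chi_finite p_le_1(1,2) good_tail])

lemma dir_tail_thr_le: "dir_tail (thr_event x) \<iota> (Suc N) \<le> dir_tail_Psi_sum x \<iota> N"
  for x :: "(int, 'd) vec"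
  unfolding dir_tail_Psi_sum_eq unfolding dir_tail_def
  by (intro expect_off_mono mult_left_mono nested_sum_thr_le[OF p_le_1(1)]) simp

lemma dir_sum_finite:
  fixes x y :: "(int, 'd) vec"
  shows "dir_sum (thr_event x) \<iota> N < \<infinity>" "dir_sum (E_event x) \<iota> N < \<infinity>"
    "dir_sum (Psi_event (y, y - unit_vec \<kappa>)) \<iota> N < \<infinity>"
  using nested_sum_finite dir_tail_finite by (auto simp: dir_sum_def ennreal_mult_less_top)

definition Pi_coeff where
  "Pi_coeff \<iota> N z = ennreal p * dir_sum (Psi_event (fst z, fst z - unit_vec (snd z))) \<iota> N"

definition dir_Psi_sum where
  "dir_Psi_sum x \<iota> N = ennreal p * bond_sum (\<lambda>b. t_conn p x b * dir_sum (Psi_event b) \<iota> N)"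

lemma dir_Psi_sum_eq:
  "dir_Psi_sum x \<iota> N = Psi_sum p x {{0, unit_vec \<iota>}} {} N 0 {unit_vec \<iota>} +
     (if N = 0 then 0 else ennreal p * dir_tail_Psi_sum x \<iota> (N - 1))"
proof (cases "N = 0")
  case True
  then show ?thesis by (simp add: dir_Psi_sum_def dir_sum_def Psi_sum_def)
next
  case False
  let ?n = "\<lambda>b. nested_sum p (Psi_event b) {{0, unit_vec \<iota>}} {} N 0 {unit_vec \<iota>}"
  let ?t = "\<lambda>b. dir_tail (Psi_event b) \<iota> (N - 1)"
  have "t_conn p x b * dir_sum (Psi_event b) \<iota> N = t_conn p x b * ?n b + ennreal p * (t_conn p x b * ?t b)" for b
    using False by (simp add: dir_sum_def distrib_left ac_simps)
  then have "dir_Psi_sum x \<iota> N = ennreal p * (bond_sum (\<lambda>b. t_conn p x b * ?n b) +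
      ennreal p * bond_sum (\<lambda>b. t_conn p x b * ?t b))"
    by (simp add: dir_Psi_sum_def nn_integral_add nn_integral_cmult)
  then show ?thesis
    using False by (simp add: Psi_sum_def dir_tail_Psi_sum_def distrib_left)
qed

lemma dir_Psi_sum_finite: "dir_Psi_sum x \<iota> N < \<infinity>" for x :: "(int, 'd) vec"
  using Psi_sum_finite dir_tail_Psi_sum_finite by (auto simp: dir_Psi_sum_eq ennreal_mult_less_top)

lemma Pi_coeff_sum:
  fixes x :: "(int, 'd) vec"
  shows "(\<integral>\<^sup>+z. Pi_coeff \<iota> N z * ennreal (tau_dir p (snd z) (x - fst z + unit_vec (snd z))) \<partial>count_space UNIV) =
     dir_Psi_sum x \<iota> N"
  unfolding dir_Psi_sum_def Pi_coeff_def nn_integral_dbonds t_conn_eq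
  by (subst nn_integral_cmult[symmetric]) (auto intro!: nn_integral_cong simp: ac_simps)

lemma Xi_dir_eq: "Xi_dir p N \<iota> x = enn2real (dir_sum (E_event x) \<iota> N)"
  by (simp add: Xi_dir_def Let_def Xi_gen_eq dir_sum_def dir_tail_def)

lemma Pi_dir_eq:
  fixes y :: "(int, 'd) vec"
  shows "Pi_dir p N \<iota> \<kappa> y = enn2real (Pi_coeff \<iota> N (y, \<kappa>))"
proof (cases "N = 0")
  case True
  then show ?thesis
    using p_le_1 by (simp add: Pi_dir_def Let_def Pi_coeff_def dir_sum_def Psi_gen_eq[OF good_dir] enn2real_mult)
next
  case False
  have "ennreal (p\<^sup>2) = ennreal p * ennreal p" using p_le_1 by (simp add: power2_eq_square ennreal_mult)
  then show ?thesis
    using False by (simp add: Pi_dir_def Let_def Pi_coeff_def dir_sum_def dir_tail_def Psi_gen_eq[OF good_dir]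
        Psi_gen_eq[OF good_tail] distrib_left mult.assoc)
qed

lemma dir_sum_expand:
  fixes x :: "(int, 'd) vec"
  shows "nested_sum p (thr_event x) {{0, unit_vec \<iota>}} {} N 0 {unit_vec \<iota>} +
       nested_sum p (thr_event x) {{0, unit_vec \<iota>}} {} (Suc N) 0 {unit_vec \<iota>} =
     nested_sum p (E_event x) {{0, unit_vec \<iota>}} {} N 0 {unit_vec \<iota>} +
       Psi_sum p x {{0, unit_vec \<iota>}} {} N 0 {unit_vec \<iota>}"
  by (rule nested_sum_expand[OF chi_finite p_le_1(1,2) good_dir])

text \<open>From order 1 on, the shift in \<open>dir_sum\<close> lines up the expansions of both
  terms. At order 0 the tail of the following order has no partner; it is supplied by
  \<open>tau_dir_decomp\<close>.\<close>

lemma dir_sum_Suc_expand: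
  fixes x :: "(int, 'd) vec"
  shows "dir_sum (thr_event x) \<iota> (Suc N) + dir_sum (thr_event x) \<iota> (Suc (Suc N)) =
     dir_sum (E_event x) \<iota> (Suc N) + dir_Psi_sum x \<iota> (Suc N)"
proof -
  have "dir_sum (thr_event x) \<iota> (Suc N) + dir_sum (thr_event x) \<iota> (Suc (Suc N)) =
      (nested_sum p (thr_event x) {{0, unit_vec \<iota>}} {} (Suc N) 0 {unit_vec \<iota>} +
       nested_sum p (thr_event x) {{0, unit_vec \<iota>}} {} (Suc (Suc N)) 0 {unit_vec \<iota>}) +
      ennreal p * (dir_tail (thr_event x) \<iota> N + dir_tail (thr_event x) \<iota> (Suc N))"
    by (simp add: dir_sum_def distrib_left ac_simps)
  also have "\<dots> = dir_sum (E_event x) \<iota> (Suc N) + dir_Psi_sum x \<iota> (Suc N)"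
    unfolding dir_sum_expand dir_tail_expand
    by (simp add: dir_sum_def dir_Psi_sum_eq distrib_left ac_simps)
  finally show ?thesis .
qed

lemma dir_sum_thr_le:
  fixes x :: "(int, 'd) vec"
  assumes "M \<ge> 1"
  shows "dir_sum (thr_event x) \<iota> (Suc M) \<le> dir_Psi_sum x \<iota> M"
proof -
  \<comment> \<open>With \<open>M = 0\<close> the tail of order 1 would have no counterpart on the
    right; from \<open>M = 1\<close> on both terms are bounded separately.\<close>
  obtain K where "M = Suc K" using assms by (cases M) auto
  then show ?thesis
    unfolding dir_Psi_sum_eq dir_sum_def
    using nested_sum_thr_le[OF p_le_1(1)] dir_tail_thr_le[of x \<iota> K] by (auto intro!: add_mono mult_left_mono)
qed

text \<open>
  The bond \<open>(0, e\<^sub>\<iota>)\<close> is either not needed for \<open>0 \<leftrightarrow> x\<close> or occupied and pivotal, in which case the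
  cutting-bond lemma applies.
\<close>

lemma tau_dir_decomp:
  fixes x :: "(int, 'd) vec"
  shows "tau p x + p * enn2real (dir_tail (thr_event x) \<iota> 0) =
     tau_dir p \<iota> x + mu TYPE('d) p * tau_dir p (opp \<iota>) (x - unit_vec \<iota>) +
     enn2real (dir_sum (thr_event x) \<iota> 0)"
proof -
  let ?e = "unit_vec \<iota> :: (int, 'd) vec"
  let ?b = "{0, ?e}"
  let ?S = "\<lambda>C. cluster_off C ?b 0"
  let ?W = "\<lambda>C. of_bool (?e \<notin> ?S C) :: ennreal"
  have ub: "ubond (0, ?e) = ?b" by (simp add: ubond_def)
  have db: "(0, ?e) \<in> dbonds" unfolding dbonds_def using bonds_iff[of 0 ?e] by (simp del: split_paired_Ex) blast
  have b: "?b \<in> bonds" using db by (simp add: dbonds_def)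
  \<comment> \<open>No bond is pivotal between a vertex and itself, so for the bond starting at the
    origin the factor \<open>E_prime\<close> in the cutting-bond lemma equals 1.\<close>
  have E0: "E_prime C 0 0 {0}" for C :: "'d bond set"
    by (auto simp: E_prime_def conn_through_iff pivotal_iff)
  define a where "a = expect_off p {?b} (\<lambda>C. of_bool (conn C 0 x))"
  \<comment> \<open>Off the bond itself, a connection to \<open>x\<close> either avoids
    \<open>?e\<close> altogether or passes through it; the two cases give \<open>tau_dir\<close> and
    the first term of order 0.\<close>
  have a: "a = ennreal (tau_dir p \<iota> x) + dir_sum (thr_event x) \<iota> 0"
  proof -
    have "a = expect_off p {} (\<lambda>C. of_bool (conn (C - bonds_at {?e}) 0 x) + of_bool (conn_through (C - {?b}) {?e} 0 x))"
      unfolding a_def expect_off_def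
    proof (intro nn_integral_cong)
      fix \<omega> :: "'d bond \<Rightarrow> bool"
      let ?C = "occupied \<omega>"
      have eq: "?C - {?b} - bonds_at {?e} = ?C - bonds_at {?e}" using b by (auto simp: bonds_at_def)
      have "conn (?C - {?b}) 0 x" if "conn (?C - bonds_at {?e}) 0 x"
        by (rule conn_mono[OF that]) (use b in \<open>auto simp: bonds_at_def\<close>)
      then show "(of_bool (conn (?C - {?b}) 0 x) :: ennreal) =
          of_bool (conn (?C - {} - bonds_at {?e}) 0 x) + of_bool (conn_through (?C - {} - {?b}) {?e} 0 x)"
        using unit_vec_ne_0[of \<iota>] by (auto simp: conn_through_iff eq)
    qed
    also have "\<dots> = expect_off p {} (\<lambda>C. of_bool (conn (C - bonds_at {?e}) 0 x)) +
        expect_off p {} (\<lambda>C. of_bool (conn_through (C - {?b}) {?e} 0 x))"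
      by (rule expect_off_add) measurable
    also have "expect_off p {} (\<lambda>C. of_bool (conn (C - bonds_at {?e}) 0 x)) = expect_off p (bonds_at {?e}) (\<lambda>C. of_bool (conn C 0 x))"
      by (simp add: expect_off_def)
    also have "\<dots> = ennreal (tau_dir p \<iota> x)"
      unfolding tau_dir_def by (rule expect_off_of_bool) measurable
    also have "expect_off p {} (\<lambda>C. of_bool (conn_through (C - {?b}) {?e} 0 x)) = dir_sum (thr_event x) \<iota> 0"
      by (simp add: expect_off_def dir_sum_def nested_sum_0 thr_event_def)
    finally show ?thesis .
  qed
  have tau: "ennreal (tau p x) = a + expect_off p {} (\<lambda>C. of_bool (first_pivotal C 0 x {0} (0, ?e)))"
  proof -
    have "ennreal (tau p x) = expect_off p {} (\<lambda>C. of_bool (conn C 0 x))"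
      unfolding tau_def by (rule expect_off_of_bool[symmetric]) measurable
    also have "\<dots> = expect_off p {} (\<lambda>C. of_bool (conn (C - {?b}) 0 x) + of_bool (first_pivotal C 0 x {0} (0, ?e)))"
    proof (rule expect_off_cong)
      fix C :: "'d bond set" assume C: "C \<subseteq> bonds"
      have 1: "conn C 0 x \<and> \<not> conn (C - {?b}) 0 x" if "first_pivotal C 0 x {0} (0, ?e)"
        using first_pivotal_imp(1)[OF C that] that pivotal_imp_conn[of C "(0, ?e)" 0 x]
        by (auto simp: pivotal_iff ub first_pivotal_def)
      have 2: "first_pivotal C 0 x {0} (0, ?e)" if c: "conn C 0 x" and n: "\<not> conn (C - {?b}) 0 x"
      proof -
        obtain u w where *: "?b = {u, w}" "?b \<in> C" "conn (C - {?b}) 0 u" "\<not> conn (C - {?b}) 0 w"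
          using conn_leaves_cluster[OF c n] by metis
        have "w \<noteq> 0" using *(4) by auto
        then have "w = ?e" using *(1) by (auto simp: doubleton_eq_iff)
        then have piv: "pivotal C (0, ?e) 0 x"
          using pivotal_orient[OF c, of "(0, ?e)"] n *(4) by (simp add: ub)
        show ?thesis
          using pivotal_imp_first_off[OF C piv] E0 *(2) by (simp add: first_pivotal_def ub)
      qed
      have 3: "conn C 0 x" if "conn (C - {?b}) 0 x" using that by (rule conn_mono) auto
      show "(of_bool (conn (C - {}) 0 x) :: ennreal) =
          of_bool (conn (C - {} - {?b}) 0 x) + of_bool (first_pivotal (C - {}) 0 x {0} (0, ?e))"
        unfolding Diff_empty by (rule of_bool_exclusive_or) (fact 1 2 3)+
    qed
    also have "\<dots> = expect_off p {} (\<lambda>C. of_bool (conn (C - {?b}) 0 x)) +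
        expect_off p {} (\<lambda>C. of_bool (first_pivotal C 0 x {0} (0, ?e)))"
      by (rule expect_off_add) measurable
    also have "expect_off p {} (\<lambda>C. of_bool (conn (C - {?b}) 0 x)) = a"
      by (simp add: a_def expect_off_def)
    finally show ?thesis .
  qed
  have piv: "expect_off p {} (\<lambda>C. of_bool (first_pivotal C 0 x {0} (0, ?e))) =
      ennreal p * expect_off p {?b} (\<lambda>C. ?W C * tau_off p (?S C) ?e x)"
    using expect_first_pivotal[OF chi_finite p_le_1(1,2) good_origin[of 0 "{0}"] db, of x] E0
    by (simp add: ub expect_off_def cluster_off_def)
  \<comment> \<open>The connection off the random cluster is completed to one off the bonds at the
    origin. This factor is deterministic and leaves the probability that \<open>?e\<close> is
    outside the cluster, which times \<open>p\<close> is \<mu>.\<close>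
  have tail: "expect_off p {?b} (\<lambda>C. ?W C * tau_off p (?S C) ?e x) + dir_tail (thr_event x) \<iota> 0 =
      ennreal (tau_dir p (opp \<iota>) (x - ?e)) * expect_off p {?b} ?W"
  proof -
    let ?t = "ennreal (tau_dir p (opp \<iota>) (x - ?e))"
    have t: "?t = ennreal (prob_off p (bonds_at {0}) (\<lambda>C. conn C ?e x))"
      using tau_dir_translate[of p 0 "opp \<iota>" x] by (simp add: unit_vec_opp)
    have "expect_off p {?b} (\<lambda>C. ?W C * tau_off p (?S C) ?e x) + dir_tail (thr_event x) \<iota> 0 =
        expect_off p {?b} (\<lambda>C. ?W C * tau_off p (?S C) ?e x +
          ?W C * nested_sum p (thr_event x) (bonds_at {0}) {0} 0 ?e (?S C))"
      unfolding dir_tail_def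
      by (rule expect_off_add[symmetric]; rule measurable_dir_tail)
        (rule measurable_tau_off measurable_nested_sum_events)+
    also have "\<dots> = expect_off p {?b} (\<lambda>C. ?t * ?W C)"
    proof (rule expect_off_cong)
      fix C :: "'d bond set"
      have "0 \<in> ?S (C - {?b})" by (simp add: in_cluster_off)
      then show "?W (C - {?b}) * tau_off p (?S (C - {?b})) ?e x +
          ?W (C - {?b}) * nested_sum p (thr_event x) (bonds_at {0}) {0} 0 ?e (?S (C - {?b})) = ?t * ?W (C - {?b})"
        using tau_off_split[of ?e "?S (C - {?b})" 0 p x]
        by (cases "?e \<in> ?S (C - {?b})") (simp_all add: t nested_sum_0 thr_event_def)
    qed
    also have "\<dots> = ?t * expect_off p {?b} ?W"
      by (rule expect_off_cmult) measurable
    finally show ?thesis .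
  qed
  have mu: "ennreal p * expect_off p {?b} ?W = ennreal (mu TYPE('d) p)"
  proof -
    have "expect_off p {?b} ?W = ennreal (prob_off p {?b} (\<lambda>C. ?e \<notin> ?S C))"
      by (rule expect_off_of_bool) measurable
    also have "prob_off p {?b} (\<lambda>C. ?e \<notin> ?S C) = prob_off p {} (\<lambda>C. ?e \<notin> ?S C)"
      by (rule prob_off_cong) (simp add: cluster_off_def)
    finally show ?thesis using mu_eq[OF p_le_1(1,3), of \<iota>] p_le_1 by (simp add: ennreal_mult prob_off_nonneg)
  qed
  have "ennreal (tau p x) + ennreal p * dir_tail (thr_event x) \<iota> 0 =
      a + ennreal p * (expect_off p {?b} (\<lambda>C. ?W C * tau_off p (?S C) ?e x) + dir_tail (thr_event x) \<iota> 0)"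
    unfolding tau piv by (simp add: distrib_left add.assoc)
  also have "\<dots> = ennreal (tau_dir p \<iota> x) + dir_sum (thr_event x) \<iota> 0 +
      ennreal (mu TYPE('d) p) * ennreal (tau_dir p (opp \<iota>) (x - ?e))"
    unfolding tail a mu[symmetric] by (simp add: ac_simps)
  finally have main: "ennreal (tau p x) + ennreal p * dir_tail (thr_event x) \<iota> 0 =
      ennreal (tau_dir p \<iota> x) + dir_sum (thr_event x) \<iota> 0 +
      ennreal (mu TYPE('d) p) * ennreal (tau_dir p (opp \<iota>) (x - ?e))" .
  have mu0: "0 \<le> mu TYPE('d) p" using mu_pos[of p, where 'd = 'd] p p_le_1 by simp
  \<comment> \<open>All terms are finite, so the identity can be read in the reals.\<close>
  obtain r1 where r1: "dir_tail (thr_event x) \<iota> 0 = ennreal r1" "0 \<le> r1"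
    using dir_tail_finite(1)[of x \<iota> 0] by (cases "dir_tail (thr_event x) \<iota> 0") auto
  obtain r2 where r2: "dir_sum (thr_event x) \<iota> 0 = ennreal r2" "0 \<le> r2"
    using dir_sum_finite(1)[of x \<iota> 0] by (cases "dir_sum (thr_event x) \<iota> 0") auto
  have t0: "0 \<le> tau p x" by (simp add: tau_def prob_off_nonneg)
  define m where "m = mu TYPE('d) p * tau_dir p (opp \<iota>) (x - ?e)"
  have m: "0 \<le> m" "ennreal (mu TYPE('d) p) * ennreal (tau_dir p (opp \<iota>) (x - ?e)) = ennreal m"
    using mu0 tau_dir_nonneg[of p "opp \<iota>" "x - ?e"] by (simp_all add: m_def ennreal_mult)
  have pr: "0 \<le> p * r1" "ennreal p * ennreal r1 = ennreal (p * r1)"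
    using p_le_1(1) r1(2) by (simp_all add: ennreal_mult)
  have "ennreal (tau p x + p * r1) = ennreal (tau_dir p \<iota> x + r2 + m)"
    using main[unfolded r1(1) r2(1) m(2) pr(2)] t0 pr(1) m(1) r2(2) tau_dir_nonneg[of p \<iota> x]
    by (simp only: ennreal_plus add_nonneg_nonneg)
  moreover have "0 \<le> tau_dir p \<iota> x + r2 + m" using m(1) r2(2) tau_dir_nonneg[of p \<iota> x] by simp
  ultimately have "tau p x + p * r1 = tau_dir p \<iota> x + r2 + m"
    using t0 pr(1) ennreal_inj[of "tau p x + p * r1" "tau_dir p \<iota> x + r2 + m"] by simp
  then show ?thesis using r1 r2 by (simp add: m_def)
qed

lemma second_expansion:
  fixes x :: "(int, 'd) vec" and \<iota> :: "'d dir"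
  assumes M: "M \<ge> 1"
  defines "T \<equiv> \<lambda>\<kappa> y. tau_dir p \<kappa> (x - y + unit_vec \<kappa>)"
  defines "g \<equiv> \<lambda>(y, \<kappa>). (\<Sum>N=0..M. (- 1) ^ N * Pi_dir p N \<iota> \<kappa> y) * T \<kappa> y"
  defines "r \<equiv> \<lambda>(y, \<kappa>). Pi_dir p M \<iota> \<kappa> y * T \<kappa> y"
  shows "g summable_on UNIV" "r summable_on UNIV"
    "tau p x - tau_dir p \<iota> x - mu TYPE('d) p * tau_dir p (opp \<iota>) (x - unit_vec \<iota>) -
       (\<Sum>\<^sub>\<infinity>z\<in>UNIV. g z) - (\<Sum>N=0..M. (- 1) ^ N * Xi_dir p N \<iota> x) \<le> (\<Sum>\<^sub>\<infinity>z\<in>UNIV. r z)"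
proof -
  let ?T = "\<lambda>z :: (int, 'd) vec \<times> 'd dir. tau_dir p (snd z) (x - fst z + unit_vec (snd z))"
  define q where "q N z = enn2real (Pi_coeff \<iota> N z) * ?T z" for N z
  define s where "s N = enn2real (dir_Psi_sum x \<iota> N)" for N
  have fin: "Pi_coeff \<iota> N z < \<infinity>" for N and z :: "(int, 'd) vec \<times> 'd dir"
    unfolding Pi_coeff_def using dir_sum_finite(3) by (simp add: ennreal_mult_less_top)
  have q: "(q N has_sum s N) UNIV" for N
    unfolding q_def[abs_def] s_def by (intro coeff_has_sum fin tau_dir_nonneg Pi_coeff_sum dir_Psi_sum_finite)
  have g: "g z = (\<Sum>N=0..M. (- 1) ^ N * q N z)" for z
    by (cases z) (simp add: g_def q_def Pi_dir_eq T_def sum_distrib_right mult.assoc)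
  from alternating_has_sum[where q = q and s = s and M = M, OF q]
  have hg: "(g has_sum (\<Sum>N=0..M. (- 1) ^ N * s N)) UNIV" by (simp only: ext[of g, OF g])
  then show "g summable_on UNIV" by (rule has_sum_imp_summable)
  from hg have G: "infsum g UNIV = (\<Sum>N=0..M. (- 1) ^ N * s N)" by (rule infsumI)
  have r: "r = q M" by (auto simp: fun_eq_iff r_def q_def Pi_dir_eq T_def)
  show "r summable_on UNIV" unfolding r by (rule has_sum_imp_summable[OF q])
  have R: "infsum r UNIV = s M" unfolding r by (rule infsumI[OF q])
  \<comment> \<open>By \<open>tau_dir_decomp\<close>, the value at 0 is that of
    \<open>dir_sum (thr_event x) \<iota> 0\<close> minus \<open>p\<close> times that of
    \<open>dir_tail (thr_event x) \<iota> 0\<close>. The subtracted tail cancels the one contained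
    in order 1.\<close>
  define \<rho> where "\<rho> N = (if N = 0 then tau p x - tau_dir p \<iota> x - mu TYPE('d) p * tau_dir p (opp \<iota>) (x - unit_vec \<iota>)
     else enn2real (dir_sum (thr_event x) \<iota> N))" for N
  let ?a = "\<lambda>N. nested_sum p (thr_event x) {{0, unit_vec \<iota>}} {} N 0 {unit_vec \<iota>}"
  have "\<rho> 0 - (\<Sum>N=0..M. (- 1) ^ N * s N) - (\<Sum>N=0..M. (- 1) ^ N * Xi_dir p N \<iota> x) \<le> s M"
  proof (rule alternating_remainder_le)
    fix N
    show "\<rho> N + \<rho> (Suc N) = Xi_dir p N \<iota> x + s N"
    proof (cases N)
      case (Suc K)
      then show ?thesis
        unfolding \<rho>_def s_def Xi_dir_eq
        using enn2real_sum_eq[OF dir_sum_Suc_expand[of x \<iota> K] dir_sum_finite(1) dir_sum_finite(1) dir_sum_finite(2) dir_Psi_sum_finite]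
        by simp
    next
      case 0
      have "enn2real (?a 0) + enn2real (?a (Suc 0)) = enn2real (dir_sum (E_event x) \<iota> 0) + s 0"
        using enn2real_sum_eq[OF dir_sum_expand[of x \<iota> 0] nested_sum_finite(1) nested_sum_finite(1) nested_sum_finite(2) Psi_sum_finite]
        by (simp add: s_def dir_Psi_sum_eq dir_sum_def)
      moreover have "enn2real (dir_sum (thr_event x) \<iota> (Suc 0)) = enn2real (?a (Suc 0)) + p * enn2real (dir_tail (thr_event x) \<iota> 0)"
        using nested_sum_finite(1)[of x] dir_tail_finite(1)[of x \<iota> 0] p_le_1
        by (simp add: dir_sum_def enn2real_plus enn2real_mult ennreal_mult_less_top)
      moreover have "dir_sum (thr_event x) \<iota> 0 = ?a 0" by (simp add: dir_sum_def)
      ultimately show ?thesis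
        using tau_dir_decomp[of x \<iota>] 0 by (simp add: \<rho>_def Xi_dir_eq)
    qed
  next
    show "0 \<le> \<rho> (Suc M)" by (simp add: \<rho>_def)
    show "\<rho> (Suc M) \<le> s M"
      unfolding s_def \<rho>_def using dir_sum_thr_le[OF M, of x \<iota>] dir_Psi_sum_finite[of x \<iota> M] by (simp add: enn2real_mono)
  qed
  then show "tau p x - tau_dir p \<iota> x - mu TYPE('d) p * tau_dir p (opp \<iota>) (x - unit_vec \<iota>) -
       (\<Sum>\<^sub>\<infinity>z\<in>UNIV. g z) - (\<Sum>N=0..M. (- 1) ^ N * Xi_dir p N \<iota> x) \<le> (\<Sum>\<^sub>\<infinity>z\<in>UNIV. r z)"
    unfolding G R by (simp add: \<rho>_def)
qed

end

theorem proposition2p1: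
  fixes p :: real and M :: nat
  assumes "0 < p" and "p < p_crit TYPE('d::{finite,linorder})" and "M \<ge> 1"
  shows "\<exists>(R :: int ^ ('d::{finite,linorder}) \<Rightarrow> real) 
      (R_dir :: 'd dir \<Rightarrow> int ^ ('d::{finite,linorder}) \<Rightarrow> real). \<forall>x \<iota>.
    (let
       Psi_M = (\<lambda>\<kappa> y. \<Sum>N=0..M. (- 1) ^ N * Psi p N \<kappa> y);
       Pi_M = (\<lambda>\<kappa> y. \<Sum>N=0..M. (- 1) ^ N * Pi_dir p N \<iota> \<kappa> y);
       Xi_M = R x + (\<Sum>N=0..M. (- 1) ^ N * Xi p N x);
       Xi_dir_M = R_dir \<iota> x + (\<Sum>N=0..M. (- 1) ^ N * Xi_dir p N \<iota> x);
       T = (\<lambda>\<kappa> y. tau_dir p \<kappa> (x - y + unit_vec \<kappa>));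
       f = (\<lambda>(y, \<kappa>). (of_bool (y = 0) + Psi_M \<kappa> y) * T \<kappa> y);
       g = (\<lambda>(y, \<kappa>). Pi_M \<kappa> y * T \<kappa> y);
       r = (\<lambda>(y, \<kappa>). Psi p M \<kappa> y * T \<kappa> y);
       r_dir = (\<lambda>(y, \<kappa>). Pi_dir p M \<iota> \<kappa> y * T \<kappa> y)
     in
       f summable_on UNIV \<and> g summable_on UNIV \<and> r summable_on UNIV \<and> r_dir summable_on UNIV \<and>
       tau p x = of_bool (x = 0) + mu TYPE('d) p * (\<Sum>\<^sub>\<infinity>z\<in>UNIV. f z) + Xi_M \<and>
       tau p x = tau_dir p \<iota> x + mu TYPE('d) p * tau_dir p (opp \<iota>) (x - unit_vec \<iota>)
                 + (\<Sum>\<^sub>\<infinity>z\<in>UNIV. g z) + Xi_dir_M \<and>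
       R x \<le> mu TYPE('d) p * (\<Sum>\<^sub>\<infinity>z\<in>UNIV. r z) \<and>
       R_dir \<iota> x \<le> (\<Sum>\<^sub>\<infinity>z\<in>UNIV. r_dir z))"
proof -
  \<comment> \<open>The remainders are obtained by solving the two identities for them, so that
    their upper bounds carry the content.\<close>
  define R where "R x = tau p x - of_bool (x = 0) - mu TYPE('d) p *
      (\<Sum>\<^sub>\<infinity>z\<in>UNIV. (\<lambda>(y, \<kappa>). (of_bool (y = 0) + (\<Sum>N=0..M. (- 1) ^ N * Psi p N \<kappa> y)) *
        tau_dir p \<kappa> (x - y + unit_vec \<kappa>)) z) - (\<Sum>N=0..M. (- 1) ^ N * Xi p N x)"
    for x :: "(int, 'd) vec"
  define R_dir where "R_dir \<iota> x = tau p x - tau_dir p \<iota> x - mu TYPE('d) p * tau_dir p (opp \<iota>) (x - unit_vec \<iota>) -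
      (\<Sum>\<^sub>\<infinity>z\<in>UNIV. (\<lambda>(y, \<kappa>). (\<Sum>N=0..M. (- 1) ^ N * Pi_dir p N \<iota> \<kappa> y) *
        tau_dir p \<kappa> (x - y + unit_vec \<kappa>)) z) - (\<Sum>N=0..M. (- 1) ^ N * Xi_dir p N \<iota> x)"
    for \<iota> :: "'d dir" and x
  show ?thesis
    unfolding Let_def
  proof (rule exI[of _ R], rule exI[of _ R_dir], intro allI conjI)
    fix x :: "(int, 'd) vec" and \<iota> :: "'d dir"
    note 1 = first_expansion[OF assms, where x = x]
      and 2 = second_expansion[OF assms, where x = x and \<iota> = \<iota>]
    show "R x \<le> mu TYPE('d) p * (\<Sum>\<^sub>\<infinity>z\<in>UNIV. (\<lambda>(y, \<kappa>). Psi p M \<kappa> y * tau_dir p \<kappa> (x - y + unit_vec \<kappa>)) z)"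
      unfolding R_def by (rule 1(3))
    show "R_dir \<iota> x \<le> (\<Sum>\<^sub>\<infinity>z\<in>UNIV. (\<lambda>(y, \<kappa>). Pi_dir p M \<iota> \<kappa> y * tau_dir p \<kappa> (x - y + unit_vec \<kappa>)) z)"
      unfolding R_dir_def by (rule 2(3))
  qed (fact first_expansion(1,2)[OF assms] second_expansion(1,2)[OF assms] | simp add: R_def R_dir_def)+
qed

end
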